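(* For all $n \in \omega$, $${}^1(\mathsf{WWKL}^{(n)}) \equiv_{\mathrm{sW}} {}^1(\mathsf{WKL}^{(n)}) \equiv_{\mathrm{sW}} (\mathsf{C}_2^* )^{(n)}.$$
   Context: A problem is a partial multifunction $\mathsf{P} :\subseteq \omega^\omega \rightrightarrows \omega^\omega$. Each $f \in \mathrm{dom}(\mathsf{P})$ (so $\mathsf{P}(f) \neq \emptyset$) is a $\mathsf{P}$-instance, and each $g \in \mathsf{P}(f)$ is a $\mathsf{P}$-solution to $f$. Sets are identified with their characteristic functions, and objects such as trees are coded by elements of $\omega^\omega$ in the standard way. The set $\omega$ is embedded in $\omega^\omega$ by identifying $x \in \omega$ with the $f \in \omega^\omega$ such that $f(0)=x$ and $f(y)=0$ for all $y>0$; finite tuples of numbers are coded as single numbers. Angle brackets denote Turing joins (tuples), with the number of components uniformly computable from the join. Turing functionals are regarded as partial maps $\omega^\omega \to \omega^\omega$, $\Psi(f,g)$ means $\Psi(\langle f,g\rangle)$, and $\Psi(f)(x)$ is the value at $x$ of the computation with oracle $f$. When a Turing functional is part of an instance, it is given by an index in a fixed computable listing of all Turing functionals. $\mathsf{Q} \leq_{\mathrm{sW}} \mathsf{P}$ (strongly Weihrauch reducible) if there are Turing functionals $\Phi,\Psi$ such that for all $f \in \mathrm{dom}(\mathsf{Q})$ we have $\Phi(f) \in \mathrm{dom}(\mathsf{P})$, and for every $g \in \mathsf{P}(\Phi(f))$ we have $\Psi(g) \in \mathsf{Q}(f)$. $\equiv_{\mathrm{sW}}$ is the induced equivalence relation.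 The first-order part ${}^1\mathsf{P}$ of a problem $\mathsf{P}$ is the following problem. Its instances are all triples $\langle f,\Phi,\Psi\rangle$, where $f \in \omega^\omega$ and $\Phi,\Psi$ are Turing functionals such that $\Phi(f) \in \mathrm{dom}(\mathsf{P})$ and $\Psi(f,g)(0)\downarrow$ for all $g \in \mathsf{P}(\Phi(f))$. The solutions to such an instance are all $y \in \omega$ such that $\Psi(f,g)(0)\downarrow = y$ for some $g \in \mathsf{P}(\Phi(f))$. The jump $\mathsf{P}'$ of a problem $\mathsf{P}$ has as instances all pairs $\langle f,i\rangle$ such that $f \in \omega^\omega$ and $i$ is a $\Delta^{0,f}_2$ index for a $\mathsf{P}$-instance $g$; the solutions to $\langle f,i\rangle$ are all the $\mathsf{P}$-solutions to $g$. $\mathsf{P}^{(0)}=\mathsf{P}$ and $\mathsf{P}^{(n+1)}=(\mathsf{P}^{(n)})'$. The finite parallelization $\mathsf{P}^*$ has as instances all $\langle k,\langle f_0,\ldots,f_{k-1}\rangle\rangle$ where $k \geq 1$ and $f_0,\ldots,f_{k-1}$ are $\mathsf{P}$-instances; its solutions are all tuples $\langle g_0,\ldots,g_{k-1}\rangle$ with $g_j \in \mathsf{P}(f_j)$ for all $j<k$. $\mathsf{C}_2$ (choice on $\{0,1\}$): instances are all enumerations of proper subsets of $\{0,1\}$; solutions are all $i \in \{0,1\}$ that are not enumerated. Explicitly, an instance is a function $v : \omega \to \{0,1,2\}$ with $\{0,1\} \nsubseteq \mathrm{ran}(v)$, such that if $v(s)\neq v(t)$ for some $s<t$ then $v(t)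 \neq 2$, and if $v(s)=v(t)$ for some $s<t$ then $v(s)=v(u)=v(t)$ for all $s<u<t$. The value $2$ means that nothing has been enumerated yet, and the solutions are the $i<2$ with $i \notin \mathrm{ran}(v)$. $\mathsf{WKL}$ (weak König's lemma): instances are all infinite trees $T \subseteq 2^{<\omega}$; solutions are all infinite paths through $T$, i.e., elements of $[T] \subseteq 2^\omega$. $\mathsf{WWKL}$ is the restriction of $\mathsf{WKL}$ to trees $T$ such that $[T]$ has positive Lebesgue measure. *)

theory Defs
  imports "HOL-Probability.Probability" "HOL-Library.Nat_Bijection" "HOL-Library.Sublist"
begin

section \<open>Turing functionals\<close>

type_synonym baire = "nat \<Rightarrow> nat"

text \<open>
  Partial recursive functions relative to an oracle, presented as unary functions on numbers, with
  several arguments combined by the pairing \<^const>\<open>prod_encode\<close>.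
\<close>

datatype prog =
    PZero | PSucc | PFst | PSnd | POracle
  | PPair prog prog
  | PComp prog prog
  | PRec prog prog
  | PMu prog

primrec eval :: "baire \<Rightarrow> prog \<Rightarrow> nat \<Rightarrow> nat option" where
  "eval f PZero x = Some 0"
| "eval f PSucc x = Some (Suc x)"
| "eval f PFst x = Some (fst (prod_decode x))"
| "eval f PSnd x = Some (snd (prod_decode x))"
| "eval f POracle x = Some (f x)"
| "eval f (PPair p q) x =
     Option.bind (eval f p x) (\<lambda>a. Option.bind (eval f q x) (\<lambda>b. Some (prod_encode (a, b))))"
| "eval f (PComp p q) x = Option.bind (eval f q x) (eval f p)"
| "eval f (PRec p q) x =
     rec_nat (eval f p (fst (prod_decode x)))
       (\<lambda>n r. Option.bind r
          (\<lambda>a. eval f q (prod_encode (fst (prod_decode x), prod_encode (n, a)))))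
       (snd (prod_decode x))"
| "eval f (PMu p) x =
     (if \<exists>n. eval f p (prod_encode (x, n)) = Some 0 \<and>
             (\<forall>m<n. eval f p (prod_encode (x, m)) \<noteq> None)
      then Some (LEAST n. eval f p (prod_encode (x, n)) = Some 0) else None)"

text \<open>The fixed computable listing of all programs.\<close>

function prog_of :: "nat \<Rightarrow> prog" where
  "prog_of n =
    (if n = 0 then PZero else if n = 1 then PSucc else if n = 2 then PFst
     else if n = 3 then PSnd else if n = 4 then POracle
     else let m = (n - 5) div 4; r = (n - 5) mod 4 in
       if r = 0 then PPair (prog_of (fst (prod_decode m))) (prog_of (snd (prod_decode m)))
       else if r = 1 then PComp (prog_of (fst (prod_decode m))) (prog_of (snd (prod_decode m)))
       else if r = 2 then PRec (prog_of (fst (prod_decode m))) (prog_of (snd (prod_decode m)))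
       else PMu (prog_of m))"

  by auto

lemma prod_decode_le: "fst (prod_decode m) \<le> m" "snd (prod_decode m) \<le> m"
  by (metis le_prod_encode_1 prod.collapse prod_decode_inverse,
      metis le_prod_encode_2 prod.collapse prod_decode_inverse)

termination
  by (relation "Wellfounded.measure id")
    (auto intro!: le_less_trans[OF prod_decode_le(1)] le_less_trans[OF prod_decode_le(2)])

declare prog_of.simps [simp del]

lemma surj_prog_of: "surj prog_of"
proof -
  have div4: "Suc (4 * m) div 4 = m" "Suc (Suc (4 * m)) div 4 = m"
    "Suc (Suc (Suc (4 * m))) div 4 = m" for m :: nat
    by presburger+
  have "\<exists>n. prog_of n = p" for p
  proof (induction p)
    case PZero
    show ?case by (rule exI[of _ 0]) (simp add: prog_of.simps)
  next
    case PSucc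
    show ?case by (rule exI[of _ 1]) (simp add: prog_of.simps)
  next
    case PFst
    show ?case by (rule exI[of _ 2]) (simp add: prog_of.simps)
  next
    case PSnd
    show ?case by (rule exI[of _ 3]) (simp add: prog_of.simps)
  next
    case POracle
    show ?case by (rule exI[of _ 4]) (simp add: prog_of.simps)
  next
    case (PPair p q)
    then obtain a b where "prog_of a = p" "prog_of b = q" by blast
    then show ?case
      by (intro exI[of _ "5 + 4 * prod_encode (a, b)"]) (subst prog_of.simps, simp add: Let_def)
  next
    case (PComp p q)
    then obtain a b where "prog_of a = p" "prog_of b = q" by blast
    then show ?case
      by (intro exI[of _ "6 + 4 * prod_encode (a, b)"])
        (subst prog_of.simps, simp add: Let_def mod_Suc div4)
  next
    case (PRec p q)
    then obtain a b where "prog_of a = p" "prog_of b = q" by blast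
    then show ?case
      by (intro exI[of _ "7 + 4 * prod_encode (a, b)"])
        (subst prog_of.simps, simp add: Let_def mod_Suc div4)
  next
    case (PMu p)
    then obtain a where "prog_of a = p" by blast
    then show ?case
      by (intro exI[of _ "8 + 4 * a"]) (subst prog_of.simps, simp add: Let_def mod_Suc div4)
  qed
  then show ?thesis by (metis surj_def)
qed

text \<open>
  \<open>\<phi> e f x\<close> is the value at \<open>x\<close> of the \<open>e\<close>-th Turing functional with oracle \<open>f\<close>. As a
  partial map on Baire space the functional is defined at \<open>f\<close> only if all values converge.
\<close>

definition \<phi> :: "nat \<Rightarrow> baire \<Rightarrow> nat \<Rightarrow> nat option" where
  "\<phi> e f x = eval f (prog_of e) x"

definition maps_to :: "nat \<Rightarrow> baire \<Rightarrow> baire \<Rightarrow> bool" where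
  "maps_to e f g \<longleftrightarrow> (\<forall>x. \<phi> e f x = Some (g x))"

section \<open>Coding\<close>

definition num :: "nat \<Rightarrow> baire" where
  "num x = (\<lambda>y. if y = 0 then x else 0)"

definition char_fun :: "nat set \<Rightarrow> baire" where
  "char_fun A = (\<lambda>x. if x \<in> A then 1 else 0)"

text \<open>
  The Turing join of a finite list of functions; its value at \<open>0\<close> is the number of components.
\<close>

definition tjoin :: "baire list \<Rightarrow> baire" where
  "tjoin fs x =
    (case x of 0 \<Rightarrow> length fs
     | Suc m \<Rightarrow> (let (i, y) = prod_decode m in if i < length fs then (fs ! i) y else 0))"

lemma inj_tjoin: "inj tjoin"
proof (rule injI)
  fix fs gs assume eq: "tjoin fs = tjoin gs"
  have len: "length fs = length gs"
    using fun_cong[OF eq, of 0] by (simp add: tjoin_def)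
  show "fs = gs"
  proof (rule nth_equalityI[OF len])
    fix i assume i: "i < length fs"
    show "fs ! i = gs ! i"
    proof
      fix y show "(fs ! i) y = (gs ! i) y"
        using fun_cong[OF eq, of "Suc (prod_encode (i, y))"] i len by (simp add: tjoin_def)
    qed
  qed
qed

section \<open>Problems\<close>

text \<open>
  A partial multifunction is given by its solution sets; its domain consists of the points with a
  nonempty solution set.
\<close>

type_synonym problem = "baire \<Rightarrow> baire set"

definition instances :: "problem \<Rightarrow> baire set" where
  "instances P = {f. P f \<noteq> {}}"

definition sW_le :: "problem \<Rightarrow> problem \<Rightarrow> bool" (infix \<open>\<le>\<^sub>s\<^sub>W\<close> 50) where
  "Q \<le>\<^sub>s\<^sub>W P \<longleftrightarrow>
    (\<exists>d e. \<forall>f \<in> instances Q.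
      \<exists>h \<in> instances P. maps_to d f h \<and> (\<forall>g \<in> P h. \<exists>k \<in> Q f. maps_to e g k))"

definition sW_equiv :: "problem \<Rightarrow> problem \<Rightarrow> bool" (infix \<open>\<equiv>\<^sub>s\<^sub>W\<close> 50) where
  "Q \<equiv>\<^sub>s\<^sub>W P \<longleftrightarrow> Q \<le>\<^sub>s\<^sub>W P \<and> P \<le>\<^sub>s\<^sub>W Q"

definition first_order_part :: "problem \<Rightarrow> problem" where
  "first_order_part P = (\<lambda>p. {num y | y f d e h.
      p = tjoin [f, num d, num e] \<and> maps_to d f h \<and> h \<in> instances P \<and>
      (\<forall>g \<in> P h. \<phi> e (tjoin [f, g]) 0 \<noteq> None) \<and>
      (\<exists>g \<in> P h. \<phi> e (tjoin [f, g]) 0 = Some y)})"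

text \<open>
  Indices in the arithmetical hierarchy relative to \<open>f\<close>: a \<open>\<Sigma>\<^sub>2\<close> (\<open>\<Pi>\<^sub>2\<close>) index is an index for the
  \<open>f\<close>-computable matrix, a \<open>\<Delta>\<^sub>2\<close> index is a pair of a \<open>\<Sigma>\<^sub>2\<close> index and a \<open>\<Pi>\<^sub>2\<close> index for the same
  set, and a \<open>\<Delta>\<^sub>2\<close> index for a function is one for its graph.
\<close>

definition Sigma2_index :: "baire \<Rightarrow> nat \<Rightarrow> nat set \<Rightarrow> bool" where
  "Sigma2_index f e A \<longleftrightarrow>
    (\<exists>R. maps_to e f (char_fun R) \<and>
      A = {x. \<exists>u. \<forall>v. prod_encode (x, prod_encode (u, v)) \<in> R})"

definition Pi2_index :: "baire \<Rightarrow> nat \<Rightarrow> nat set \<Rightarrow> bool" where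
  "Pi2_index f e A \<longleftrightarrow>
    (\<exists>R. maps_to e f (char_fun R) \<and>
      A = {x. \<forall>u. \<exists>v. prod_encode (x, prod_encode (u, v)) \<in> R})"

definition Delta2_index :: "baire \<Rightarrow> nat \<Rightarrow> baire \<Rightarrow> bool" where
  "Delta2_index f i g \<longleftrightarrow>
    (\<exists>a b. i = prod_encode (a, b) \<and>
      Sigma2_index f a {prod_encode (x, g x) | x. True} \<and>
      Pi2_index f b {prod_encode (x, g x) | x. True})"

definition jump :: "problem \<Rightarrow> problem" where
  "jump P = (\<lambda>p. {h. \<exists>f i g. p = tjoin [f, num i] \<and> Delta2_index f i g \<and> h \<in> P g})"

definition iter_jump :: "problem \<Rightarrow> nat \<Rightarrow> problem" where
  "iter_jump P n = (jump ^^ n) P"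

definition finite_parallelization :: "problem \<Rightarrow> problem" where
  "finite_parallelization P = (\<lambda>p. {tjoin gs | gs k fs.
      p = tjoin [num k, tjoin fs] \<and> 1 \<le> k \<and> length fs = k \<and> length gs = k \<and>
      (\<forall>j<k. gs ! j \<in> P (fs ! j))})"

section \<open>The problems in question\<close>

definition C2_instance :: "baire \<Rightarrow> bool" where
  "C2_instance v \<longleftrightarrow>
    range v \<subseteq> {0, 1, 2} \<and> \<not> {0, 1} \<subseteq> range v \<and>
    (\<forall>s t. s < t \<and> v s \<noteq> v t \<longrightarrow> v t \<noteq> 2) \<and>
    (\<forall>s t u. s < u \<and> u < t \<and> v s = v t \<longrightarrow> v s = v u \<and> v u = v t)"

definition C2 :: problem where
  "C2 v = (if C2_instance v then {num i | i. i < 2 \<and> i \<notin> range v} else {})"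

definition is_tree :: "bool list set \<Rightarrow> bool" where
  "is_tree T \<longleftrightarrow> (\<forall>\<sigma>\<in>T. \<forall>\<tau>. prefix \<tau> \<sigma> \<longrightarrow> \<tau> \<in> T)"

definition tree_code :: "bool list set \<Rightarrow> baire" where
  "tree_code T = char_fun ((\<lambda>\<sigma>. list_encode (map of_bool \<sigma>)) ` T)"

definition paths :: "bool list set \<Rightarrow> (nat \<Rightarrow> bool) set" where
  "paths T = {X. \<forall>n. map X [0..<n] \<in> T}"

definition WKL :: problem where
  "WKL p = {char_fun {n. X n} | X T. p = tree_code T \<and> is_tree T \<and> infinite T \<and> X \<in> paths T}"

text \<open>The uniform measure on Cantor space.\<close>

definition cantor_measure :: "(nat \<Rightarrow> bool) measure" where
  "cantor_measure = (\<Pi>\<^sub>M n\<in>UNIV. measure_pmf (pmf_of_set (UNIV :: bool set)))"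

definition WWKL :: problem where
  "WWKL p = {char_fun {n. X n} | X T. p = tree_code T \<and> is_tree T \<and> infinite T \<and>
    emeasure cantor_measure (paths T) > 0 \<and> X \<in> paths T}"

end

theory Submission
  imports Defs
begin

text \<open>
  \<open>WWKL\<close> is a restriction of \<open>WKL\<close>, so it suffices to reduce the first-order part of \<open>WKL\<^sup>(\<^sup>n\<^sup>)\<close> to
  \<open>(C2\<^sup>*)\<^sup>(\<^sup>n\<^sup>)\<close> and the latter to the first-order part of \<open>WWKL\<^sup>(\<^sup>n\<^sup>)\<close>. Jumps preserve strong
  reductions, because computable functionals map \<open>\<Delta>\<^sub>2\<close> functions to \<open>\<Delta>\<^sub>2\<close> functions uniformly.
  For the first reduction, compactness yields a level of the tree at which the functional has
  converged along all strings; this leaves finitely many candidate values, one of which is never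
  refuted by the tree, and such a candidate is found by finitely many instances of \<open>C2\<close>. For the
  second, the tuples of solutions of finitely many instances of \<open>C2\<close> are initial segments of the
  paths through a tree that is unrestricted from some level on, and hence has positive measure.
\<close>

section \<open>Uniformly computable functionals\<close>

text \<open>Moving the jump past the first-order part is the main obstacle. In an instance of a
  first-order part the \<open>P\<close>-instance is computed from \<open>f\<close>, and the final
  computation consults the same \<open>f\<close>; under a jump the inner instance is only limit
  computable from \<open>f\<close>. \<open>evaluation\<close> separates the two roles, so all jumps
  can be pulled outside and only the unjumped \<open>WKL\<close> needs an argument about trees.
  Conversely, every problem with numbers as solutions that reduces to \<open>P\<close> also reduces
  to the first-order part of \<open>P\<close>; tuples of answers are not numbers, hence the detour
  through \<open>coded_choice\<close>. Reductions are strong: the backward functional sees a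
  solution but no instance. Therefore candidates are the output values themselves, so that the index
  of a component is already the answer. Finally, \<open>eval\<close> has no clock. Convergence is
  expressed by finite certificates with a decidable correctness condition, and these give the
  universal functional, the use principle, and the composition of limit computable maps with
  computable ones.\<close>

abbreviation pfst :: "nat \<Rightarrow> nat" where "pfst n \<equiv> fst (prod_decode n)"
abbreviation psnd :: "nat \<Rightarrow> nat" where "psnd n \<equiv> snd (prod_decode n)"

text \<open>A single program must serve every oracle in \<open>S\<close>, which expresses
  uniformity; convergence is demanded on \<open>S\<close> only, as partial functionals on instances
  require.\<close>

definition computable_on :: "baire set \<Rightarrow> (baire \<Rightarrow> nat \<Rightarrow> nat) \<Rightarrow> bool" where
  "computable_on S F \<longleftrightarrow> (\<exists>p. \<forall>f\<in>S. \<forall>x. eval f p x = Some (F f x))"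

definition decidable_on :: "baire set \<Rightarrow> (baire \<Rightarrow> nat \<Rightarrow> bool) \<Rightarrow> bool" where
  "decidable_on S P \<longleftrightarrow> computable_on S (\<lambda>f x. of_bool (P f x))"

text \<open>Syntax-directed closure rules: \<open>intro comp\<close> assembles the program along the
  term.\<close>

named_theorems comp

lemma computable_on_cong:
  assumes "computable_on S F" "\<And>f x. f \<in> S \<Longrightarrow> F f x = G f x"
  shows "computable_on S G"
proof -
  obtain p where "\<forall>f\<in>S. \<forall>x. eval f p x = Some (F f x)"
    using assms(1) unfolding computable_on_def by blast
  with assms(2) show ?thesis
    unfolding computable_on_def by (intro exI[of _ p]) simp
qed

lemma computable_on_subset: "computable_on S F \<Longrightarrow> T \<subseteq> S \<Longrightarrow> computable_on T F"
  unfolding computable_on_def by blast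

lemma computable_on_id [comp]: "computable_on S (\<lambda>f x. x)"
  unfolding computable_on_def
  \<comment> \<open>No constructor of \<open>prog\<close> is the identity; unpairing and pairing
    again recovers \<open>x\<close>.\<close>
  by (rule exI[of _ "PComp PFst (PPair (PPair PFst PSnd) PZero)"]) simp

lemma computable_on_compose:
  assumes "computable_on S (\<lambda>f x. A f x)" "computable_on S (\<lambda>f x. B f x)"
  shows "computable_on S (\<lambda>f x. A f (B f x))"
proof -
  obtain p q where "\<forall>f\<in>S. \<forall>x. eval f p x = Some (A f x)" "\<forall>f\<in>S. \<forall>x. eval f q x = Some (B f x)"
    using assms unfolding computable_on_def by blast
  then show ?thesis
    unfolding computable_on_def by (intro exI[of _ "PComp p q"]) simp
qed

lemma computable_on_Suc [comp]:
  assumes "computable_on S A"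
  shows "computable_on S (\<lambda>f x. Suc (A f x))"
  by (rule computable_on_compose[OF _ assms], unfold computable_on_def, rule exI[of _ PSucc]) simp

lemma computable_on_pfst [comp]:
  assumes "computable_on S A"
  shows "computable_on S (\<lambda>f x. pfst (A f x))"
  by (rule computable_on_compose[OF _ assms], unfold computable_on_def, rule exI[of _ PFst]) simp

lemma computable_on_psnd [comp]:
  assumes "computable_on S A"
  shows "computable_on S (\<lambda>f x. psnd (A f x))"
  by (rule computable_on_compose[OF _ assms], unfold computable_on_def, rule exI[of _ PSnd]) simp

lemma computable_on_oracle [comp]:
  assumes "computable_on S A"
  shows "computable_on S (\<lambda>f x. f (A f x))"
  by (rule computable_on_compose[OF _ assms], unfold computable_on_def, rule exI[of _ POracle]) simp

lemma computable_on_const [comp]: "computable_on S (\<lambda>f x. c)"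
proof (induction c)
  case 0
  show ?case unfolding computable_on_def by (rule exI[of _ PZero]) simp
qed (rule computable_on_Suc)

lemma computable_on_prod_encode [comp]:
  assumes "computable_on S A" "computable_on S B"
  shows "computable_on S (\<lambda>f x. prod_encode (A f x, B f x))"
proof -
  obtain p q where "\<forall>f\<in>S. \<forall>x. eval f p x = Some (A f x)" "\<forall>f\<in>S. \<forall>x. eval f q x = Some (B f x)"
    using assms unfolding computable_on_def by blast
  then show ?thesis
    unfolding computable_on_def by (intro exI[of _ "PPair p q"]) simp
qed

text \<open>\<open>B\<close> is taken as a function of the packed argument
  \<open>(x, (n, r))\<close>, the layout in which \<open>PRec\<close> feeds its step
  program.\<close>

lemma computable_on_rec_nat [comp]:
  assumes "computable_on S A"
    and "computable_on S (\<lambda>f z. B f (pfst z) (pfst (psnd z)) (psnd (psnd z)))"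
    and "computable_on S N"
  shows "computable_on S (\<lambda>f x. rec_nat (A f x) (\<lambda>n r. B f x n r) (N f x))"
proof -
  obtain p q where p: "\<forall>f\<in>S. \<forall>x. eval f p x = Some (A f x)"
    and q: "\<forall>f\<in>S. \<forall>z. eval f q z = Some (B f (pfst z) (pfst (psnd z)) (psnd (psnd z)))"
    using assms unfolding computable_on_def by blast
  have "eval f (PRec p q) (prod_encode (x, n)) = Some (rec_nat (A f x) (\<lambda>n r. B f x n r) n)"
    if "f \<in> S" for f x n
    using that p q by (induction n) auto
  then have "computable_on S (\<lambda>f z. rec_nat (A f (pfst z)) (\<lambda>n r. B f (pfst z) n r) (psnd z))"
    unfolding computable_on_def by (metis prod.collapse prod_decode_inverse)
  from computable_on_compose[OF this computable_on_prod_encode[OF computable_on_id assms(3)]]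
  show ?thesis by simp
qed

lemma computable_on_Least:
  assumes "decidable_on S (\<lambda>f z. P f (pfst z) (psnd z))"
    and ex: "\<And>f x. f \<in> S \<Longrightarrow> \<exists>y. P f x y"
  shows "computable_on S (\<lambda>f x. LEAST y. P f x y)"
proof -
  have "computable_on S (\<lambda>f z. rec_nat 1 (\<lambda>n r. 0) (of_bool (P f (pfst z) (psnd z))))"
    using assms(1) unfolding decidable_on_def by (intro comp)
  then obtain p where p: "\<forall>f\<in>S. \<forall>z. eval f p z =
      Some (rec_nat 1 (\<lambda>n r. 0) (of_bool (P f (pfst z) (psnd z))))"
    unfolding computable_on_def by blast
  have "eval f (PMu p) x = Some (LEAST y. P f x y)" if "f \<in> S" for f x
  proof -
    have "eval f p (prod_encode (x, y)) = Some 0 \<longleftrightarrow> P f x y" "eval f p (prod_encode (x, y)) \<noteq> None" for y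
      using p that by auto
    then show ?thesis using ex[OF that, of x] by simp
  qed
  then show ?thesis unfolding computable_on_def by blast
qed

section \<open>Arithmetic, decidable predicates and bounded quantifiers\<close>

lemma computable_on_add [comp]:
  assumes "computable_on S A" "computable_on S B"
  shows "computable_on S (\<lambda>f x. A f x + B f x)"
proof -
  have eq: "rec_nat a (\<lambda>n r. Suc r) b = a + b" for a b by (induction b) auto
  have "computable_on S (\<lambda>f x. rec_nat (A f x) (\<lambda>n r. Suc r) (B f x))"
    by (intro comp assms)
  then show ?thesis unfolding eq .
qed

lemma computable_on_mult [comp]:
  assumes "computable_on S A" "computable_on S B"
  shows "computable_on S (\<lambda>f x. A f x * B f x)"
proof -
  have A: "computable_on S (\<lambda>f z. A f (pfst z))"
    by (rule computable_on_compose[OF assms(1)]) (intro comp)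
  have eq: "rec_nat 0 (\<lambda>n r. r + a) b = a * b" for a b :: nat by (induction b) auto
  have "computable_on S (\<lambda>f x. rec_nat 0 (\<lambda>n r. r + A f x) (B f x))"
    by (intro comp assms A)
  then show ?thesis unfolding eq .
qed

lemma computable_on_power [comp]:
  assumes "computable_on S A" "computable_on S B"
  shows "computable_on S (\<lambda>f x. A f x ^ B f x)"
proof -
  have A: "computable_on S (\<lambda>f z. A f (pfst z))"
    by (rule computable_on_compose[OF assms(1)]) (intro comp)
  have eq: "rec_nat 1 (\<lambda>n r. r * a) b = a ^ b" for a b :: nat by (induction b) auto
  have "computable_on S (\<lambda>f x. rec_nat 1 (\<lambda>n r. r * A f x) (B f x))"
    by (intro comp assms A)
  then show ?thesis unfolding eq .
qed

lemma computable_on_diff [comp]: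
  assumes "computable_on S A" "computable_on S B"
  shows "computable_on S (\<lambda>f x. A f x - B f x)"
proof -
  have pred: "rec_nat 0 (\<lambda>n r. n) a = a - 1" for a :: nat by (cases a) auto
  have eq: "rec_nat a (\<lambda>n r. rec_nat 0 (\<lambda>n r. n) r) b = a - b" for a b :: nat
    unfolding pred by (induction b) auto
  have "computable_on S (\<lambda>f x. rec_nat (A f x) (\<lambda>n r. rec_nat 0 (\<lambda>n r. n) r) (B f x))"
    by (intro comp assms)
  then show ?thesis unfolding eq .
qed

lemma decidable_on_less [comp]:
  assumes "computable_on S A" "computable_on S B"
  shows "decidable_on S (\<lambda>f x. A f x < B f x)"
proof -
  have eq: "(of_bool (a < b) :: nat) = rec_nat 0 (\<lambda>n r. 1) (b - a)" for a b :: nat by (cases "b - a") auto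
  have "computable_on S (\<lambda>f x. rec_nat 0 (\<lambda>n r. 1) (B f x - A f x))"
    by (intro comp assms)
  then show ?thesis unfolding decidable_on_def eq .
qed

lemma decidable_on_not [comp]:
  assumes "decidable_on S P"
  shows "decidable_on S (\<lambda>f x. \<not> P f x)"
proof -
  have "computable_on S (\<lambda>f x. 1 - of_bool (P f x))"
    using assms unfolding decidable_on_def by (intro comp)
  then show ?thesis unfolding decidable_on_def by (rule computable_on_cong) simp
qed

lemma decidable_on_conj [comp]:
  assumes "decidable_on S P" "decidable_on S Q"
  shows "decidable_on S (\<lambda>f x. P f x \<and> Q f x)"
proof -
  have "computable_on S (\<lambda>f x. of_bool (P f x) * of_bool (Q f x))"
    using assms unfolding decidable_on_def by (intro comp)
  then show ?thesis unfolding decidable_on_def by (rule computable_on_cong) simp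
qed

lemma decidable_on_disj [comp]:
  assumes "decidable_on S P" "decidable_on S Q"
  shows "decidable_on S (\<lambda>f x. P f x \<or> Q f x)"
proof -
  have "decidable_on S (\<lambda>f x. \<not> (\<not> P f x \<and> \<not> Q f x))"
    by (intro comp assms)
  then show ?thesis by simp
qed

lemma decidable_on_imp [comp]:
  assumes "decidable_on S P" "decidable_on S Q"
  shows "decidable_on S (\<lambda>f x. P f x \<longrightarrow> Q f x)"
proof -
  have "decidable_on S (\<lambda>f x. \<not> P f x \<or> Q f x)"
    by (intro comp assms)
  then show ?thesis by (simp only: imp_conv_disj)
qed

lemma decidable_on_iff [comp]:
  assumes "decidable_on S P" "decidable_on S Q"
  shows "decidable_on S (\<lambda>f x. P f x \<longleftrightarrow> Q f x)"
proof -
  have "decidable_on S (\<lambda>f x. (P f x \<longrightarrow> Q f x) \<and> (Q f x \<longrightarrow> P f x))"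
    by (intro comp assms)
  then show ?thesis by (simp only: iff_conv_conj_imp)
qed

lemma decidable_on_le [comp]:
  assumes "computable_on S A" "computable_on S B"
  shows "decidable_on S (\<lambda>f x. A f x \<le> B f x)"
  unfolding not_less[symmetric] by (intro comp assms)

lemma decidable_on_eq [comp]:
  assumes "computable_on S A" "computable_on S B"
  shows "decidable_on S (\<lambda>f x. A f x = B f x)"
  unfolding order_eq_iff by (intro comp assms)

lemma computable_on_if [comp]:
  assumes "decidable_on S P" "computable_on S A" "computable_on S B"
  shows "computable_on S (\<lambda>f x. if P f x then A f x else B f x)"
proof -
  have "computable_on S (\<lambda>f x. of_bool (P f x) * A f x + (1 - of_bool (P f x)) * B f x)"
    using assms unfolding decidable_on_def by (intro comp)
  then show ?thesis by (rule computable_on_cong) simp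
qed

lemma computable_on_of_bool [comp]:
  "decidable_on S P \<Longrightarrow> computable_on S (\<lambda>f x. of_bool (P f x))"
  by (simp add: decidable_on_def)

lemma decidable_on_compose:
  assumes "decidable_on S P" "computable_on S A"
  shows "decidable_on S (\<lambda>f x. P f (A f x))"
  using computable_on_compose[of S "\<lambda>f x. of_bool (P f x)" A] assms unfolding decidable_on_def by simp

text \<open>Search for the least \<open>y\<close> that is a counterexample or has reached the bound.
  The bound makes the search halt, and there is no counterexample below it exactly when the search
  ends at the bound or beyond.\<close>

lemma decidable_on_ball_less [comp]:
  assumes "decidable_on S (\<lambda>f z. P f (pfst z) (psnd z))" "computable_on S B"
  shows "decidable_on S (\<lambda>f x. \<forall>y<B f x. P f x y)"
proof -
  let ?L = "\<lambda>f x. LEAST y. \<not> P f x y \<or> B f x \<le> y"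
  have B: "computable_on S (\<lambda>f z. B f (pfst z))"
    by (rule computable_on_compose[OF assms(2)]) (intro comp)
  have L: "computable_on S ?L"
    by (rule computable_on_Least) (intro comp assms B, blast)
  have d: "decidable_on S (\<lambda>f x. B f x \<le> ?L f x)"
    by (intro comp assms L)
  have eq: "B f x \<le> ?L f x \<longleftrightarrow> (\<forall>y<B f x. P f x y)" for f x
  proof
    assume *: "B f x \<le> ?L f x"
    show "\<forall>y<B f x. P f x y"
    proof (intro allI impI)
      fix y assume "y < B f x"
      with * have "y < ?L f x" by simp
      from not_less_Least[OF this] show "P f x y" by simp
    qed
  next
    assume *: "\<forall>y<B f x. P f x y"
    have "\<not> P f x (?L f x) \<or> B f x \<le> ?L f x"
      by (rule LeastI[of _ "B f x"]) simp
    with * show "B f x \<le> ?L f x"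
      using not_less by blast
  qed
  from d show ?thesis unfolding eq .
qed

lemma decidable_on_bex_less [comp]:
  assumes "decidable_on S (\<lambda>f z. P f (pfst z) (psnd z))" "computable_on S B"
  shows "decidable_on S (\<lambda>f x. \<exists>y<B f x. P f x y)"
proof -
  have "decidable_on S (\<lambda>f x. \<not> (\<forall>y<B f x. \<not> P f x y))"
    by (intro comp assms)
  then show ?thesis by simp
qed

lemma decidable_on_bex_le [comp]:
  assumes "decidable_on S (\<lambda>f z. P f (pfst z) (psnd z))" "computable_on S B"
  shows "decidable_on S (\<lambda>f x. \<exists>y\<le>B f x. P f x y)"
  unfolding less_Suc_eq_le[symmetric] by (intro comp assms)

text \<open>The quotient is found by search; the disjunct \<open>b = 0\<close> makes the search halt
  at once and yields 0, the value that HOL gives to division by zero.\<close>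

lemma computable_on_div [comp]:
  assumes "computable_on S A" "computable_on S B"
  shows "computable_on S (\<lambda>f x. A f x div B f x)"
proof -
  let ?L = "\<lambda>a b. LEAST q. b = 0 \<or> a < b * Suc q"
  have A: "computable_on S (\<lambda>f z. A f (pfst z))" "computable_on S (\<lambda>f z. B f (pfst z))"
    by (rule computable_on_compose[OF assms(1)] computable_on_compose[OF assms(2)], intro comp)+
  have ex: "\<exists>q. b = 0 \<or> a < b * Suc q" for a b :: nat
    by (metis dividend_less_times_div gr0I mult_Suc_right)
  have eq: "?L a b = a div b" for a b :: nat
  proof (cases "b = 0")
    case False
    show ?thesis
    proof (rule Least_equality)
      show "b = 0 \<or> a < b * Suc (a div b)"
        using False by (simp add: dividend_less_times_div)
    qed (metis False div_less_iff_less_mult gr0I less_Suc_eq_le mult.commute)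
  qed simp
  have "computable_on S (\<lambda>f x. ?L (A f x) (B f x))"
    by (rule computable_on_Least) (intro comp A, rule ex)
  then show ?thesis unfolding eq .
qed

lemma computable_on_mod [comp]:
  assumes "computable_on S A" "computable_on S B"
  shows "computable_on S (\<lambda>f x. A f x mod B f x)"
proof -
  have "computable_on S (\<lambda>f x. A f x - B f x * (A f x div B f x))"
    by (intro comp assms)
  then show ?thesis by (simp add: minus_mult_div_eq_mod)
qed

lemma decidable_on_mem_set_decode [comp]:
  assumes "computable_on S A" "computable_on S B"
  shows "decidable_on S (\<lambda>f x. A f x \<in> set_decode (B f x))"
proof -
  have eq: "t \<in> set_decode D \<longleftrightarrow> D div 2 ^ t mod 2 = 1" for t D
    by (simp add: set_decode_def odd_iff_mod_2_eq_one)
  have "decidable_on S (\<lambda>f x. B f x div 2 ^ A f x mod 2 = 1)"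
    by (intro comp assms)
  then show ?thesis unfolding eq .
qed

text \<open>The digit at position \<open>t\<close> contributes \<open>2 ^ t > t\<close> to
  \<open>D\<close>. This turns quantifiers over a coded finite set into bounded ones.\<close>

lemma set_decode_less: "t \<in> set_decode D \<Longrightarrow> t < D"
proof -
  assume "t \<in> set_decode D"
  then have "D div 2 ^ t \<noteq> 0"
    unfolding set_decode_def by (metis dvd_0_right mem_Collect_eq)
  then have "2 ^ t \<le> D"
    by (meson div_less leI)
  then show ?thesis
    by (meson less_exp order_less_le_trans)
qed

lemma decidable_on_ball_set_decode [comp]:
  assumes "decidable_on S (\<lambda>f z. P f (pfst z) (psnd z))" "computable_on S B"
  shows "decidable_on S (\<lambda>f x. \<forall>y\<in>set_decode (B f x). P f x y)"
proof -
  have B: "computable_on S (\<lambda>f z. B f (pfst z))"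
    by (rule computable_on_compose[OF assms(2)]) (intro comp)
  have d: "decidable_on S (\<lambda>f x. \<forall>y<B f x. y \<in> set_decode (B f x) \<longrightarrow> P f x y)"
    by (intro comp assms B)
  have eq: "(\<forall>y<B f x. y \<in> set_decode (B f x) \<longrightarrow> P f x y) \<longleftrightarrow> (\<forall>y\<in>set_decode (B f x). P f x y)" for f x
    using set_decode_less by blast
  from d show ?thesis unfolding eq .
qed

lemma decidable_on_cong:
  assumes "decidable_on S P" "\<And>f x. f \<in> S \<Longrightarrow> P f x \<longleftrightarrow> Q f x"
  shows "decidable_on S Q"
  using assms(1) unfolding decidable_on_def by (rule computable_on_cong) (simp add: assms(2))

lemma decidable_on_if [comp]:
  assumes "decidable_on S P" "decidable_on S Q" "decidable_on S R"
  shows "decidable_on S (\<lambda>f x. if P f x then Q f x else R f x)"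
proof -
  have "decidable_on S (\<lambda>f x. P f x \<and> Q f x \<or> \<not> P f x \<and> R f x)"
    by (intro comp assms)
  then show ?thesis by (rule decidable_on_cong) simp
qed

lemma computable_on_apply2:
  assumes "computable_on S (\<lambda>f z. F f (pfst z) (psnd z))" "computable_on S A" "computable_on S B"
  shows "computable_on S (\<lambda>f x. F f (A f x) (B f x))"
  using computable_on_compose[OF assms(1) computable_on_prod_encode[OF assms(2,3)]] by simp

lemma decidable_on_apply2:
  assumes "decidable_on S (\<lambda>f z. P f (pfst z) (psnd z))" "computable_on S A" "computable_on S B"
  shows "decidable_on S (\<lambda>f x. P f (A f x) (B f x))"
  using decidable_on_compose[OF assms(1) computable_on_prod_encode[OF assms(2,3)]] by simp

lemma decidable_on_apply3:
  assumes "decidable_on S (\<lambda>f z. P f (pfst z) (pfst (psnd z)) (psnd (psnd z)))"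
    and "computable_on S A" "computable_on S B" "computable_on S C"
  shows "decidable_on S (\<lambda>f x. P f (A f x) (B f x) (C f x))"
  using decidable_on_apply2[OF assms(1,2) computable_on_prod_encode[OF assms(3,4)]] by simp

section \<open>Certificates of computations\<close>

text \<open>
  A certificate is the code of a finite set of triples \<open>(e, x, y)\<close>, each read as the assertion
  that program \<open>e\<close> maps \<open>x\<close> to \<open>y\<close> and each supported by further members of the set. No order
  on the set is needed: support descends along subprograms, and along the recursion argument
  of \<^const>\<open>PRec\<close>, so it cannot be circular. The relation \<open>Q\<close> stands for the graph of the oracle.
\<close>

abbreviation triple :: "nat \<Rightarrow> nat \<Rightarrow> nat \<Rightarrow> nat" where
  "triple e x y \<equiv> prod_encode (e, prod_encode (x, y))"

text \<open>The case distinction retraces \<open>prog_of\<close>: codes up to 4 are the base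
  programs, and above them \<open>(e - 5) mod 4\<close> selects the constructor and
  \<open>(e - 5) div 4\<close> carries the codes of the subprograms. Intermediate values are bounded
  by \<open>D\<close> for decidability; by \<open>triple_less\<close> this excludes nothing.\<close>

definition supported :: "(nat \<Rightarrow> nat \<Rightarrow> bool) \<Rightarrow> nat \<Rightarrow> nat \<Rightarrow> nat \<Rightarrow> nat \<Rightarrow> bool" where
  "supported Q D e x y \<longleftrightarrow>
    (if e = 0 then y = 0 else if e = 1 then y = Suc x else if e = 2 then y = pfst x
     else if e = 3 then y = psnd x else if e = 4 then Q x y
     else if (e - 5) mod 4 = 0 then
       triple (pfst ((e - 5) div 4)) x (pfst y) \<in> set_decode D \<and>
       triple (psnd ((e - 5) div 4)) x (psnd y) \<in> set_decode D
     else if (e - 5) mod 4 = 1 then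
       (\<exists>z<D. triple (psnd ((e - 5) div 4)) x z \<in> set_decode D \<and>
         triple (pfst ((e - 5) div 4)) z y \<in> set_decode D)
     else if (e - 5) mod 4 = 2 then
       (if psnd x = 0 then triple (pfst ((e - 5) div 4)) (pfst x) y \<in> set_decode D
        else (\<exists>z<D. triple e (prod_encode (pfst x, psnd x - 1)) z \<in> set_decode D \<and>
          triple (psnd ((e - 5) div 4)) (prod_encode (pfst x, prod_encode (psnd x - 1, z))) y
            \<in> set_decode D))
     else triple ((e - 5) div 4) (prod_encode (x, y)) 0 \<in> set_decode D \<and>
       (\<forall>j<y. \<exists>z<D. z \<noteq> 0 \<and> triple ((e - 5) div 4) (prod_encode (x, j)) z \<in> set_decode D))"

definition certificate :: "(nat \<Rightarrow> nat \<Rightarrow> bool) \<Rightarrow> nat \<Rightarrow> bool" where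
  "certificate Q D \<longleftrightarrow>
    (\<forall>t\<in>set_decode D. supported Q D (pfst t) (pfst (psnd t)) (psnd (psnd t)))"

text \<open>Pairing dominates both components and a member of a coded set is below the code. Besides
  justifying the bounds in \<open>supported\<close>, this limits the oracle queries in a certificate
  \<open>D\<close> to arguments below \<open>D\<close>.\<close>

lemma triple_less:
  assumes "triple e x y \<in> set_decode D"
  shows "e < D" "x < D" "y < D"
  using set_decode_less[OF assms] le_prod_encode_1[of e "prod_encode (x, y)"]
    le_prod_encode_2[of "prod_encode (x, y)" e] le_prod_encode_1[of x y] le_prod_encode_2[of y x]
  by linarith+

lemma certificateD:
  "certificate Q D \<Longrightarrow> triple e x y \<in> set_decode D \<Longrightarrow> supported Q D e x y"
  unfolding certificate_def by force

text \<open>The oracle enters only through triples with program code 4 (\<open>POracle\<close>), so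
  it can be exchanged for any relation that holds at the queries actually recorded: the use
  principle.\<close>

lemma certificate_mono:
  assumes "certificate Q D" "\<And>x y. triple 4 x y \<in> set_decode D \<Longrightarrow> Q x y \<Longrightarrow> Q' x y"
  shows "certificate Q' D"
  unfolding certificate_def
proof
  fix t assume t: "t \<in> set_decode D"
  obtain e x y where txy: "t = triple e x y"
    by (metis prod.collapse prod_decode_inverse)
  have "supported Q D e x y"
    using assms(1) t txy by (auto intro: certificateD)
  then have "supported Q' D e x y"
  proof (cases "e = 4")
    case True
    then show ?thesis
      using assms(2)[of x y] t \<open>supported Q D e x y\<close> unfolding txy by (simp add: supported_def)
  next
    case False
    then show ?thesis
      using \<open>supported Q D e x y\<close> by (simp only: supported_def if_False)
  qed
  then show "supported Q' D (pfst t) (pfst (psnd t)) (psnd (psnd t))"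
    by (simp add: txy)
qed

lemma prog_of_ge_5:
  assumes "5 \<le> e"
  shows "(e - 5) mod 4 = 0 \<Longrightarrow>
      prog_of e = PPair (prog_of (pfst ((e - 5) div 4))) (prog_of (psnd ((e - 5) div 4)))"
    and "(e - 5) mod 4 = 1 \<Longrightarrow>
      prog_of e = PComp (prog_of (pfst ((e - 5) div 4))) (prog_of (psnd ((e - 5) div 4)))"
    and "(e - 5) mod 4 = 2 \<Longrightarrow>
      prog_of e = PRec (prog_of (pfst ((e - 5) div 4))) (prog_of (psnd ((e - 5) div 4)))"
    and "(e - 5) mod 4 = 3 \<Longrightarrow> prog_of e = PMu (prog_of ((e - 5) div 4))"
  using assms by (subst prog_of.simps; simp add: Let_def)+

lemma prog_of_le_4:
  "prog_of 0 = PZero" "prog_of 1 = PSucc" "prog_of 2 = PFst" "prog_of 3 = PSnd" "prog_of 4 = POracle"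
  by (subst prog_of.simps; simp)+

lemma prog_code_cases:
  fixes e :: nat
  obtains "e = 0" | "e = 1" | "e = 2" | "e = 3" | "e = 4"
  | "5 \<le> e" "(e - 5) mod 4 = 0" | "5 \<le> e" "(e - 5) mod 4 = 1"
  | "5 \<le> e" "(e - 5) mod 4 = 2" | "5 \<le> e" "(e - 5) mod 4 = 3"
proof -
  have "(e - 5) mod 4 < 4" by simp
  then have "(e - 5) mod 4 = 0 \<or> (e - 5) mod 4 = 1 \<or> (e - 5) mod 4 = 2 \<or> (e - 5) mod 4 = 3"
    by linarith
  moreover have "e = 0 \<or> e = 1 \<or> e = 2 \<or> e = 3 \<or> e = 4 \<or> 5 \<le> e" by linarith
  ultimately show ?thesis using that by metis
qed

lemma prog_code_less:
  assumes "5 \<le> e"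
  shows "pfst ((e - 5) div 4) < e" "psnd ((e - 5) div 4) < e" "(e - 5) div 4 < e"
proof -
  show *: "(e - 5) div 4 < e" using assms by linarith
  show "pfst ((e - 5) div 4) < e" "psnd ((e - 5) div 4) < e"
    using * prod_decode_le[of "(e - 5) div 4"] by linarith+
qed

text \<open>Course-of-values induction on the program code works because the codes of subprograms
  are smaller.\<close>

lemma certificate_sound:
  assumes D: "certificate (\<lambda>x y. f x = y) D"
  shows "triple e x y \<in> set_decode D \<Longrightarrow> eval f (prog_of e) x = Some y"
proof (induction e arbitrary: x y rule: less_induct)
  case (less e)
  have sup: "supported (\<lambda>x y. f x = y) D e x y"
    using certificateD[OF D less.prems] .
  show ?case
  proof (cases e rule: prog_code_cases)
    case 6
    from sup 6 have "triple (pfst ((e - 5) div 4)) x (pfst y) \<in> set_decode D"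
      "triple (psnd ((e - 5) div 4)) x (psnd y) \<in> set_decode D"
      by (simp_all add: supported_def)
    from this[THEN less.IH[rotated]] 6 show ?thesis
      by (simp add: prog_of_ge_5(1) prog_code_less)
  next
    case 7
    from sup 7 obtain z where "triple (psnd ((e - 5) div 4)) x z \<in> set_decode D"
      "triple (pfst ((e - 5) div 4)) z y \<in> set_decode D"
      by (auto simp: supported_def)
    from this[THEN less.IH[rotated]] 7 show ?thesis
      by (simp add: prog_of_ge_5(2) prog_code_less)
  next
    case 8
    \<comment> \<open>A triple for \<open>PRec\<close> rests on another triple with the same code
      \<open>e\<close>, hence the inner induction on the recursion argument.\<close>
    have "triple e (prod_encode (a, n)) y \<in> set_decode D \<Longrightarrow>
        eval f (prog_of e) (prod_encode (a, n)) = Some y" for a n y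
    proof (induction n arbitrary: y)
      case 0
      from certificateD[OF D 0] 8 have "triple (pfst ((e - 5) div 4)) a y \<in> set_decode D"
        by (simp add: supported_def)
      from this[THEN less.IH[rotated]] 8 show ?case
        by (simp add: prog_of_ge_5(3) prog_code_less)
    next
      case (Suc n)
      from certificateD[OF D Suc.prems] 8 obtain z
        where z: "triple e (prod_encode (a, n)) z \<in> set_decode D"
          "triple (psnd ((e - 5) div 4)) (prod_encode (a, prod_encode (n, z))) y \<in> set_decode D"
        by (auto simp: supported_def)
      from Suc.IH[OF z(1)] z(2)[THEN less.IH[rotated]] 8 show ?case
        by (simp add: prog_of_ge_5(3) prog_code_less)
    qed
    from this[of "pfst x" "psnd x"] less.prems show ?thesis by simp
  next
    case 9
    from sup 9 have *: "triple ((e - 5) div 4) (prod_encode (x, y)) 0 \<in> set_decode D"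
      and **: "\<forall>j<y. \<exists>z. z \<noteq> 0 \<and> triple ((e - 5) div 4) (prod_encode (x, j)) z \<in> set_decode D"
      by (auto simp: supported_def)
    let ?q = "prog_of ((e - 5) div 4)"
    have 0: "eval f ?q (prod_encode (x, y)) = Some 0"
      using *[THEN less.IH[rotated]] 9 by (simp add: prog_code_less)
    have pos: "\<exists>z. z \<noteq> 0 \<and> eval f ?q (prod_encode (x, j)) = Some z" if "j < y" for j
      using ** that less.IH 9 prog_code_less(3) by blast
    have "(LEAST n. eval f ?q (prod_encode (x, n)) = Some 0) = y"
      by (rule Least_equality, rule 0) (metis leI option.inject pos)
    moreover have "\<exists>n. eval f ?q (prod_encode (x, n)) = Some 0 \<and>
        (\<forall>m<n. eval f ?q (prod_encode (x, m)) \<noteq> None)"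
      using 0 pos by (metis option.discI)
    ultimately show ?thesis using 9 by (simp add: prog_of_ge_5(4))
  qed (use sup in \<open>simp_all add: supported_def prog_of_le_4 prog_of_le_4[simplified]\<close>)
qed

definition certified :: "(nat \<Rightarrow> nat \<Rightarrow> bool) \<Rightarrow> nat set" where
  "certified Q = {t. \<exists>D. certificate Q D \<and> t \<in> set_decode D}"

text \<open>\<open>D\<close> occurs only positively, in memberships and in bounds
  \<open>z < D\<close>; the bounds survive because a larger set has a larger code.\<close>

lemma supported_mono:
  assumes "supported Q D e x y" "set_decode D \<subseteq> set_decode D'"
  shows "supported Q D' e x y"
proof -
  have "D \<le> D'" using assms(2) by (rule subset_decode_imp_le)
  then have "z < D \<Longrightarrow> z < D'" for z by simp
  note * = this subsetD[OF assms(2)]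
  show ?thesis
  proof (cases e rule: prog_code_cases)
    case 8
    then show ?thesis
      using assms(1) by (auto simp: supported_def *) (blast intro: *)
  next
    case 9
    have "\<exists>z<D'. z \<noteq> 0 \<and> triple ((e - 5) div 4) (prod_encode (x, j)) z \<in> set_decode D'"
      if "j < y" for j
      using assms(1) 9 that by (auto simp: supported_def dest!: spec[of _ j] intro: *)
    then show ?thesis
      using assms(1) 9 by (simp add: supported_def *)
  qed (use assms(1) in \<open>auto simp: supported_def intro: *\<close>)
qed

text \<open>By monotonicity of support, the union of two certificates is again a
  certificate.\<close>

lemma certified_finite:
  assumes "finite A" "A \<subseteq> certified Q"
  shows "\<exists>D. certificate Q D \<and> A \<subseteq> set_decode D"
  using assms
proof (induction A rule: finite_induct)
  case empty
  have "certificate Q 0" by (simp add: certificate_def)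
  then show ?case by blast
next
  case (insert t A)
  then obtain D D' where D: "certificate Q D" "A \<subseteq> set_decode D"
    and D': "certificate Q D'" "t \<in> set_decode D'"
    unfolding certified_def by auto
  define E where "E = set_encode (set_decode D \<union> set_decode D')"
  have E: "set_decode E = set_decode D \<union> set_decode D'"
    by (simp add: E_def)
  have "certificate Q E"
    unfolding certificate_def
  proof
    fix t assume "t \<in> set_decode E"
    then consider "t \<in> set_decode D" | "t \<in> set_decode D'" using E by blast
    then show "supported Q E (pfst t) (pfst (psnd t)) (psnd (psnd t))"
      using D(1) D'(1) E unfolding certificate_def
      by cases (blast intro: supported_mono)+
  qed
  then show ?case using D D' E by blast
qed

text \<open>The one-step rule for building certificates bottom-up: merge certificates for the
  premises in \<open>A\<close> and add the triple that they support.\<close>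

lemma certified_supported:
  assumes "finite A" "A \<subseteq> certified Q"
    and "\<And>D. A \<subseteq> set_decode D \<Longrightarrow> supported Q D e x y"
  shows "triple e x y \<in> certified Q"
proof -
  obtain D where D: "certificate Q D" "A \<subseteq> set_decode D"
    using certified_finite[OF assms(1,2)] by blast
  define E where "E = set_encode (insert (triple e x y) (set_decode D))"
  have E: "set_decode E = insert (triple e x y) (set_decode D)"
    by (simp add: E_def)
  have "certificate Q E"
    unfolding certificate_def
  proof
    fix t assume "t \<in> set_decode E"
    then consider "t = triple e x y" | "t \<in> set_decode D" using E by blast
    then show "supported Q E (pfst t) (pfst (psnd t)) (psnd (psnd t))"
    proof cases
      case 1
      then show ?thesis using assms(3)[of E] D(2) E by auto
    next
      case 2
      then show ?thesis using D(1) E supported_mono unfolding certificate_def by blast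
    qed
  qed
  then show ?thesis using E unfolding certified_def by blast
qed

lemma certified_complete:
  "eval f (prog_of e) x = Some y \<Longrightarrow> triple e x y \<in> certified (\<lambda>x y. f x = y)"
proof (induction e arbitrary: x y rule: less_induct)
  case (less e)
  let ?Q = "\<lambda>x y. f x = y" and ?m = "(e - 5) div 4"
  show ?case
  proof (cases e rule: prog_code_cases)
    case 6
    obtain a b where y: "y = prod_encode (a, b)"
      and ab: "eval f (prog_of (pfst ?m)) x = Some a" "eval f (prog_of (psnd ?m)) x = Some b"
      using less.prems 6 by (auto simp: prog_of_ge_5(1) bind_eq_Some_conv)
    show ?thesis
      by (rule certified_supported[of "{triple (pfst ?m) x a, triple (psnd ?m) x b}"])
        (use 6 y ab in \<open>simp_all add: less.IH prog_code_less supported_def\<close>)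
  next
    case 7
    obtain z where z: "eval f (prog_of (psnd ?m)) x = Some z" "eval f (prog_of (pfst ?m)) z = Some y"
      using less.prems 7 by (auto simp: prog_of_ge_5(2) bind_eq_Some_conv)
    show ?thesis
    proof (rule certified_supported[of "{triple (psnd ?m) x z, triple (pfst ?m) z y}"])
      fix D assume "{triple (psnd ?m) x z, triple (pfst ?m) z y} \<subseteq> set_decode D"
      moreover from this have "z < D" by (auto dest: triple_less)
      ultimately show "supported ?Q D e x y"
        using 7 by (auto simp: supported_def)
    qed (use 7 z in \<open>simp_all add: less.IH prog_code_less\<close>)
  next
    case 8
    have "eval f (prog_of e) (prod_encode (a, n)) = Some y \<Longrightarrow>
        triple e (prod_encode (a, n)) y \<in> certified ?Q" for a n y
    proof (induction n arbitrary: y)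
      case 0
      then have "eval f (prog_of (pfst ?m)) a = Some y"
        using 8 by (simp add: prog_of_ge_5(3))
      then show ?case
        by (intro certified_supported[of "{triple (pfst ?m) a y}"])
          (use 8 in \<open>simp_all add: less.IH prog_code_less supported_def\<close>)
    next
      case (Suc n)
      then obtain z where z: "eval f (prog_of e) (prod_encode (a, n)) = Some z"
        "eval f (prog_of (psnd ?m)) (prod_encode (a, prod_encode (n, z))) = Some y"
        using 8 by (auto simp: prog_of_ge_5(3) bind_eq_Some_conv)
      let ?A = "{triple e (prod_encode (a, n)) z,
        triple (psnd ?m) (prod_encode (a, prod_encode (n, z))) y}"
      show ?case
      proof (rule certified_supported[of ?A])
        fix D assume "?A \<subseteq> set_decode D"
        moreover from this have "z < D" by (auto dest: triple_less)
        ultimately show "supported ?Q D e (prod_encode (a, Suc n)) y"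
          using 8 by (auto simp: supported_def)
      qed (use 8 z in \<open>simp_all add: less.IH prog_code_less Suc.IH\<close>)
    qed
    from this[of "pfst x" "psnd x"] less.prems show ?thesis by simp
  next
    case 9
    let ?e = "\<lambda>n. eval f (prog_of ?m) (prod_encode (x, n))"
    have ex: "\<exists>n. ?e n = Some 0 \<and> (\<forall>m<n. ?e m \<noteq> None)" and y: "y = (LEAST n. ?e n = Some 0)"
      using less.prems 9 by (auto simp: prog_of_ge_5(4) split: if_splits)
    then obtain n where n: "?e n = Some 0" "\<forall>m<n. ?e m \<noteq> None" by blast
    have 0: "?e y = Some 0" unfolding y using n(1) by (rule LeastI)
    \<comment> \<open>Values are known to exist only below the given zero \<open>n\<close>; the
      least zero is no larger, so everything before it converges to a nonzero value.\<close>
    have "y \<le> n" unfolding y using n(1) by (rule Least_le)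
    then have "\<forall>j<y. \<exists>z. z \<noteq> 0 \<and> ?e j = Some z"
      using n(2) not_less_Least[of _ "\<lambda>n. ?e n = Some 0"] unfolding y[symmetric]
      by (metis not_Some_eq order_less_le_trans)
    then obtain z where z: "\<And>j. j < y \<Longrightarrow> z j \<noteq> 0 \<and> ?e j = Some (z j)" by metis
    let ?A = "insert (triple ?m (prod_encode (x, y)) 0)
      ((\<lambda>j. triple ?m (prod_encode (x, j)) (z j)) ` {..<y})"
    show ?thesis
    proof (rule certified_supported[of ?A])
      fix D assume D: "?A \<subseteq> set_decode D"
      then have "z j < D \<and> z j \<noteq> 0 \<and> triple ?m (prod_encode (x, j)) (z j) \<in> set_decode D"
        if "j < y" for j
        using that z triple_less(3) by blast
      then have "\<forall>j<y. \<exists>z<D. z \<noteq> 0 \<and> triple ?m (prod_encode (x, j)) z \<in> set_decode D"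
        by blast
      then show "supported ?Q D e x y"
        using 9 D by (simp add: supported_def)
    qed (use 9 z 0 in \<open>auto simp: less.IH prog_code_less\<close>)
  qed (use less.prems in \<open>auto simp: prog_of_le_4 prog_of_le_4[simplified] supported_def
    intro!: certified_supported[of "{}"]\<close>)
qed

text \<open>A normal form in the style of Kleene: convergence is the existence of a number with a
  property decidable in the oracle.\<close>

lemma phi_eq_Some_iff:
  "\<phi> e f x = Some y \<longleftrightarrow> (\<exists>D. certificate (\<lambda>x y. f x = y) D \<and> triple e x y \<in> set_decode D)"
  using certificate_sound certified_complete unfolding \<phi>_def certified_def by blast

text \<open>The oracle relation need only be decidable uniformly, so certificates can be checked
  against an oracle computed from \<open>f\<close> or against a finite table of guessed
  values.\<close>

lemma decidable_on_certificate [comp]: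
  assumes Q: "decidable_on S (\<lambda>f z. Q f (pfst z) (pfst (psnd z)) (psnd (psnd z)))"
    and "computable_on S D"
  shows "decidable_on S (\<lambda>f x. certificate (\<lambda>a b. Q f x a b) (D f x))"
proof -
  have Q': "decidable_on S (\<lambda>f z.
      Q f (pfst (pfst z)) (pfst (psnd (psnd z))) (psnd (psnd (psnd z))))"
    by (rule decidable_on_apply3[OF Q]) (intro comp)+
  have "decidable_on S (\<lambda>f z. certificate (\<lambda>a b. Q f (pfst z) a b) (psnd z))"
    unfolding certificate_def supported_def by (intro comp Q')
  from decidable_on_apply2[OF this computable_on_id assms(2)] show ?thesis .
qed

text \<open>The universal functional: index, oracle and argument may all vary. It searches for a
  certificate paired with the value; convergence, assumed in \<open>V\<close>, makes the search
  halt.\<close>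

lemma computable_on_phi:
  assumes "computable_on S E" "computable_on S A"
    and G: "computable_on S (\<lambda>f z. G f (pfst z) (psnd z))"
    and V: "\<And>f x. f \<in> S \<Longrightarrow> \<phi> (E f x) (G f x) (A f x) = Some (V f x)"
  shows "computable_on S V"
proof -
  let ?P = "\<lambda>f x c. certificate (\<lambda>a b. G f x a = b) (pfst c) \<and>
    triple (E f x) (A f x) (psnd c) \<in> set_decode (pfst c)"
  have EA: "computable_on S (\<lambda>f z. E f (pfst z))" "computable_on S (\<lambda>f z. A f (pfst z))"
    by (rule computable_on_compose[OF assms(1)] computable_on_compose[OF assms(2)], intro comp)+
  have G': "computable_on S (\<lambda>f z. G f (pfst (pfst z)) (pfst (psnd z)))"
    by (rule computable_on_apply2[OF G]) (intro comp)+
  have ex: "\<exists>c. ?P f x c" if f: "f \<in> S" for f x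
  proof -
    obtain D where "certificate (\<lambda>a b. G f x a = b) D" "triple (E f x) (A f x) (V f x) \<in> set_decode D"
      using V[OF f] unfolding phi_eq_Some_iff by blast
    then show ?thesis by (intro exI[of _ "prod_encode (D, V f x)"]) simp
  qed
  have "computable_on S (\<lambda>f x. LEAST c. ?P f x c)"
    by (rule computable_on_Least[OF _ ex]) (intro comp EA G')
  then have "computable_on S (\<lambda>f x. psnd (LEAST c. ?P f x c))"
    by (intro comp)
  then show ?thesis
  proof (rule computable_on_cong)
    fix f x assume f: "f \<in> S"
    from LeastI_ex[OF ex[OF f, of x]]
    have "\<phi> (E f x) (G f x) (A f x) = Some (psnd (LEAST c. ?P f x c))"
      unfolding phi_eq_Some_iff by blast
    with V[OF f] show "psnd (LEAST c. ?P f x c) = V f x" by simp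
  qed
qed

lemma computable_on_iff_index: "computable_on S F \<longleftrightarrow> (\<exists>e. \<forall>f\<in>S. maps_to e f (F f))"
proof
  assume "computable_on S F"
  then obtain p where p: "\<forall>f\<in>S. \<forall>x. eval f p x = Some (F f x)"
    unfolding computable_on_def by blast
  obtain e where "p = prog_of e" using surj_prog_of by (metis surjD)
  with p show "\<exists>e. \<forall>f\<in>S. maps_to e f (F f)"
    unfolding maps_to_def \<phi>_def by blast
qed (auto simp: computable_on_def maps_to_def \<phi>_def)

lemma computable_on_substitute:
  assumes "computable_on T H" "computable_on S A"
    and "computable_on S (\<lambda>f z. G f (pfst z) (psnd z))" "\<And>f x. f \<in> S \<Longrightarrow> G f x \<in> T"
  shows "computable_on S (\<lambda>f x. H (G f x) (A f x))"
proof -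
  obtain e where "\<forall>g\<in>T. maps_to e g (H g)"
    using assms(1) unfolding computable_on_iff_index by blast
  then have "\<phi> e (G f x) (A f x) = Some (H (G f x) (A f x))" if "f \<in> S" for f x
    using assms(4)[OF that] by (simp add: maps_to_def)
  from computable_on_phi[OF computable_on_const assms(2,3) this] show ?thesis .
qed

section \<open>Reducibility and jumps\<close>

lemma tjoin_0 [simp]: "tjoin fs 0 = length fs"
  by (simp add: tjoin_def)

lemma tjoin_Suc [simp]:
  "tjoin fs (Suc (prod_encode (i, y))) = (if i < length fs then (fs ! i) y else 0)"
  by (simp add: tjoin_def)

abbreviation component :: "baire \<Rightarrow> nat \<Rightarrow> baire" where
  "component f i \<equiv> \<lambda>y. f (Suc (prod_encode (i, y)))"

lemma tjoin_eq_iff [simp]: "tjoin fs = tjoin gs \<longleftrightarrow> fs = gs"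
  using inj_tjoin by (auto dest: injD)

lemma num_eq_iff [simp]: "num x = num y \<longleftrightarrow> x = y"
  unfolding num_def by metis

lemma num_0 [simp]: "num x 0 = x"
  by (simp add: num_def)

lemma computable_on_num [comp]:
  assumes "computable_on S A" "computable_on S B"
  shows "computable_on S (\<lambda>f x. num (A f x) (B f x))"
  unfolding num_def by (intro comp assms)

lemma computable_on_tjoin [comp]:
  assumes "list_all (\<lambda>G. computable_on S (\<lambda>f z. G f (pfst z) (psnd z))) Gs" "computable_on S A"
  shows "computable_on S (\<lambda>f x. tjoin (map (\<lambda>G. G f x) Gs) (A f x))"
proof -
  have "computable_on S (\<lambda>f z. if pfst (psnd z) < length Gs
      then (Gs ! pfst (psnd z)) f (pfst z) (psnd (psnd z)) else 0)"
    using assms(1)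
  proof (induction Gs rule: rev_induct)
    case Nil
    show ?case by (simp add: computable_on_const)
  next
    case (snoc G Gs)
    have G: "computable_on S (\<lambda>f z. G f (pfst z) (psnd (psnd z)))"
      by (rule computable_on_apply2[of S G]) (use snoc.prems in simp, (intro comp)+)
    have "computable_on S (\<lambda>f z. if pfst (psnd z) = length Gs then G f (pfst z) (psnd (psnd z))
        else if pfst (psnd z) < length Gs
        then (Gs ! pfst (psnd z)) f (pfst z) (psnd (psnd z)) else 0)"
      by (rule computable_on_if[OF _ G]) (intro comp, use snoc in simp)
    then show ?case by (rule computable_on_cong) (auto simp: nth_append)
  qed
  from computable_on_compose[OF this, of "\<lambda>f x. prod_encode (x, A f x - 1)"]
  have "computable_on S (\<lambda>f x. if pfst (A f x - 1) < length Gs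
      then (Gs ! pfst (A f x - 1)) f x (psnd (A f x - 1)) else 0)"
    by (simp add: computable_on_prod_encode computable_on_id computable_on_diff
        computable_on_const assms(2) del: One_nat_def cong: if_cong)
  then have "computable_on S (\<lambda>f x. if A f x = 0 then length Gs
      else if pfst (A f x - 1) < length Gs
      then (Gs ! pfst (A f x - 1)) f x (psnd (A f x - 1)) else 0)"
    by (rule computable_on_if[OF decidable_on_eq[OF assms(2)], rotated 2]) (intro comp)+
  then show ?thesis
    by (rule computable_on_cong) (auto simp: tjoin_def Let_def split: nat.split prod.split)
qed

lemma computable_on_tjoin2 [comp]:
  assumes "computable_on S (\<lambda>f z. G f (pfst z) (psnd z))" "computable_on S (\<lambda>f z. H f (pfst z) (psnd z))"
    and "computable_on S A"
  shows "computable_on S (\<lambda>f x. tjoin [G f x, H f x] (A f x))"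
  using computable_on_tjoin[of S "[G, H]" A] assms by simp

lemma computable_on_tjoin3 [comp]:
  assumes "computable_on S (\<lambda>f z. G f (pfst z) (psnd z))" "computable_on S (\<lambda>f z. H f (pfst z) (psnd z))"
    and "computable_on S (\<lambda>f z. K f (pfst z) (psnd z))" "computable_on S A"
  shows "computable_on S (\<lambda>f x. tjoin [G f x, H f x, K f x] (A f x))"
  using computable_on_tjoin[of S "[G, H, K]" A] assms by simp

lemma computable_on_functional_comp:
  assumes "computable_on T H" "computable_on S G" "G ` S \<subseteq> T"
  shows "computable_on S (\<lambda>f. H (G f))"
proof -
  have "computable_on S (\<lambda>f z. G f (psnd z))"
    by (rule computable_on_compose[OF assms(2)]) (intro comp)
  from computable_on_substitute[OF assms(1) computable_on_id this] assms(3)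
  show ?thesis by (simp add: image_subset_iff)
qed

lemma instancesI: "h \<in> P f \<Longrightarrow> f \<in> instances P"
  by (auto simp: instances_def)

text \<open>Since the backward functional has no access to \<open>f\<close>, it must be computable
  on the union of all solution sets that can arise.\<close>

lemma sW_leI:
  assumes "computable_on (instances Q) \<Phi>" "computable_on (\<Union>f\<in>instances Q. P (\<Phi> f)) \<Psi>"
    and "\<And>f. f \<in> instances Q \<Longrightarrow> \<Phi> f \<in> instances P"
    and "\<And>f g. f \<in> instances Q \<Longrightarrow> g \<in> P (\<Phi> f) \<Longrightarrow> \<Psi> g \<in> Q f"
  shows "Q \<le>\<^sub>s\<^sub>W P"
proof -
  obtain d where d: "\<forall>f\<in>instances Q. maps_to d f (\<Phi> f)"
    using assms(1) unfolding computable_on_iff_index ..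
  obtain e where e: "\<forall>g\<in>(\<Union>f\<in>instances Q. P (\<Phi> f)). maps_to e g (\<Psi> g)"
    using assms(2) unfolding computable_on_iff_index ..
  show ?thesis
    unfolding sW_le_def
  proof (intro exI ballI)
    fix f assume f: "f \<in> instances Q"
    have "\<exists>k\<in>Q f. maps_to e g k" if "g \<in> P (\<Phi> f)" for g
      using assms(4)[OF f that] e f that by (intro bexI[of _ "\<Psi> g"]) auto
    then show "\<exists>h\<in>instances P. maps_to d f h \<and> (\<forall>g\<in>P h. \<exists>k\<in>Q f. maps_to e g k)"
      using assms(3)[OF f] d f by (intro bexI[of _ "\<Phi> f"]) simp_all
  qed
qed

lemma sW_leE:
  assumes "Q \<le>\<^sub>s\<^sub>W P"
  obtains \<Phi> \<Psi> where "computable_on (instances Q) \<Phi>" "computable_on (\<Union>f\<in>instances Q. P (\<Phi> f)) \<Psi>"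
    and "\<And>f. f \<in> instances Q \<Longrightarrow> \<Phi> f \<in> instances P"
    and "\<And>f g. f \<in> instances Q \<Longrightarrow> g \<in> P (\<Phi> f) \<Longrightarrow> \<Psi> g \<in> Q f"
proof -
  obtain d e where de: "\<forall>f\<in>instances Q. \<exists>h\<in>instances P. maps_to d f h \<and>
      (\<forall>g\<in>P h. \<exists>k\<in>Q f. maps_to e g k)"
    using assms unfolding sW_le_def by (elim exE) (rule that)
  \<comment> \<open>A functional has at most one output, so the outputs that \<open>sW_le\<close>
    merely asserts to exist are those read off by \<open>the\<close>.\<close>
  have eq: "(\<lambda>x. the (\<phi> i f x)) = h" if "maps_to i f h" for i f h
    using that unfolding maps_to_def by simp
  let ?F = "\<lambda>i f x. the (\<phi> i f x)"
  have 1: "?F d f \<in> instances P \<and> maps_to d f (?F d f) \<and>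
      (\<forall>g\<in>P (?F d f). maps_to e g (?F e g) \<and> ?F e g \<in> Q f)" if "f \<in> instances Q" for f
  proof -
    obtain h where h: "h \<in> instances P" "maps_to d f h" "\<forall>g\<in>P h. \<exists>k\<in>Q f. maps_to e g k"
      using de \<open>f \<in> instances Q\<close> by blast
    have "maps_to e g (?F e g) \<and> ?F e g \<in> Q f" if g: "g \<in> P h" for g
    proof -
      obtain k where k: "k \<in> Q f" "maps_to e g k" using bspec[OF h(3) g] ..
      show ?thesis unfolding eq[OF k(2)] using k by blast
    qed
    then show ?thesis unfolding eq[OF h(2)] using h(1,2) by blast
  qed
  show ?thesis
  proof (rule that)
    show "computable_on (instances Q) (?F d)"
      unfolding computable_on_iff_index using 1 by (intro exI[of _ d]) simp
    show "computable_on (\<Union>f\<in>instances Q. P (?F d f)) (?F e)"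
      unfolding computable_on_iff_index using 1 by (intro exI[of _ e]) simp
  qed (use 1 in simp_all)
qed

lemma sW_le_trans [trans]:
  assumes "R \<le>\<^sub>s\<^sub>W Q" "Q \<le>\<^sub>s\<^sub>W P"
  shows "R \<le>\<^sub>s\<^sub>W P"
proof -
  obtain \<Phi> \<Psi> where 1: "computable_on (instances R) \<Phi>" "computable_on (\<Union>f\<in>instances R. Q (\<Phi> f)) \<Psi>"
    "\<And>f. f \<in> instances R \<Longrightarrow> \<Phi> f \<in> instances Q" "\<And>f g. f \<in> instances R \<Longrightarrow> g \<in> Q (\<Phi> f) \<Longrightarrow> \<Psi> g \<in> R f"
    using assms(1) by (rule sW_leE) blast
  obtain \<Phi>' \<Psi>' where 2: "computable_on (instances Q) \<Phi>'" "computable_on (\<Union>f\<in>instances Q. P (\<Phi>' f)) \<Psi>'"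
    "\<And>f. f \<in> instances Q \<Longrightarrow> \<Phi>' f \<in> instances P" "\<And>f g. f \<in> instances Q \<Longrightarrow> g \<in> P (\<Phi>' f) \<Longrightarrow> \<Psi>' g \<in> Q f"
    using assms(2) by (rule sW_leE) blast
  let ?T = "\<Union>f\<in>instances R. P (\<Phi>' (\<Phi> f))"
  have "?T \<subseteq> (\<Union>f\<in>instances Q. P (\<Phi>' f))" using 1(3) by blast
  then have \<Psi>': "computable_on ?T \<Psi>'" using 2(2) computable_on_subset by blast
  show ?thesis
  proof (rule sW_leI)
    show "computable_on (instances R) (\<lambda>f. \<Phi>' (\<Phi> f))"
      by (rule computable_on_functional_comp[OF 2(1) 1(1)]) (use 1(3) in blast)
    show "computable_on ?T (\<lambda>g. \<Psi> (\<Psi>' g))"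
      by (rule computable_on_functional_comp[OF 1(2) \<Psi>']) (use 2(4) 1(3) in blast)
  qed (use 1(3,4) 2(3,4) in auto)
qed

text \<open>
  Every function that is limit computable in this uniform sense has a \<open>\<Delta>\<^sub>2\<close> index; the \<open>\<Pi>\<^sub>2\<close> half
  comes for free because the graph of a total function contains \<open>(x, y)\<close> iff it omits \<open>(x, y')\<close>
  for all \<open>y' \<noteq> y\<close>.
\<close>

definition Sigma2_on :: "baire set \<Rightarrow> (baire \<Rightarrow> baire) \<Rightarrow> bool" where
  "Sigma2_on S G \<longleftrightarrow> (\<exists>R. decidable_on S R \<and>
    (\<forall>f\<in>S. \<forall>x y. G f x = y \<longleftrightarrow>
      (\<exists>u. \<forall>v. R f (prod_encode (prod_encode (x, y), prod_encode (u, v))))))"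

lemma Sigma2_onI:
  assumes "decidable_on S (\<lambda>f z. R f (pfst (pfst z)) (psnd (pfst z)) (pfst (psnd z)) (psnd (psnd z)))"
    and "\<And>f x y. f \<in> S \<Longrightarrow> G f x = y \<longleftrightarrow> (\<exists>u. \<forall>v. R f x y u v)"
  shows "Sigma2_on S G"
  unfolding Sigma2_on_def
  by (rule exI[of _ "\<lambda>f z. R f (pfst (pfst z)) (psnd (pfst z)) (pfst (psnd z)) (psnd (psnd z))"])
    (use assms in simp)

lemma decidable_on_index:
  assumes "decidable_on S R"
  obtains e where "\<And>f. f \<in> S \<Longrightarrow> maps_to e f (char_fun {w. R f w})"
proof -
  have "computable_on S (\<lambda>f. char_fun {w. R f w})"
    using assms unfolding decidable_on_def by (rule computable_on_cong) (simp add: char_fun_def)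
  then obtain e where "\<forall>f\<in>S. maps_to e f (char_fun {w. R f w})"
    unfolding computable_on_iff_index ..
  then show ?thesis by (intro that[of e]) simp
qed

lemma all_pair_iff: "(\<forall>c. P (pfst c) (psnd c)) \<longleftrightarrow> (\<forall>x y. P x y)"
proof (intro iffI allI)
  fix x y assume "\<forall>c. P (pfst c) (psnd c)"
  from spec[OF this, of "prod_encode (x, y)"] show "P x y" by simp
qed simp

lemma Sigma2_on_Delta2_index:
  assumes "Sigma2_on S G"
  obtains j where "\<And>f. f \<in> S \<Longrightarrow> Delta2_index f j (G f)"
proof -
  obtain R where R: "decidable_on S R" "\<And>f x y. f \<in> S \<Longrightarrow> G f x = y \<longleftrightarrow>
      (\<exists>u. \<forall>v. R f (prod_encode (prod_encode (x, y), prod_encode (u, v))))"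
    using assms unfolding Sigma2_on_def by blast
  obtain a where a: "\<And>f. f \<in> S \<Longrightarrow> maps_to a f (char_fun {z. R f z})"
    by (rule decidable_on_index[OF R(1)]) (rule that)
  \<comment> \<open>With \<open>z\<close> coding \<open>((x, y), ((y', u), v))\<close>, this is
    \<open>((x, y'), (u, v))\<close>. The pair \<open>(y', u)\<close> merges two universal
    quantifiers into the single outer one of a \<open>Pi2_index\<close>.\<close>
  let ?w = "\<lambda>z. prod_encode (prod_encode (pfst (pfst z), pfst (pfst (psnd z))),
    prod_encode (psnd (pfst (psnd z)), psnd (psnd z)))"
  let ?B = "\<lambda>f z. pfst (pfst (psnd z)) = psnd (pfst z) \<or> \<not> R f (?w z)"
  have "decidable_on S (\<lambda>f z. R f (?w z))"
    by (rule decidable_on_compose[OF R(1)]) (intro comp)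
  then have "decidable_on S ?B"
    by (intro comp)
  then obtain b where b: "\<And>f. f \<in> S \<Longrightarrow> maps_to b f (char_fun {z. ?B f z})"
    by (rule decidable_on_index) (rule that)
  show ?thesis
  proof (rule that)
    fix f assume f: "f \<in> S"
    have graph: "z \<in> {prod_encode (x, G f x) |x. True} \<longleftrightarrow> G f (pfst z) = psnd z" for z
    proof
      assume "G f (pfst z) = psnd z"
      then have "z = prod_encode (pfst z, G f (pfst z))" by simp
      then show "z \<in> {prod_encode (x, G f x) |x. True}" by blast
    qed auto
    have "Sigma2_index f a {prod_encode (x, G f x) |x. True}"
      unfolding Sigma2_index_def
    proof (intro exI conjI set_eqI)
      fix z
      show "z \<in> {prod_encode (x, G f x) |x. True} \<longleftrightarrow>
          z \<in> {x. \<exists>u. \<forall>v. prod_encode (x, prod_encode (u, v)) \<in> {z. R f z}}"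
        unfolding graph R(2)[OF f] by simp
    qed (rule a[OF f])
    moreover have "Pi2_index f b {prod_encode (x, G f x) |x. True}"
      unfolding Pi2_index_def
    proof (intro exI conjI set_eqI)
      fix z
      have "G f (pfst z) = psnd z \<longleftrightarrow> (\<forall>y. y = psnd z \<or> G f (pfst z) \<noteq> y)"
        by auto
      also have "\<dots> \<longleftrightarrow> (\<forall>y u. \<exists>v. y = psnd z \<or>
          \<not> R f (prod_encode (prod_encode (pfst z, y), prod_encode (u, v))))"
        unfolding R(2)[OF f] by simp
      also have "\<dots> \<longleftrightarrow> (\<forall>c. \<exists>v. pfst c = psnd z \<or>
          \<not> R f (prod_encode (prod_encode (pfst z, pfst c), prod_encode (psnd c, v))))"
        by (rule all_pair_iff[symmetric])
      finally show "z \<in> {prod_encode (x, G f x) |x. True} \<longleftrightarrow>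
          z \<in> {x. \<forall>u. \<exists>v. prod_encode (x, prod_encode (u, v)) \<in> {z. ?B f z}}"
        unfolding graph by simp
    qed (rule b[OF f])
    ultimately show "Delta2_index f (prod_encode (a, b)) (G f)"
      unfolding Delta2_index_def by blast
  qed
qed

section \<open>The jump as composition with one limit computable partial map\<close>

definition jump_instances :: "baire set" where
  "jump_instances = {tjoin [f, num i] | f i. \<exists>g. Delta2_index f i g}"

definition jump_fun :: "baire \<Rightarrow> baire" where
  "jump_fun p = (THE g. \<exists>f i. p = tjoin [f, num i] \<and> Delta2_index f i g)"

lemma maps_to_unique:
  assumes "maps_to e f g" "maps_to e f h"
  shows "g = h"
proof
  fix x show "g x = h x"
    using spec[OF assms(1)[unfolded maps_to_def], of x] spec[OF assms(2)[unfolded maps_to_def], of x]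
    by simp
qed

lemma char_fun_eq_1_iff [simp]: "char_fun A x = Suc 0 \<longleftrightarrow> x \<in> A"
  by (simp add: char_fun_def)

lemma Sigma2_index_unique:
  assumes "Sigma2_index f e A" "Sigma2_index f e B"
  shows "A = B"
proof -
  from assms(1) obtain R where R: "maps_to e f (char_fun R)"
    "A = {x. \<exists>u. \<forall>v. prod_encode (x, prod_encode (u, v)) \<in> R}"
    unfolding Sigma2_index_def by (elim exE conjE) (rule that)
  from assms(2) obtain R' where R': "maps_to e f (char_fun R')"
    "B = {x. \<exists>u. \<forall>v. prod_encode (x, prod_encode (u, v)) \<in> R'}"
    unfolding Sigma2_index_def by (elim exE conjE) (rule that)
  have "x \<in> R \<longleftrightarrow> x \<in> R'" for x
    using fun_cong[OF maps_to_unique[OF R(1) R'(1)], of x] by (simp add: char_fun_def split: if_splits)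
  then have "R = R'" by (rule set_eqI)
  then show ?thesis using R(2) R'(2) by (simp only:)
qed

lemma Delta2_index_unique:
  assumes "Delta2_index f i g" "Delta2_index f i h"
  shows "g = h"
proof -
  from assms(1) obtain a b where 1: "i = prod_encode (a, b)"
    "Sigma2_index f a {prod_encode (x, g x) |x. True}"
    unfolding Delta2_index_def by (elim exE conjE) (rule that)
  from assms(2) obtain a' b' where 2: "i = prod_encode (a', b')"
    "Sigma2_index f a' {prod_encode (x, h x) |x. True}"
    unfolding Delta2_index_def by (elim exE conjE) (rule that)
  have "a = a'" using 1(1) 2(1) by simp
  then have eq: "{prod_encode (x, g x) |x. True} = {prod_encode (x, h x) |x. True}"
    using Sigma2_index_unique[OF 1(2)] 2(2) by simp
  show ?thesis
  proof
    fix x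
    have "prod_encode (x, g x) \<in> {prod_encode (x, h x) |x. True}"
      unfolding eq[symmetric] by blast
    then show "g x = h x" by auto
  qed
qed

lemma jump_fun_tjoin:
  assumes "Delta2_index f i g"
  shows "jump_fun (tjoin [f, num i]) = g"
  unfolding jump_fun_def
proof (rule the_equality)
  show "\<exists>f' i'. tjoin [f, num i] = tjoin [f', num i'] \<and> Delta2_index f' i' g"
    using assms by (intro exI conjI) (rule refl)
  fix h assume "\<exists>f' i'. tjoin [f, num i] = tjoin [f', num i'] \<and> Delta2_index f' i' h"
  then have "Delta2_index f i h" by auto
  then show "h = g" using assms by (rule Delta2_index_unique)
qed

lemma jump_instancesI: "Delta2_index f i g \<Longrightarrow> tjoin [f, num i] \<in> jump_instances"
  unfolding jump_instances_def by (intro CollectI exI conjI) (rule refl)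

lemma jump_instancesE:
  assumes "p \<in> jump_instances"
  obtains f i g where "p = tjoin [f, num i]" "Delta2_index f i g"
  using assms unfolding jump_instances_def mem_Collect_eq by (elim exE conjE) (rule that)

text \<open>Decoding an index does not involve \<open>P\<close>. Hence facts about jumps reduce to
  the single fact that \<open>jump_fun\<close> is limit computable, and a jump never changes
  solutions.\<close>

lemma jump_eq: "jump P p = (if p \<in> jump_instances then P (jump_fun p) else {})"
proof (intro set_eqI iffI)
  fix h assume "h \<in> jump P p"
  then obtain f i g where "p = tjoin [f, num i]" "Delta2_index f i g" "h \<in> P g"
    unfolding jump_def mem_Collect_eq by (elim exE conjE) (rule that)
  then show "h \<in> (if p \<in> jump_instances then P (jump_fun p) else {})"
    by (simp add: jump_fun_tjoin jump_instancesI)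
next
  fix h assume h: "h \<in> (if p \<in> jump_instances then P (jump_fun p) else {})"
  then have "p \<in> jump_instances" by (simp split: if_splits)
  then obtain f i g where p: "p = tjoin [f, num i]" "Delta2_index f i g"
    by (rule jump_instancesE)
  with h have "h \<in> P g"
    by (simp add: jump_fun_tjoin jump_instancesI)
  with p show "h \<in> jump P p"
    unfolding jump_def mem_Collect_eq by (intro exI conjI)
qed

lemma instances_jump: "p \<in> instances (jump P) \<longleftrightarrow> p \<in> jump_instances \<and> jump_fun p \<in> instances P"
  unfolding instances_def jump_eq by auto

text \<open>The instance carries its own index: the first half of the number in component 1 computes
  the matrix relative to component 0, and the universal functional evaluates it.\<close>

lemma Sigma2_on_jump_fun: "Sigma2_on jump_instances jump_fun"
proof -
  let ?V = "\<lambda>p w. the (\<phi> (pfst (component p 1 0)) (component p 0) w)"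
  have ex: "\<exists>R. (\<forall>w. \<phi> (pfst (component p 1 0)) (component p 0) w = Some (char_fun R w)) \<and>
      {prod_encode (x, jump_fun p x) |x. True} =
        {x. \<exists>u. \<forall>v. prod_encode (x, prod_encode (u, v)) \<in> R}"
    if p0: "p \<in> jump_instances" for p
  proof -
    obtain f i g where p: "p = tjoin [f, num i]" and g: "Delta2_index f i g"
      using p0 by (rule jump_instancesE)
    from g obtain a b where i: "i = prod_encode (a, b)"
      and a: "Sigma2_index f a {prod_encode (x, g x) |x. True}"
      unfolding Delta2_index_def by (elim exE conjE) (rule that)
    then obtain R where "maps_to a f (char_fun R)"
      "{prod_encode (x, g x) |x. True} = {x. \<exists>u. \<forall>v. prod_encode (x, prod_encode (u, v)) \<in> R}"
      unfolding Sigma2_index_def by (elim exE conjE) (rule that)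
    then show ?thesis
      unfolding p jump_fun_tjoin[OF g] by (intro exI[of _ R]) (simp add: i maps_to_def)
  qed
  have V: "\<phi> (pfst (component p 1 0)) (component p 0) w = Some (?V p w)"
    if p0: "p \<in> jump_instances" for p w
  proof -
    from ex[OF p0] obtain y where "\<phi> (pfst (component p 1 0)) (component p 0) w = Some y"
      by (elim exE conjE) (rule that, erule spec)
    then show ?thesis by (simp only: option.sel)
  qed
  have "computable_on jump_instances ?V"
    by (rule computable_on_phi[where E = "\<lambda>p w. pfst (component p 1 0)" and A = "\<lambda>p w. w"
          and G = "\<lambda>p z. component p 0", OF _ _ _ V]) (intro comp)+
  then have "decidable_on jump_instances (\<lambda>p w. ?V p w = 1)"
    by (intro comp)
  moreover have "jump_fun p x = y \<longleftrightarrow>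
      (\<exists>u. \<forall>v. ?V p (prod_encode (prod_encode (x, y), prod_encode (u, v))) = 1)"
    if p: "p \<in> jump_instances" for p x y
  proof -
    from ex[OF p] obtain R where R: "\<And>w. \<phi> (pfst (component p 1 0)) (component p 0) w = Some (char_fun R w)"
      and graph: "{prod_encode (x, jump_fun p x) |x. True} =
        {x. \<exists>u. \<forall>v. prod_encode (x, prod_encode (u, v)) \<in> R}"
      by (elim exE conjE) (rule that, erule spec)
    have "jump_fun p x = y \<longleftrightarrow> prod_encode (x, y) \<in> {prod_encode (x, jump_fun p x) |x. True}"
      by auto
    then show ?thesis unfolding graph R by simp
  qed
  ultimately show ?thesis unfolding Sigma2_on_def by blast
qed

lemma Sigma2_on_precompose:
  assumes "Sigma2_on T G" "computable_on S H" "H ` S \<subseteq> T"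
  shows "Sigma2_on S (\<lambda>f. G (H f))"
proof -
  obtain R where R: "decidable_on T R" "\<forall>f\<in>T. \<forall>x y. G f x = y \<longleftrightarrow>
      (\<exists>u. \<forall>v. R f (prod_encode (prod_encode (x, y), prod_encode (u, v))))"
    using assms(1) unfolding Sigma2_on_def by blast
  have "decidable_on S (\<lambda>f z. R (H f) z)"
    using R(1) unfolding decidable_on_def
    by (rule computable_on_functional_comp[OF _ assms(2,3)])
  then show ?thesis
    unfolding Sigma2_on_def using R(2) assms(3) by (intro exI[of _ "\<lambda>f. R (H f)"]) auto
qed

text \<open>
  The witness for \<open>H (G f) x = y\<close> is a certificate with finitely many oracle assertions, together
  with a finite set assigning a witness to each of them; the remaining condition is a single
  universal quantifier.
\<close>

lemma Sigma2_on_postcompose: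
  assumes "Sigma2_on S G" "computable_on T H" "G ` S \<subseteq> T"
  shows "Sigma2_on S (\<lambda>f. H (G f))"
proof -
  obtain R where R: "decidable_on S R" "\<And>f x y. f \<in> S \<Longrightarrow> G f x = y \<longleftrightarrow>
      (\<exists>u. \<forall>v. R f (prod_encode (prod_encode (x, y), prod_encode (u, v))))"
    using assms(1) unfolding Sigma2_on_def by blast
  obtain e where e: "\<And>g. g \<in> T \<Longrightarrow> maps_to e g (H g)"
    using assms(2) unfolding computable_on_iff_index by blast
  let ?R = "\<lambda>f w v. R f (prod_encode (prod_encode (pfst w, pfst (psnd w)),
    prod_encode (psnd (psnd w), v)))"
  let ?P = "\<lambda>f x y u v.
    certificate (\<lambda>a b. \<exists>w<psnd u. triple a b w \<in> set_decode (psnd u)) (pfst u) \<and>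
    triple e x y \<in> set_decode (pfst u) \<and> (\<forall>w\<in>set_decode (psnd u). ?R f w v)"
  show ?thesis
  proof (rule Sigma2_onI[of S ?P])
    have "decidable_on S (\<lambda>f z. ?R f (psnd z) (psnd (psnd (pfst z))))"
      by (rule decidable_on_compose[OF R(1)]) (intro comp)
    then show "decidable_on S (\<lambda>f z. ?P f (pfst (pfst z)) (psnd (pfst z)) (pfst (psnd z)) (psnd (psnd z)))"
      by (intro comp)
  next
    fix f x y assume f: "f \<in> S"
    have Ge: "H (G f) x = y \<longleftrightarrow> \<phi> e (G f) x = Some y"
      using e[of "G f"] f assms(3) unfolding maps_to_def by auto
    show "H (G f) x = y \<longleftrightarrow> (\<exists>u. \<forall>v. ?P f x y u v)"
    proof
      assume "H (G f) x = y"
      then obtain D where D: "certificate (\<lambda>a b. G f a = b) D" "triple e x y \<in> set_decode D"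
        unfolding Ge phi_eq_Some_iff by blast
      have "\<forall>a. \<exists>u. \<forall>v. R f (prod_encode (prod_encode (a, G f a), prod_encode (u, v)))"
        using R(2)[OF f] by blast
      then obtain c where c: "\<And>a v. R f (prod_encode (prod_encode (a, G f a), prod_encode (c a, v)))"
        by metis
      \<comment> \<open>The certificate queries the oracle only below \<open>D\<close>, so finitely
        many values with their witnesses suffice.\<close>
      define W where "W = set_encode ((\<lambda>a. triple a (G f a) (c a)) ` {..<D})"
      have W: "set_decode W = (\<lambda>a. triple a (G f a) (c a)) ` {..<D}"
        by (simp add: W_def)
      have "certificate (\<lambda>a b. \<exists>w<W. triple a b w \<in> set_decode W) D"
      proof (rule certificate_mono[OF D(1)])
        fix a b assume "triple 4 a b \<in> set_decode D" "G f a = b"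
        then have "triple a b (c a) \<in> set_decode W"
          using triple_less(2) unfolding W by blast
        then show "\<exists>w<W. triple a b w \<in> set_decode W"
          using triple_less(3) by blast
      qed
      then have "\<forall>v. ?P f x y (prod_encode (D, W)) v"
        using D(2) c by (auto simp: W)
      then show "\<exists>u. \<forall>v. ?P f x y u v" by blast
    next
      assume "\<exists>u. \<forall>v. ?P f x y u v"
      then obtain D W where D: "certificate (\<lambda>a b. \<exists>w<W. triple a b w \<in> set_decode W) D"
        "triple e x y \<in> set_decode D" and W: "\<And>w v. w \<in> set_decode W \<Longrightarrow> ?R f w v"
        by blast
      have "certificate (\<lambda>a b. G f a = b) D"
      proof (rule certificate_mono[OF D(1)])
        fix a b assume "\<exists>w<W. triple a b w \<in> set_decode W"
        then obtain w where "triple a b w \<in> set_decode W" by blast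
        from W[OF this] show "G f a = b" unfolding R(2)[OF f] by auto
      qed
      with D(2) show "H (G f) x = y" unfolding Ge phi_eq_Some_iff by blast
    qed
  qed
qed

lemma Sigma2_on_tjoin3:
  assumes "computable_on S A" "computable_on S B" "Sigma2_on S G"
  shows "Sigma2_on S (\<lambda>f. tjoin [A f, B f, G f])"
proof -
  obtain R where R: "decidable_on S R" "\<And>f x y. f \<in> S \<Longrightarrow> G f x = y \<longleftrightarrow>
      (\<exists>u. \<forall>v. R f (prod_encode (prod_encode (x, y), prod_encode (u, v))))"
    using assms(3) unfolding Sigma2_on_def by blast
  \<comment> \<open>Correct everywhere outside the component with index 2, where the zero function
    is a placeholder; there the matrix for \<open>G\<close> takes over.\<close>
  let ?J = "\<lambda>f. tjoin [A f, B f, \<lambda>_. 0]"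
  let ?P = "\<lambda>f x y u v. if x = 0 \<or> pfst (x - 1) \<noteq> 2 then ?J f x = y
    else R f (prod_encode (prod_encode (psnd (x - 1), y), prod_encode (u, v)))"
  show ?thesis
  proof (rule Sigma2_onI[of S ?P])
    have "computable_on S (\<lambda>f z. A f (psnd z))" "computable_on S (\<lambda>f z. B f (psnd z))"
      by (rule computable_on_compose[OF assms(1)] computable_on_compose[OF assms(2)], intro comp)+
    moreover have "decidable_on S (\<lambda>f z. R f (prod_encode
      (prod_encode (psnd (pfst (pfst z) - 1), psnd (pfst z)), prod_encode (pfst (psnd z), psnd (psnd z)))))"
      by (rule decidable_on_compose[OF R(1)]) (intro comp)
    ultimately show "decidable_on S
        (\<lambda>f z. ?P f (pfst (pfst z)) (psnd (pfst z)) (pfst (psnd z)) (psnd (psnd z)))"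
      by (intro comp)
  next
    fix f x y assume f: "f \<in> S"
    show "tjoin [A f, B f, G f] x = y \<longleftrightarrow> (\<exists>u. \<forall>v. ?P f x y u v)"
    proof (cases "x = 0 \<or> pfst (x - 1) \<noteq> 2")
      case True
      then have "tjoin [A f, B f, G f] x = ?J f x"
        by (cases x) (auto simp: tjoin_def Let_def less_Suc_eq numeral_2_eq_2 split: prod.split)
      with True show ?thesis by simp
    next
      case False
      then obtain m where "x = Suc (prod_encode (2, m))"
        by (metis Suc_pred' diff_Suc_1 gr0I prod.collapse prod_decode_inverse)
      then show ?thesis using R(2)[OF f] by simp
    qed
  qed
qed

text \<open>The whole jump instance \<open>p\<close> serves as the new parameter, with one index
  \<open>j\<close>, independent of \<open>p\<close>, for the limit computable map from
  \<open>p\<close> to \<open>\<Phi> (jump_fun p)\<close>. The backward functional is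
  unchanged.\<close>

lemma jump_mono:
  assumes "Q \<le>\<^sub>s\<^sub>W P"
  shows "jump Q \<le>\<^sub>s\<^sub>W jump P"
proof -
  obtain \<Phi> \<Psi> where \<Phi>: "computable_on (instances Q) \<Phi>" "\<And>f. f \<in> instances Q \<Longrightarrow> \<Phi> f \<in> instances P"
    and \<Psi>: "computable_on (\<Union>f\<in>instances Q. P (\<Phi> f)) \<Psi>"
      "\<And>f g. f \<in> instances Q \<Longrightarrow> g \<in> P (\<Phi> f) \<Longrightarrow> \<Psi> g \<in> Q f"
    using assms by (rule sW_leE) blast
  have "Sigma2_on (instances (jump Q)) jump_fun"
    by (rule Sigma2_on_precompose[OF Sigma2_on_jump_fun, of _ "\<lambda>p. p"])
      (intro comp, auto simp: instances_jump)
  then have "Sigma2_on (instances (jump Q)) (\<lambda>p. \<Phi> (jump_fun p))"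
    using \<Phi>(1) by (rule Sigma2_on_postcompose) (auto simp: instances_jump)
  then obtain j where j: "\<And>p. p \<in> instances (jump Q) \<Longrightarrow> Delta2_index p j (\<Phi> (jump_fun p))"
    using Sigma2_on_Delta2_index by blast
  have jump_P: "jump P (tjoin [p, num j]) = P (\<Phi> (jump_fun p))" if "p \<in> instances (jump Q)" for p
    using j[OF that] jump_fun_tjoin[OF j[OF that]] by (auto simp: jump_eq jump_instances_def)
  show ?thesis
  proof (rule sW_leI)
    show "computable_on (instances (jump Q)) (\<lambda>p. tjoin [p, num j])"
      by (intro comp)
    show "computable_on (\<Union>p\<in>instances (jump Q). jump P (tjoin [p, num j])) \<Psi>"
      by (rule computable_on_subset[OF \<Psi>(1)]) (auto simp: jump_P instances_jump)
    show "tjoin [p, num j] \<in> instances (jump P)" if p: "p \<in> instances (jump Q)" for p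
    proof -
      have "\<Phi> (jump_fun p) \<in> instances P"
        using p by (intro \<Phi>(2)) (simp add: instances_jump)
      then show ?thesis by (simp add: instances_def jump_P[OF p])
    qed
    show "\<Psi> g \<in> jump Q p" if "p \<in> instances (jump Q)" "g \<in> jump P (tjoin [p, num j])" for p g
      using that \<Psi>(2) unfolding jump_P[OF that(1)] by (simp add: instances_jump) (simp add: jump_eq)
  qed
qed

lemma iter_jump_0 [simp]: "iter_jump P 0 = P"
  by (simp add: iter_jump_def)

lemma iter_jump_Suc [simp]: "iter_jump P (Suc n) = jump (iter_jump P n)"
  by (simp add: iter_jump_def)

lemma iter_jump_mono: "Q \<le>\<^sub>s\<^sub>W P \<Longrightarrow> iter_jump Q n \<le>\<^sub>s\<^sub>W iter_jump P n"
  by (induction n) (auto intro: jump_mono)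

section \<open>First-order parts\<close>

lemma first_order_partE:
  assumes "z \<in> first_order_part P p"
  obtains f d e h where "p = tjoin [f, num d, num e]" "maps_to d f h"
  using assms unfolding first_order_part_def mem_Collect_eq by (elim exE conjE) (rule that)

lemma first_order_part_eq:
  assumes h: "maps_to d f h"
  shows "first_order_part P (tjoin [f, num d, num e]) =
    (if P h \<noteq> {} \<and> (\<forall>g\<in>P h. \<phi> e (tjoin [f, g]) 0 \<noteq> None)
     then {num y |y. \<exists>g\<in>P h. \<phi> e (tjoin [f, g]) 0 = Some y} else {})"
    (is "_ = ?rhs")
proof (intro set_eqI iffI)
  fix z assume "z \<in> first_order_part P (tjoin [f, num d, num e])"
  then obtain y f' d' e' h' where
    1: "z = num y" "tjoin [f, num d, num e] = tjoin [f', num d', num e']" "maps_to d' f' h'"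
      "h' \<in> instances P" "\<forall>g\<in>P h'. \<phi> e' (tjoin [f', g]) 0 \<noteq> None"
      "\<exists>g\<in>P h'. \<phi> e' (tjoin [f', g]) 0 = Some y"
    unfolding first_order_part_def mem_Collect_eq by (elim exE conjE) (rule that)
  from 1(2) have 2: "f' = f" "d' = d" "e' = e" by simp_all
  have 3: "h' = h" using 1(3) h unfolding 2 by (rule maps_to_unique)
  show "z \<in> ?rhs" using 1 unfolding 2 3 by (auto simp: instances_def)
next
  fix z assume z: "z \<in> ?rhs"
  then have 1: "h \<in> instances P" "\<forall>g\<in>P h. \<phi> e (tjoin [f, g]) 0 \<noteq> None"
    and "z \<in> {num y |y. \<exists>g\<in>P h. \<phi> e (tjoin [f, g]) 0 = Some y}"
    by (auto simp: instances_def split: if_splits)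
  then obtain y where "z = num y" "\<exists>g\<in>P h. \<phi> e (tjoin [f, g]) 0 = Some y"
    by (auto simp only: mem_Collect_eq)
  with 1 h have "z = num y \<and> tjoin [f, num d, num e] = tjoin [f, num d, num e] \<and> maps_to d f h \<and>
      h \<in> instances P \<and> (\<forall>g\<in>P h. \<phi> e (tjoin [f, g]) 0 \<noteq> None) \<and>
      (\<exists>g\<in>P h. \<phi> e (tjoin [f, g]) 0 = Some y)"
    by (intro conjI refl)
  then show "z \<in> first_order_part P (tjoin [f, num d, num e])"
    unfolding first_order_part_def mem_Collect_eq by (intro exI)
qed

text \<open>Solution sets must agree on the smaller domain, not just be included, since first-order
  parts quantify both universally and existentially over solutions. In this form the relation passes
  pointwise through jumps and first-order parts.\<close>

definition restricts :: "problem \<Rightarrow> problem \<Rightarrow> bool" where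
  "restricts P Q \<longleftrightarrow> (\<forall>p. P p = {} \<or> P p = Q p)"

lemma restricts_jump: "restricts P Q \<Longrightarrow> restricts (jump P) (jump Q)"
  unfolding restricts_def jump_eq by simp

lemma restricts_iter_jump: "restricts P Q \<Longrightarrow> restricts (iter_jump P n) (iter_jump Q n)"
  by (induction n) (simp_all add: restricts_jump)

lemma restricts_first_order_part:
  assumes "restricts P Q"
  shows "restricts (first_order_part P) (first_order_part Q)"
  unfolding restricts_def
proof (intro allI disjCI)
  fix p assume "first_order_part P p \<noteq> first_order_part Q p"
  show "first_order_part P p = {}"
  proof (rule ccontr)
    assume "first_order_part P p \<noteq> {}"
    then obtain z where "z \<in> first_order_part P p" by (meson ex_in_conv)
    then obtain f d e h where p: "p = tjoin [f, num d, num e]" and h: "maps_to d f h"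
      by (rule first_order_partE)
    have "P h \<noteq> {}"
      using \<open>z \<in> first_order_part P p\<close> unfolding p first_order_part_eq[OF h] by (simp split: if_splits)
    then have "P h = Q h" using spec[OF assms[unfolded restricts_def], of h] by blast
    then show False
      using \<open>first_order_part P p \<noteq> first_order_part Q p\<close>
      unfolding p first_order_part_eq[OF h] \<open>P h = Q h\<close> by simp
  qed
qed

lemma restricts_sW_le:
  assumes "restricts Q P"
  shows "Q \<le>\<^sub>s\<^sub>W P"
proof (rule sW_leI)
  show "computable_on (instances Q) (\<lambda>f. f)" "computable_on (\<Union>f\<in>instances Q. P f) (\<lambda>f. f)"
    by (intro comp)+
qed (use assms in \<open>auto simp: restricts_def instances_def\<close>)

text \<open>
  In contrast to the first-order part, the instance \<open>h\<close> of \<open>P\<close> is given here and not computed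
  from \<open>f\<close>, so that the jump can be moved outside.
\<close>

definition evaluation :: "problem \<Rightarrow> problem" where
  "evaluation P = (\<lambda>p. {num y | y f e h. p = tjoin [f, num e, h] \<and>
     (\<forall>g\<in>P h. \<phi> e (tjoin [f, g]) 0 \<noteq> None) \<and> (\<exists>g\<in>P h. \<phi> e (tjoin [f, g]) 0 = Some y)})"

lemma evaluationE:
  assumes "p \<in> instances (evaluation P)"
  obtains f e h g where "p = tjoin [f, num e, h]" "g \<in> P h"
proof -
  obtain z where "z \<in> evaluation P p"
    using assms unfolding instances_def mem_Collect_eq by (meson ex_in_conv)
  then obtain f e h where "p = tjoin [f, num e, h]" "\<exists>g. g \<in> P h"
    unfolding evaluation_def mem_Collect_eq by (elim exE conjE bexE) (rule that, assumption, erule exI)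
  then show ?thesis by (elim exE) (rule that)
qed

lemma evaluation_eq:
  "evaluation P (tjoin [f, num e, h]) =
    (if \<forall>g\<in>P h. \<phi> e (tjoin [f, g]) 0 \<noteq> None
     then {num y |y. \<exists>g\<in>P h. \<phi> e (tjoin [f, g]) 0 = Some y} else {})"
    (is "_ = ?rhs")
proof (intro set_eqI iffI)
  fix z assume "z \<in> evaluation P (tjoin [f, num e, h])"
  then obtain y f' e' h' where
    1: "z = num y" "tjoin [f, num e, h] = tjoin [f', num e', h']"
      "\<forall>g\<in>P h'. \<phi> e' (tjoin [f', g]) 0 \<noteq> None" "\<exists>g\<in>P h'. \<phi> e' (tjoin [f', g]) 0 = Some y"
    unfolding evaluation_def mem_Collect_eq by (elim exE conjE) (rule that)
  from 1(2) have 2: "f' = f" "e' = e" "h' = h" by simp_all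
  show "z \<in> ?rhs" using 1 unfolding 2 by auto
next
  fix z assume z: "z \<in> ?rhs"
  then have 1: "\<forall>g\<in>P h. \<phi> e (tjoin [f, g]) 0 \<noteq> None"
    and "z \<in> {num y |y. \<exists>g\<in>P h. \<phi> e (tjoin [f, g]) 0 = Some y}"
    by (auto split: if_splits)
  then obtain y where "z = num y" "\<exists>g\<in>P h. \<phi> e (tjoin [f, g]) 0 = Some y"
    by (auto simp only: mem_Collect_eq)
  with 1 have "z = num y \<and> tjoin [f, num e, h] = tjoin [f, num e, h] \<and>
      (\<forall>g\<in>P h. \<phi> e (tjoin [f, g]) 0 \<noteq> None) \<and> (\<exists>g\<in>P h. \<phi> e (tjoin [f, g]) 0 = Some y)"
    by (intro conjI refl)
  then show "z \<in> evaluation P (tjoin [f, num e, h])"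
    unfolding evaluation_def mem_Collect_eq by (intro exI)
qed

text \<open>The instance \<open>h\<close> can be computed from \<open>f\<close> and the index
  \<open>d\<close> by the universal functional; the solution sets then coincide and the backward
  functional is the identity.\<close>

lemma first_order_part_le_evaluation: "first_order_part P \<le>\<^sub>s\<^sub>W evaluation P"
proof -
  let ?S = "instances (first_order_part P)"
  let ?h = "\<lambda>p x. the (\<phi> (component p 1 0) (component p 0) x)"
  let ?F = "\<lambda>p. tjoin [component p 0, component p 2, ?h p]"
  have S: "\<exists>f d e h. p = tjoin [f, num d, num e] \<and> maps_to d f h" if p: "p \<in> ?S" for p
  proof -
    obtain z where "z \<in> first_order_part P p"
      using p unfolding instances_def mem_Collect_eq by (meson ex_in_conv)
    then show ?thesis by (rule first_order_partE) (intro exI conjI)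
  qed
  have h: "\<phi> (component p 1 0) (component p 0) x = Some (?h p x)" if p: "p \<in> ?S" for p x
    using S[OF p] by (elim exE conjE) (simp add: maps_to_def)
  have eq: "evaluation P (?F p) = first_order_part P p" if p: "p \<in> ?S" for p
  proof -
    from S[OF p] obtain f d e h where fde: "p = tjoin [f, num d, num e]" and h: "maps_to d f h"
      by (elim exE conjE) (rule that)
    have "?F p = tjoin [f, num e, h]"
      using h by (simp add: fde maps_to_def)
    moreover have "P h \<noteq> {}"
      using p unfolding fde instances_def mem_Collect_eq first_order_part_eq[OF h] by (simp split: if_splits)
    ultimately show ?thesis
      unfolding fde first_order_part_eq[OF h] by (simp only: evaluation_eq) simp
  qed
  have "computable_on ?S ?h"
    by (rule computable_on_phi[where E = "\<lambda>p w. component p 1 0" and A = "\<lambda>p w. w"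
          and G = "\<lambda>p z. component p 0", OF _ _ _ h]) (intro comp)+
  then have h': "computable_on ?S (\<lambda>p z. ?h p (psnd z))"
    by (rule computable_on_compose) (intro comp)
  show ?thesis
  proof (rule sW_leI)
    show "computable_on ?S ?F"
      by (intro comp h')
    show "computable_on (\<Union>p\<in>?S. evaluation P (?F p)) (\<lambda>g. g)"
      by (intro comp)
    show "?F p \<in> instances (evaluation P)" if p: "p \<in> ?S" for p
    proof -
      from p show ?thesis unfolding instances_def mem_Collect_eq eq[OF p] .
    qed
    show "g \<in> first_order_part P p" if p: "p \<in> ?S" and g: "g \<in> evaluation P (?F p)" for p g
      using g unfolding eq[OF p] .
  qed
qed

text \<open>The program \<open>e\<close> consults \<open>f\<close> and a solution but never
  \<open>h\<close>. So only the third component has to be replaced by the instance that it indexes,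
  and the resulting triple is limit computable from \<open>p\<close>.\<close>

lemma evaluation_jump_le: "evaluation (jump P) \<le>\<^sub>s\<^sub>W jump (evaluation P)"
proof -
  let ?S = "instances (evaluation (jump P))"
  let ?K = "\<lambda>p. tjoin [component p 0, component p 1, jump_fun (component p 2)]"
  have S: "component p 2 \<in> jump_instances \<and> evaluation P (?K p) = evaluation (jump P) p"
    if p: "p \<in> ?S" for p
  proof -
    obtain f e h g where p_eq: "p = tjoin [f, num e, h]" and "g \<in> jump P h"
      using p by (rule evaluationE)
    then have h: "h \<in> jump_instances" "jump P h = P (jump_fun h)"
      by (simp_all add: jump_eq split: if_splits)
    have K: "?K p = tjoin [f, num e, jump_fun h]"
      by (simp add: p_eq)
    have "evaluation P (?K p) = evaluation P (tjoin [f, num e, jump_fun h])"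
      by (simp only: K)
    also have "\<dots> = evaluation (jump P) p"
      unfolding p_eq evaluation_eq h(2) ..
    finally have "evaluation P (?K p) = evaluation (jump P) p" .
    then show ?thesis using h(1) by (simp add: p_eq)
  qed
  have "Sigma2_on ?S (\<lambda>p. jump_fun (component p 2))"
    by (rule Sigma2_on_precompose[OF Sigma2_on_jump_fun]) (intro comp, use S in blast)
  then have "Sigma2_on ?S ?K"
    by (intro Sigma2_on_tjoin3) (intro comp)+
  then obtain j where j: "\<And>p. p \<in> ?S \<Longrightarrow> Delta2_index p j (?K p)"
    by (rule Sigma2_on_Delta2_index) (rule that)
  have eq: "jump (evaluation P) (tjoin [p, num j]) = evaluation (jump P) p" if p: "p \<in> ?S" for p
  proof -
    have "jump (evaluation P) (tjoin [p, num j]) = evaluation P (?K p)"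
      unfolding jump_eq jump_fun_tjoin[OF j[OF p]]
      using jump_instancesI[OF j[OF p]] by (rule if_P)
    then show ?thesis using S[OF p] by (simp only:)
  qed
  show ?thesis
  proof (rule sW_leI)
    show "computable_on ?S (\<lambda>p. tjoin [p, num j])"
      by (intro comp)
    show "computable_on (\<Union>p\<in>?S. jump (evaluation P) (tjoin [p, num j])) (\<lambda>g. g)"
      by (intro comp)
    show "tjoin [p, num j] \<in> instances (jump (evaluation P))" if p: "p \<in> ?S" for p
    proof -
      from p show ?thesis unfolding instances_def mem_Collect_eq eq[OF p] .
    qed
    show "g \<in> evaluation (jump P) p"
      if p: "p \<in> ?S" and g: "g \<in> jump (evaluation P) (tjoin [p, num j])" for p g
      using g unfolding eq[OF p] .
  qed
qed

lemma sW_le_refl: "P \<le>\<^sub>s\<^sub>W P"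
  by (rule restricts_sW_le) (simp add: restricts_def)

lemma evaluation_iter_jump_le: "evaluation (iter_jump P n) \<le>\<^sub>s\<^sub>W iter_jump (evaluation P) n"
proof (induction n)
  case (Suc n)
  from sW_le_trans[OF evaluation_jump_le jump_mono[OF this]] show ?case by simp
qed (simp add: sW_le_refl)

text \<open>The value at 0 determines a solution in the range of \<open>num\<close>. Thus
  \<open>f\<close>, the forward functional and the program sending \<open>tjoin [f, g]\<close> to
  \<open>\<Psi> g 0\<close> form an instance with exactly the right solutions.\<close>

lemma le_first_order_part:
  assumes "Q \<le>\<^sub>s\<^sub>W P" and num: "\<And>p. Q p \<subseteq> range num"
  shows "Q \<le>\<^sub>s\<^sub>W first_order_part P"
proof -
  obtain \<Phi> \<Psi> where \<Phi>: "computable_on (instances Q) \<Phi>" "\<And>f. f \<in> instances Q \<Longrightarrow> \<Phi> f \<in> instances P"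
    and \<Psi>: "computable_on (\<Union>f\<in>instances Q. P (\<Phi> f)) \<Psi>"
      "\<And>f g. f \<in> instances Q \<Longrightarrow> g \<in> P (\<Phi> f) \<Longrightarrow> \<Psi> g \<in> Q f"
    using assms(1) by (rule sW_leE) (rule that)
  let ?T = "\<Union>f\<in>instances Q. (\<lambda>g. tjoin [f, g]) ` P (\<Phi> f)"
  from \<Phi>(1) obtain d where "\<forall>f\<in>instances Q. maps_to d f (\<Phi> f)"
    unfolding computable_on_iff_index ..
  then have d: "maps_to d f (\<Phi> f)" if f: "f \<in> instances Q" for f
    using f by simp
  have "computable_on ?T (\<lambda>r. \<Psi> (component r 1))"
    by (rule computable_on_functional_comp[OF \<Psi>(1)]) (intro comp, auto)
  then obtain e where "\<forall>r\<in>?T. maps_to e r (\<Psi> (component r 1))"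
    unfolding computable_on_iff_index ..
  then have e: "\<phi> e (tjoin [f, g]) 0 = Some (\<Psi> g 0)" if f: "f \<in> instances Q" and g: "g \<in> P (\<Phi> f)" for f g
    using f g by (auto simp: maps_to_def)
  have eq: "first_order_part P (tjoin [f, num d, num e]) = \<Psi> ` P (\<Phi> f)" if f: "f \<in> instances Q" for f
  proof -
    have num': "num (\<Psi> g 0) = \<Psi> g" if g: "g \<in> P (\<Phi> f)" for g
    proof -
      have "\<Psi> g \<in> range num" using \<Psi>(2)[OF f g] num[of f] by (rule subsetD[rotated])
      then show ?thesis by auto
    qed
    have "first_order_part P (tjoin [f, num d, num e]) = {num y |y. \<exists>g\<in>P (\<Phi> f). \<Psi> g 0 = y}"
      unfolding first_order_part_eq[OF d[OF f]] using \<Phi>(2)[OF f] by (simp add: e[OF f] instances_def)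
    also have "\<dots> = (\<lambda>g. num (\<Psi> g 0)) ` P (\<Phi> f)" by (simp add: image_def) auto
    also have "\<dots> = \<Psi> ` P (\<Phi> f)" using num' by (rule image_cong[OF refl])
    finally show ?thesis .
  qed
  show ?thesis
  proof (rule sW_leI)
    show "computable_on (instances Q) (\<lambda>f. tjoin [f, num d, num e])"
      by (intro comp)
    show "computable_on (\<Union>f\<in>instances Q. first_order_part P (tjoin [f, num d, num e])) (\<lambda>g. g)"
      by (intro comp)
    show "tjoin [f, num d, num e] \<in> instances (first_order_part P)" if f: "f \<in> instances Q" for f
      unfolding instances_def mem_Collect_eq eq[OF f] using \<Phi>(2)[OF f] by (simp add: instances_def)
    show "g \<in> Q f" if f: "f \<in> instances Q" and g: "g \<in> first_order_part P (tjoin [f, num d, num e])" for f g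
      using g \<Psi>(2)[OF f] unfolding eq[OF f] by auto
  qed
qed

lemma jump_subset: "(\<And>p. P p \<subseteq> A) \<Longrightarrow> jump P p \<subseteq> A"
  by (simp add: jump_eq)

lemma iter_jump_subset: "(\<And>p. P p \<subseteq> A) \<Longrightarrow> iter_jump P n p \<subseteq> A"
  by (induction n arbitrary: p) (simp_all add: jump_subset)

section \<open>Choosing a candidate that is never rejected\<close>

text \<open>A decreasing sequence of nonempty clopen subsets of Cantor space has a common point. The
  modulus \<open>b\<close> is left open because the two applications inspect different numbers of
  bits.\<close>

lemma compactness:
  fixes R :: "nat \<Rightarrow> (nat \<Rightarrow> bool) \<Rightarrow> bool"
  assumes ex: "\<And>n. \<exists>X. R n X" and dec: "\<And>m n X. m \<le> n \<Longrightarrow> R n X \<Longrightarrow> R m X"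
    and fin: "\<And>n X Y. (\<And>i. i < b n \<Longrightarrow> X i = Y i) \<Longrightarrow> R n X \<Longrightarrow> R n Y"
  shows "\<exists>X. \<forall>n. R n X"
proof -
  let ?ext = "\<lambda>\<sigma> X. \<forall>i<length \<sigma>. X i = \<sigma> ! i"
  \<comment> \<open>The strings that are met by every \<open>R n\<close>; a path of good strings is
    then grown as in the proof of Koenig's lemma.\<close>
  define good where "good \<sigma> \<longleftrightarrow> (\<forall>n. \<exists>X. R n X \<and> ?ext \<sigma> X)" for \<sigma> :: "bool list"
  have good_D: "\<exists>X. R n X \<and> ?ext \<sigma> X" if "good \<sigma>" for \<sigma> n
    using \<open>good \<sigma>\<close> unfolding good_def by (rule spec)
  have not_good_D: "\<exists>n. \<forall>X. R n X \<longrightarrow> \<not> ?ext \<sigma> X" if "\<not> good \<sigma>" for \<sigma>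
    using \<open>\<not> good \<sigma>\<close> unfolding good_def by simp
  have step: "\<exists>b. good (\<sigma> @ [b])" if \<sigma>: "good \<sigma>" for \<sigma>
  proof (rule ccontr)
    assume no: "\<not> (\<exists>b. good (\<sigma> @ [b]))"
    then have "\<exists>n. \<forall>X. R n X \<longrightarrow> \<not> ?ext (\<sigma> @ [b]) X" for b
      by (intro not_good_D) simp
    then have "\<forall>b. \<exists>n. \<forall>X. R n X \<longrightarrow> \<not> ?ext (\<sigma> @ [b]) X" ..
    from choice[OF this] obtain n where n: "\<And>b X. R (n b) X \<Longrightarrow> \<not> ?ext (\<sigma> @ [b]) X"
      by (elim exE) (rule that, blast)
    \<comment> \<open>As \<open>R\<close> decreases, no point at this level extends either successor
      of \<open>\<sigma>\<close>, although \<open>X\<close> must extend one of them.\<close>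
    obtain X where X: "R (max (n True) (n False)) X" "?ext \<sigma> X"
      using good_D[OF \<sigma>, of "max (n True) (n False)"] by (elim exE conjE) (rule that)
    have "n (X (length \<sigma>)) \<le> max (n True) (n False)"
      by (cases "X (length \<sigma>)") simp_all
    from n[OF dec[OF this X(1)]] have "\<not> ?ext (\<sigma> @ [X (length \<sigma>)]) X" .
    moreover have "X i = (\<sigma> @ [X (length \<sigma>)]) ! i" if i: "i < length (\<sigma> @ [X (length \<sigma>)])" for i
    proof (cases "i < length \<sigma>")
      case True
      then have "X i = \<sigma> ! i" using X(2) by (elim allE impE)
      then show ?thesis using True by (simp only: nth_append if_True)
    next
      case False
      then have "i = length \<sigma>" using i by simp
      then show ?thesis by (simp only: nth_append_length)
    qed
    ultimately show False by blast
  qed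
  define next_bit where "next_bit \<sigma> = (SOME b. good (\<sigma> @ [b]))" for \<sigma>
  define seg where "seg = rec_nat [] (\<lambda>_ \<sigma>. \<sigma> @ [next_bit \<sigma>])"
  have seg_Suc: "seg (Suc n) = seg n @ [next_bit (seg n)]" for n by (simp add: seg_def)
  have len: "length (seg n) = n" for n by (induction n) (simp_all add: seg_def)
  have good: "good (seg n)" for n
  proof (induction n)
    case 0
    show ?case using ex by (simp add: seg_def good_def)
  next
    case (Suc n)
    from someI_ex[OF step[OF Suc]] show ?case by (simp add: seg_Suc next_bit_def)
  qed
  define X where "X i = seg (Suc i) ! i" for i
  have nth: "i < n \<Longrightarrow> seg n ! i = X i" for i n
  proof (induction n)
    case (Suc n)
    then show ?case by (cases "i = n") (simp_all add: X_def seg_Suc nth_append len)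
  qed simp
  have "R n X" for n
  proof -
    obtain Y where Y: "R n Y" "?ext (seg (b n)) Y"
      using good_D[OF good[of "b n"], of n] by (elim exE conjE) (rule that)
    show ?thesis by (rule fin[OF _ Y(1)]) (use Y(2) in \<open>simp add: len nth\<close>)
  qed
  then show ?thesis by blast
qed

text \<open>
  Candidates \<open>0, \<dots>, k - 1\<close> can be rejected at some stage. The \<open>j\<close>-th instance of \<open>C2\<close> asks whether
  candidate \<open>j\<close> survives (\<open>0\<close>) or some later one does (\<open>1\<close>), and enumerates whichever of the two
  is refuted first.
\<close>

definition race :: "nat \<Rightarrow> (nat \<Rightarrow> nat \<Rightarrow> bool) \<Rightarrow> nat \<Rightarrow> nat \<Rightarrow> nat" where
  "race k alive j s =
    (if alive j s \<and> (\<exists>m<k. j < m \<and> alive m s) then 2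
     else if alive j (LEAST t. s \<le> t \<or> \<not> (alive j t \<and> (\<exists>m<k. j < m \<and> alive m t))) then 1 else 0)"

lemma C2_instance_step:
  assumes "c < 2"
  shows "C2_instance (\<lambda>s. if s < t then 2 else c)"
proof -
  let ?v = "\<lambda>s. if s < t then 2 else c"
  have c: "c \<noteq> 2" "c = 0 \<or> c = 1" using assms by linarith+
  have ran: "range ?v \<subseteq> {2, c}" by (rule image_subsetI) simp
  have 0: "{2, c} \<subseteq> {0, 1, 2}" "\<not> {0, 1} \<subseteq> {2, c}" using c(2) by auto
  have 1: "range ?v \<subseteq> {0, 1, 2}" "\<not> {0, 1} \<subseteq> range ?v"
    by (rule subset_trans[OF ran 0(1)], rule contrapos_nn[OF 0(2)], erule subset_trans[OF _ ran])
  have 2: "?v r \<noteq> 2" if "s < r" "?v s \<noteq> ?v r" for s r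
    using that c(1) by (cases "r < t") simp_all
  have 3: "?v s = ?v u \<and> ?v u = ?v r" if "s < u" "u < r" "?v s = ?v r" for s r u
    using that c(1) by (cases "s < t"; cases "r < t") simp_all
  show ?thesis
    unfolding C2_instance_def
  proof (intro conjI allI impI)
    fix s r :: nat assume "s < r \<and> ?v s \<noteq> ?v r"
    then show "?v r \<noteq> 2" by (elim conjE) (rule 2)
  next
    fix s r u :: nat assume *: "s < u \<and> u < r \<and> ?v s = ?v r"
    then have "?v s = ?v u \<and> ?v u = ?v r" by (elim conjE) (rule 3)
    then show "?v s = ?v u" "?v u = ?v r" by (rule conjunct1, rule conjunct2)
  qed (fact 1)+
qed

context
  fixes alive :: "nat \<Rightarrow> nat \<Rightarrow> bool" and k :: nat
  assumes alive_mono: "\<And>m s t. s \<le> t \<Longrightarrow> alive m t \<Longrightarrow> alive m s"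
begin

lemma race_cases:
  obtains "\<And>s. race k alive j s = 2" "\<And>s. alive j s" "\<And>s. \<exists>m<k. j < m \<and> alive m s"
  | t where "\<And>s. race k alive j s = (if s < t then 2 else 0)" "\<not> alive j t"
  | t where "\<And>s. race k alive j s = (if s < t then 2 else 1)" "\<not> (\<exists>m<k. j < m \<and> alive m t)" "alive j t"
proof -
  define P where "P s \<longleftrightarrow> alive j s \<and> (\<exists>m<k. j < m \<and> alive m s)" for s
  have race_P: "race k alive j s =
      (if P s then 2 else if alive j (LEAST t. s \<le> t \<or> \<not> P t) then 1 else 0)" for s
    unfolding race_def P_def ..
  have P_mono: "P s" if "P t" "s \<le> t" for s t
    using \<open>P t\<close> alive_mono[OF \<open>s \<le> t\<close>] unfolding P_def by (elim conjE exE) (intro conjI exI)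
  show ?thesis
  proof (cases "\<forall>s. P s")
    case True
    then have "alive j s" "\<exists>m<k. j < m \<and> alive m s" for s
      unfolding P_def by simp_all
    with True show ?thesis by (intro that(1)) (simp_all add: race_P)
  next
    case False
    then have ex: "\<exists>t. \<not> P t" by simp
    define t where "t = (LEAST t. \<not> P t)"
    have t: "\<not> P t" unfolding t_def using ex by (rule LeastI_ex)
    have P_iff: "P s \<longleftrightarrow> s < t" for s
    proof
      assume "P s"
      show "s < t"
      proof (rule ccontr)
        assume "\<not> s < t"
        then have "t \<le> s" by simp
        from P_mono[OF \<open>P s\<close> this] t show False by contradiction
      qed
    next
      assume "s < t"
      then show "P s" using not_less_Least[of s "\<lambda>t. \<not> P t"] unfolding t_def by simp
    qed
    \<comment> \<open>The cap \<open>s\<close> in \<open>race\<close> guarantees that the search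
      halts; from the first failure \<open>t\<close> on, the search always returns \<open>t\<close>,
      so the enumerated value never changes.\<close>
    have "(LEAST u. s \<le> u \<or> \<not> u < t) = t" if "t \<le> s" for s
      using \<open>t \<le> s\<close> by (intro Least_equality) auto
    then have race: "race k alive j s = (if s < t then 2 else if alive j t then 1 else 0)" for s
      unfolding race_P P_iff by simp
    show ?thesis
    proof (cases "alive j t")
      case True
      then show ?thesis using race t by (intro that(3)[of t]) (simp_all add: P_def)
    next
      case False
      then show ?thesis using race by (intro that(2)[of t]) simp_all
    qed
  qed
qed

lemma C2_instance_race: "C2_instance (race k alive j)"
proof (cases rule: race_cases[of j])
  case 1
  then have "race k alive j = (\<lambda>s. 2)" by (intro ext)
  then show ?thesis by (simp add: C2_instance_def)
next
  case (2 t)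
  from 2(1) have "race k alive j = (\<lambda>s. if s < t then 2 else 0)" by (intro ext)
  then show ?thesis by (simp only: C2_instance_step zero_less_numeral)
next
  case (3 t)
  from 3(1) have "race k alive j = (\<lambda>s. if s < t then 2 else 1)" by (intro ext)
  then show ?thesis by (simp only: C2_instance_step one_less_numeral_iff semiring_norm)
qed

text \<open>If 1 was enumerated, then no candidate after \<open>j\<close> was alive at that stage,
  so the assumed survivor can only be \<open>j\<close> itself.\<close>

lemma race_0:
  assumes "0 \<notin> range (race k alive j)" "m < k" "j \<le> m" "\<And>s. alive m s"
  shows "alive j s"
proof (cases rule: race_cases[of j])
  case 1
  then show ?thesis by blast
next
  case (2 t)
  have "race k alive j t = 0" using 2(1) by simp
  then have "0 \<in> range (race k alive j)" by (rule range_eqI[OF sym])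
  then show ?thesis using assms(1) by contradiction
next
  case (3 t)
  then have "\<not> j < m" using assms(2,4) by blast
  then show ?thesis using assms(3,4) by simp
qed

text \<open>If every later candidate died, the survivor would be \<open>j\<close>, the race would
  end against the later ones, and 1 would be enumerated.\<close>

lemma race_1:
  assumes "1 \<notin> range (race k alive j)" "m < k" "j \<le> m" "\<And>s. alive m s"
  shows "\<exists>m<k. j < m \<and> (\<forall>s. alive m s)"
proof (rule ccontr)
  assume none: "\<not> (\<exists>m<k. j < m \<and> (\<forall>s. alive m s))"
  then have "\<not> j < m" using assms(2,4) by blast
  then have "m = j" using assms(3) by simp
  have "\<forall>m. \<exists>s. m < k \<longrightarrow> j < m \<longrightarrow> \<not> alive m s" using none by blast
  then obtain d where d: "\<And>m. m < k \<Longrightarrow> j < m \<Longrightarrow> \<not> alive m (d m)" by metis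
  \<comment> \<open>Only finitely many candidates lie below \<open>k\<close>, so there is a stage by
    which all later ones are dead.\<close>
  have "\<not> alive m (Max (d ` {..<k}))" if "m < k" "j < m" for m
    using d[OF that] alive_mono[of "d m" "Max (d ` {..<k})" m] that by auto
  then have no: "\<not> (\<exists>m<k. j < m \<and> alive m (Max (d ` {..<k})))" by blast
  show False
  proof (cases rule: race_cases[of j])
    case 1
    then show ?thesis using no by blast
  next
    case (2 t)
    then show ?thesis using assms(4) \<open>m = j\<close> by blast
  next
    case (3 t)
    have "race k alive j t = 1" using 3(1) by simp
    then have "1 \<in> range (race k alive j)" by (rule range_eqI[OF sym])
    then show ?thesis using assms(1) by contradiction
  qed
qed

text \<open>As long as all answers below \<open>j\<close> are 1, some candidate from
  \<open>j\<close> on survives forever. This cannot continue up to \<open>k\<close>, so an answer 0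
  occurs, and by \<open>race_0\<close> the first one names a survivor.\<close>

lemma race_winner:
  assumes "m < k" "\<And>s. alive m s"
    and i: "\<And>j. j < k \<Longrightarrow> i j < 2 \<and> i j \<notin> range (race k alive j)"
  shows "alive (LEAST j. i j = 0) s"
proof -
  have inv: "j \<le> k \<Longrightarrow> (\<And>j'. j' < j \<Longrightarrow> i j' \<noteq> 0) \<Longrightarrow> \<exists>m<k. j \<le> m \<and> (\<forall>s. alive m s)" for j
  proof (induction j)
    case 0
    show ?case using assms(1,2) by blast
  next
    case (Suc j)
    have "\<exists>m<k. j \<le> m \<and> (\<forall>s. alive m s)"
      by (rule Suc.IH) (use Suc.prems in simp_all)
    then obtain m' where m': "m' < k" "j \<le> m'" "\<And>s. alive m' s" by blast
    have "i j < 2 \<and> i j \<noteq> 0" using i[of j] Suc.prems by simp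
    then have "i j = 1" by linarith
    then have "1 \<notin> range (race k alive j)" using i[of j] Suc.prems(1) by simp
    from race_1[OF this m'] show ?case by (simp add: Suc_le_eq)
  qed
  have "\<exists>j<k. i j = 0"
  proof (rule ccontr)
    assume "\<not> (\<exists>j<k. i j = 0)"
    then have "\<exists>m<k. k \<le> m \<and> (\<forall>s. alive m s)" by (intro inv) simp_all
    then show False by auto
  qed
  then obtain j where j: "j < k" "i j = 0" by blast
  have L: "i (LEAST j. i j = 0) = 0" using j(2) by (rule LeastI)
  have Lk: "(LEAST j. i j = 0) < k"
    using Least_le[of "\<lambda>j. i j = 0", OF j(2)] j(1) by (rule le_less_trans)
  have "\<exists>m<k. (LEAST j. i j = 0) \<le> m \<and> (\<forall>s. alive m s)"
    by (rule inv, rule less_imp_le[OF Lk], erule not_less_Least)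
  then obtain m' where m': "m' < k" "(LEAST j. i j = 0) \<le> m'" "\<And>s. alive m' s" by blast
  have "0 \<notin> range (race k alive (LEAST j. i j = 0))"
    using i[OF Lk] unfolding L by (rule conjunct2)
  from race_0[OF this m'] show "alive (LEAST j. i j = 0) s" .
qed

end

section \<open>Finite strings and paths through trees\<close>

text \<open>Together with a length \<open>n\<close>, a number below \<open>2 ^ n\<close> stands for
  a string through its binary digits, so quantifying over strings of a given length is bounded
  quantification.\<close>

abbreviation bits :: "nat \<Rightarrow> nat \<Rightarrow> bool" where
  "bits c \<equiv> \<lambda>i. i \<in> set_decode c"

definition string_code :: "nat \<Rightarrow> (nat \<Rightarrow> bool) \<Rightarrow> nat" where
  "string_code n X = list_encode (map (\<lambda>i. of_bool (X i)) [0..<n])"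

lemma string_code_cong: "(\<And>i. i < n \<Longrightarrow> X i = Y i) \<Longrightarrow> string_code n X = string_code n Y"
  unfolding string_code_def by (intro arg_cong[of _ _ list_encode] map_cong) simp_all

text \<open>Bounds the length of a string by its code, which makes recovering the length a bounded
  search.\<close>

lemma string_code_ge: "n \<le> string_code n X"
proof -
  have "length xs \<le> list_encode xs" for xs
  proof (induction xs)
    case (Cons x xs)
    then show ?case using le_prod_encode_2[of "list_encode xs" x] by simp
  qed simp
  from this[of "map (\<lambda>i. of_bool (X i)) [0..<n]"] show ?thesis by (simp add: string_code_def)
qed

lemma string_code_mem_iff:
  "string_code n X \<in> (\<lambda>\<sigma>. list_encode (map of_bool \<sigma>)) ` T \<longleftrightarrow> map X [0..<n] \<in> T"
proof -
  have "inj (\<lambda>\<sigma>. list_encode (map of_bool \<sigma>))"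
  proof (rule injI)
    fix \<sigma> \<tau> :: "bool list"
    assume "list_encode (map of_bool \<sigma>) = list_encode (map of_bool \<tau>)"
    then have "map (of_bool :: bool \<Rightarrow> nat) \<sigma> = map of_bool \<tau>" by (simp add: list_encode_eq)
    moreover have "inj (of_bool :: bool \<Rightarrow> nat)" by (rule injI) (simp only: of_bool_eq_iff)
    ultimately show "\<sigma> = \<tau>" by (simp add: inj_map_eq_map)
  qed
  from inj_image_mem_iff[OF this, of "map X [0..<n]" T] show ?thesis
    by (simp add: string_code_def comp_def)
qed

lemma tree_code_string: "tree_code T (string_code n X) = 1 \<longleftrightarrow> map X [0..<n] \<in> T"
  using string_code_mem_iff[of n X T] by (simp add: tree_code_def char_fun_def)

lemma tree_code_eq_iff [simp]: "tree_code T = tree_code U \<longleftrightarrow> T = U"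
proof
  assume eq: "tree_code T = tree_code U"
  have "\<sigma> \<in> T \<longleftrightarrow> \<sigma> \<in> U" for \<sigma>
  proof -
    have "map (\<lambda>i. \<sigma> ! i) [0..<length \<sigma>] = \<sigma>" by (rule map_nth)
    then show ?thesis
      using tree_code_string[of T "length \<sigma>" "\<lambda>i. \<sigma> ! i"] tree_code_string[of U "length \<sigma>" "\<lambda>i. \<sigma> ! i"]
      by (simp add: eq)
  qed
  then show "T = U" by (rule set_eqI)
qed simp

lemma computable_on_string_code [comp]:
  assumes "computable_on S A" "computable_on S C"
  shows "computable_on S (\<lambda>f x. string_code (A f x) (bits (C f x)))"
proof -
  \<comment> \<open>The list is built from its end: after \<open>j\<close> steps the value codes the
    last \<open>j\<close> bits, and \<open>Suc\<close> of a pair is the code of a nonempty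
    list.\<close>
  let ?r = "\<lambda>n c. rec_nat 0 (\<lambda>j r. Suc (prod_encode (of_bool (bits c (n - Suc j)), r)))"
  have "j \<le> n \<Longrightarrow> ?r n c j = list_encode (map (\<lambda>i. of_bool (bits c i)) [n - j..<n])" for n c j
  proof (induction j)
    case (Suc j)
    then have "[n - Suc j..<n] = (n - Suc j) # [n - j..<n]"
      using upt_conv_Cons[of "n - Suc j" n] by (simp add: Suc_diff_Suc)
    then show ?case using Suc by simp
  qed simp
  from this[of n n for n] have eq: "?r n c n = string_code n (bits c)" for n c
    by (simp add: string_code_def)
  have "computable_on S (\<lambda>f z. ?r (pfst z) (psnd z) (pfst z))"
    by (intro comp)
  then have "computable_on S (\<lambda>f z. string_code (pfst z) (bits (psnd z)))"
    unfolding eq .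
  from computable_on_apply2[OF this assms] show ?thesis .
qed

lemma set_encode_less:
  assumes "A \<subseteq> {..<n}"
  shows "set_encode A < 2 ^ n"
proof -
  have "sum ((^) 2) {..<n} + 1 = (2 :: nat) ^ n" by (induction n) simp_all
  moreover have "sum ((^) 2) A \<le> sum ((^) (2 :: nat)) {..<n}"
    by (rule sum_mono2[OF finite_lessThan assms]) simp
  ultimately show ?thesis unfolding set_encode_def by linarith
qed

lemma ex_bits: "\<exists>c<2 ^ n. \<forall>i<n. bits c i = X i"
proof (intro exI conjI)
  show "set_encode {i. i < n \<and> X i} < 2 ^ n" by (rule set_encode_less) auto
qed simp

lemma paths_prefix:
  assumes "is_tree T" "map X [0..<n] \<in> T" "m \<le> n"
  shows "map X [0..<m] \<in> T"
proof -
  have "map X [0..<n] = map X [0..<m] @ map X [m..<n]"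
    using upt_add_eq_append[of 0 m "n - m"] \<open>m \<le> n\<close> by simp
  then have "prefix (map X [0..<m]) (map X [0..<n])" by (simp only: prefix_def) blast
  with assms(1,2) show ?thesis unfolding is_tree_def by simp
qed

lemma char_fun_Collect: "char_fun {n. X n} = (\<lambda>n. of_bool (X n))"
  by (simp add: char_fun_def fun_eq_iff)

lemma WKL_eq:
  assumes "is_tree T" "infinite T"
  shows "WKL (tree_code T) = {char_fun {n. X n} |X. X \<in> paths T}"
  using assms unfolding WKL_def by simp

section \<open>Evaluation on paths reduces to finitely many choices\<close>

lemma C2_star_iff:
  "g \<in> finite_parallelization C2 (tjoin [num k, tjoin fs]) \<longleftrightarrow>
    1 \<le> k \<and> length fs = k \<and> (\<exists>is. g = tjoin (map num is) \<and> length is = k \<and>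
      (\<forall>j<k. C2_instance (fs ! j) \<and> is ! j < 2 \<and> is ! j \<notin> range (fs ! j)))"
    (is "_ \<longleftrightarrow> ?rhs")
proof
  assume "g \<in> finite_parallelization C2 (tjoin [num k, tjoin fs])"
  then obtain gs k' fs' where 1: "g = tjoin gs" "tjoin [num k, tjoin fs] = tjoin [num k', tjoin fs']"
    "1 \<le> k'" "length fs' = k'" "length gs = k'" "\<forall>j<k'. gs ! j \<in> C2 (fs' ! j)"
    unfolding finite_parallelization_def mem_Collect_eq by (elim exE conjE) (rule that)
  from 1(2) have 2: "k' = k" "fs' = fs" by simp_all
  let ?is = "map (\<lambda>h. h 0) gs"
  have 3: "C2_instance (fs ! j) \<and> gs ! j = num (?is ! j) \<and> ?is ! j < 2 \<and> ?is ! j \<notin> range (fs ! j)"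
    if j: "j < k" for j
  proof -
    have "gs ! j \<in> C2 (fs ! j)" using 1(6) j unfolding 2 by simp
    then have inst: "C2_instance (fs ! j)" and "gs ! j \<in> {num i |i. i < 2 \<and> i \<notin> range (fs ! j)}"
      unfolding C2_def by (simp_all split: if_split_asm)
    then obtain i where i: "gs ! j = num i" "i < 2" "i \<notin> range (fs ! j)"
      unfolding mem_Collect_eq by (elim exE conjE) (rule that)
    have "?is ! j = i" using j 1(5) i(1) by (simp add: 2)
    then show ?thesis using inst i by simp
  qed
  have gs: "gs = map num ?is"
  proof (rule nth_equalityI)
    fix j assume j: "j < length gs"
    then have "gs ! j = num (?is ! j)" using 3[of j] 1(5) unfolding 2 by (simp only: simp_thms)
    also have "\<dots> = map num ?is ! j" by (rule nth_map[symmetric]) (simp add: j)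
    finally show "gs ! j = map num ?is ! j" .
  qed simp
  show ?rhs
  proof (intro conjI exI[of _ ?is] allI impI)
    show "1 \<le> k" "length fs = k" using 1(3,4) unfolding 2 .
    show "g = tjoin (map num ?is)" using 1(1) gs by (simp only: gs[symmetric])
    show "length ?is = k" using 1(5) unfolding 2 by simp
    fix j assume "j < k"
    note c = 3[OF this]
    show "C2_instance (fs ! j)" by (rule c[THEN conjunct1])
    show "?is ! j < 2" by (rule c[THEN conjunct2, THEN conjunct2, THEN conjunct1])
    show "?is ! j \<notin> range (fs ! j)" by (rule c[THEN conjunct2, THEN conjunct2, THEN conjunct2])
  qed
next
  assume rhs: ?rhs
  then obtain "is" where "is": "g = tjoin (map num is)" "length is = k"
    "\<forall>j<k. C2_instance (fs ! j) \<and> is ! j < 2 \<and> is ! j \<notin> range (fs ! j)"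
    by (elim exE conjE) (rule that)
  have "map num is ! j \<in> C2 (fs ! j)" if "j < k" for j
    using that "is"(2,3) by (simp add: C2_def)
  with rhs "is"(1,2) show "g \<in> finite_parallelization C2 (tjoin [num k, tjoin fs])"
    unfolding finite_parallelization_def mem_Collect_eq
    by (intro exI[of _ "map num is"] exI[of _ k] exI[of _ fs]) simp
qed

lemma C2_instance_solution:
  assumes "C2_instance v"
  shows "\<exists>i<2. i \<notin> range v"
proof -
  have no: "\<not> {0, 1} \<subseteq> range v"
    using assms unfolding C2_instance_def by (elim conjE)
  show ?thesis
  proof (cases "0 \<in> range v")
    case True
    have "1 \<notin> range v"
    proof
      assume "1 \<in> range v"
      with True have "{0, 1} \<subseteq> range v" by (intro insert_subsetI empty_subsetI)
      with no show False by contradiction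
    qed
    moreover have "(1 :: nat) < 2" by simp
    ultimately show ?thesis by (intro exI conjI)
  next
    case False
    then show ?thesis by (intro exI[of _ 0] conjI) (rule zero_less_numeral)
  qed
qed

text \<open>Unlike in \<open>computable_on_tjoin\<close>, the number of components may depend on the
  oracle.\<close>

lemma computable_on_tjoin_list:
  assumes "computable_on S (\<lambda>f x. K f)" "computable_on S (\<lambda>f z. V f (pfst z) (psnd z))"
  shows "computable_on S (\<lambda>f. tjoin (map (V f) [0..<K f]))"
proof -
  have "computable_on S (\<lambda>f x. V f (pfst (x - 1)) (psnd (x - 1)))"
    by (rule computable_on_apply2[OF assms(2)]) (intro comp)+
  then have "computable_on S (\<lambda>f x. if x = 0 then K f
      else if pfst (x - 1) < K f then V f (pfst (x - 1)) (psnd (x - 1)) else 0)"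
    by (intro computable_on_if decidable_on_eq decidable_on_less computable_on_pfst
        computable_on_diff computable_on_id computable_on_const assms(1))
  then show ?thesis
  proof (rule computable_on_cong)
    fix f x
    show "(if x = 0 then K f else if pfst (x - 1) < K f then V f (pfst (x - 1)) (psnd (x - 1)) else 0) =
        tjoin (map (V f) [0..<K f]) x"
      by (cases x) (simp_all add: tjoin_def Let_def split: prod.split)
  qed
qed

lemma computable_on_race:
  assumes "decidable_on S (\<lambda>f z. alive f (pfst z) (psnd z))" "computable_on S (\<lambda>f x. K f)"
  shows "computable_on S (\<lambda>f z. race (K f) (alive f) (pfst z) (psnd z))"
proof -
  let ?P = "\<lambda>f j s. alive f j s \<and> (\<exists>m<K f. j < m \<and> alive f m s)"
  have alive: "decidable_on S (\<lambda>f z. alive f (A z) (B z))"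
    if "computable_on S (\<lambda>f z. A z)" "computable_on S (\<lambda>f z. B z)" for A B
    by (rule decidable_on_apply2[OF assms(1) that])
  have P: "decidable_on S (\<lambda>f z. ?P f (pfst z) (psnd z))"
    by (intro decidable_on_conj decidable_on_bex_less decidable_on_less alive computable_on_pfst
        computable_on_psnd computable_on_id assms(2))
  have P': "decidable_on S (\<lambda>f z. ?P f (pfst (pfst z)) (psnd z))"
    using decidable_on_apply2[OF P, of "\<lambda>f z. pfst (pfst z)" "\<lambda>f z. psnd z"]
    by (simp only: computable_on_pfst computable_on_psnd computable_on_id)
  have "computable_on S (\<lambda>f z. LEAST t. psnd z \<le> t \<or> \<not> ?P f (pfst z) t)" (is "computable_on S ?L")
    by (rule computable_on_Least)
      (intro decidable_on_disj decidable_on_not P' decidable_on_le computable_on_pfst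
        computable_on_psnd computable_on_id, rule exI, rule disjI1, rule order_refl)
  then have "decidable_on S (\<lambda>f z. alive f (pfst z) (?L f z))"
    by (intro decidable_on_apply2[OF assms(1)] computable_on_pfst computable_on_id)
  then show ?thesis
    unfolding race_def by (intro computable_on_if P computable_on_const)
qed

text \<open>
  For an instance \<open>p = \<langle>f, e, h\<rangle>\<close> of \<open>evaluation WKL\<close>: \<open>D\<close> certifies that the program \<open>e\<close> with
  oracle \<open>\<langle>f, X\<rangle>\<close> returns \<open>m\<close> at \<open>0\<close>.
\<close>

definition certifies :: "baire \<Rightarrow> (nat \<Rightarrow> bool) \<Rightarrow> nat \<Rightarrow> nat \<Rightarrow> bool" where
  "certifies p X D m \<longleftrightarrow>
    certificate (\<lambda>a b. tjoin [component p 0, \<lambda>n. of_bool (X n)] a = b) D \<and>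
    triple (component p 1 0) 0 m \<in> set_decode D"

text \<open>A certificate \<open>D \<le> l\<close> queries only positions below \<open>l\<close>, so
  it depends on the first \<open>l\<close> bits alone and the zeros following them in
  \<open>bits c\<close> are harmless. The bounds on \<open>D\<close> and \<open>m\<close> keep the
  condition decidable.\<close>

definition decided_at :: "baire \<Rightarrow> nat \<Rightarrow> bool" where
  "decided_at p l \<longleftrightarrow> (\<forall>c<2 ^ l. component p 2 (string_code l (bits c)) = 1 \<longrightarrow>
    (\<exists>D\<le>l. \<exists>m\<le>l. certifies p (bits c) D m))"

text \<open>The certificate stays bounded by \<open>l\<close> while the string grows. Candidate
  \<open>m\<close> is thus refuted once the tree has died out above all strings of level
  \<open>l\<close> for which such a certificate returns \<open>m\<close>.\<close>

definition survives :: "baire \<Rightarrow> nat \<Rightarrow> nat \<Rightarrow> nat \<Rightarrow> bool" where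
  "survives p l m s \<longleftrightarrow> (\<exists>c<2 ^ (l + s). component p 2 (string_code (l + s) (bits c)) = 1 \<and>
    (\<exists>D\<le>l. certifies p (bits c) D m))"

text \<open>The use principle for paths: bit \<open>n\<close> sits in the join at a position greater
  than \<open>n\<close>, and queries lie below \<open>D\<close>.\<close>

lemma certifies_cong:
  assumes "certifies p X D m" "\<And>i. i < D \<Longrightarrow> X i = Y i"
  shows "certifies p Y D m"
proof -
  have "certificate (\<lambda>a b. tjoin [component p 0, \<lambda>n. of_bool (Y n)] a = b) D"
  proof (rule certificate_mono)
    show "certificate (\<lambda>a b. tjoin [component p 0, \<lambda>n. of_bool (X n)] a = b) D"
      using assms(1) unfolding certifies_def by (rule conjunct1)
    fix a b
    assume "triple 4 a b \<in> set_decode D" and eq: "tjoin [component p 0, \<lambda>n. of_bool (X n)] a = b"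
    then have a: "a < D" by (intro triple_less(2))
    have "tjoin [component p 0, \<lambda>n. of_bool (X n)] a = tjoin [component p 0, \<lambda>n. of_bool (Y n)] a"
    proof (cases a)
      case 0
      then show ?thesis by simp
    next
      case (Suc z)
      obtain i n where z: "z = prod_encode (i, n)"
        by (metis prod.collapse prod_decode_inverse)
      have "n < D" using a le_prod_encode_2[of n i] unfolding Suc z by simp
      then have "X n = Y n" by (rule assms(2))
      then show ?thesis unfolding Suc z tjoin_Suc by (cases "i = 0"; cases "i = 1") simp_all
    qed
    with eq show "tjoin [component p 0, \<lambda>n. of_bool (Y n)] a = b" by (simp only:)
  qed
  then show ?thesis
    using assms(1)[unfolded certifies_def, THEN conjunct2] unfolding certifies_def by (rule conjI)
qed

lemma decidable_on_certifies:
  assumes "computable_on S (\<lambda>f x. C x)" "computable_on S (\<lambda>f x. D x)" "computable_on S (\<lambda>f x. M x)"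
  shows "decidable_on S (\<lambda>p x. certifies p (bits (C x)) (D x) (M x))"
proof -
  have "decidable_on S (\<lambda>p z. certifies p (bits (pfst z)) (pfst (psnd z)) (psnd (psnd z)))"
    unfolding certifies_def by (intro comp)
  from decidable_on_apply3[OF this assms] show ?thesis .
qed

lemma decidable_on_decided_at: "decidable_on S (\<lambda>p l. decided_at p l)"
  unfolding decided_at_def by (intro comp decidable_on_certifies)

lemma decidable_on_survives:
  assumes "computable_on S (\<lambda>p x. L p)"
  shows "decidable_on S (\<lambda>p z. survives p (L p) (pfst z) (psnd z))"
proof -
  have "decidable_on S (\<lambda>p z. survives p (pfst z) (pfst (psnd z)) (psnd (psnd z)))"
    unfolding survives_def by (intro comp decidable_on_certifies)
  from decidable_on_apply3[OF this assms computable_on_pfst[OF computable_on_id]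
      computable_on_psnd[OF computable_on_id]]
  show ?thesis .
qed

lemma phi_iff_certifies:
  "\<phi> e (tjoin [f, char_fun {n. X n}]) 0 = Some m \<longleftrightarrow> (\<exists>D. certifies (tjoin [f, num e, h]) X D m)"
proof -
  have "component (tjoin [f, num e, h]) 0 = f" "component (tjoin [f, num e, h]) 1 0 = e" by simp_all
  then show ?thesis unfolding phi_eq_Some_iff certifies_def char_fun_Collect by (simp only:)
qed

section \<open>Correctness of the candidates for a single tree\<close>

context
  fixes f p :: baire and e :: nat and T :: "bool list set"
  assumes p: "p = tjoin [f, num e, tree_code T]" and T: "is_tree T"
    and total: "\<forall>X\<in>paths T. \<exists>D m. certifies p X D m"
begin

lemma component_tree: "component p 2 (string_code n X) = 1 \<longleftrightarrow> map X [0..<n] \<in> T"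
proof -
  have "component p 2 (string_code n X) = tree_code T (string_code n X)" by (simp add: p)
  then show ?thesis by (simp only: tree_code_string)
qed

lemma map_upt_cong: "(\<And>i. i < n \<Longrightarrow> X i = Y i) \<Longrightarrow> map X [0..<n] = map Y [0..<n]"
  by (rule map_cong) simp_all

text \<open>If no level were decided, the strings without a small certificate would exist at all
  levels, and compactness would give a path without any certificate, against totality.\<close>

lemma ex_decided_at: "\<exists>l. decided_at p l"
proof (rule ccontr)
  assume none: "\<not> (\<exists>l. decided_at p l)"
  let ?R = "\<lambda>n X. map X [0..<n] \<in> T \<and> \<not> (\<exists>D\<le>n. \<exists>m\<le>n. certifies p X D m)"
  have "\<exists>X. \<forall>n. ?R n X"
  proof (rule compactness)
    fix n
    have "\<not> decided_at p n" using none by simp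
    then obtain c where "component p 2 (string_code n (bits c)) = 1"
      "\<not> (\<exists>D\<le>n. \<exists>m\<le>n. certifies p (bits c) D m)"
      unfolding decided_at_def not_all not_imp by (elim exE conjE) (rule that)
    then show "\<exists>X. ?R n X" unfolding component_tree by (intro exI conjI)
  next
    fix m n X assume mn: "m \<le> n" and R: "?R n X"
    have "\<exists>D\<le>n. \<exists>m\<le>n. certifies p X D m" if "\<exists>D\<le>m. \<exists>m'\<le>m. certifies p X D m'"
    proof -
      from \<open>\<exists>D\<le>m. \<exists>m'\<le>m. certifies p X D m'\<close> obtain D m' where "D \<le> m" "m' \<le> m" "certifies p X D m'"
        by (elim exE conjE) (rule that)
      then show ?thesis using mn by (intro exI[of _ D] exI[of _ m'] conjI) simp_all
    qed
    with R paths_prefix[OF T _ mn, of X] show "?R m X" by (elim conjE) (intro conjI notI, simp, simp)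
  next
    fix n X Y assume XY: "\<And>i. i < n \<Longrightarrow> X i = Y i" and R: "?R n X"
    have imp: "\<exists>D\<le>n. \<exists>m\<le>n. certifies p X D m" if "\<exists>D\<le>n. \<exists>m\<le>n. certifies p Y D m"
    proof -
      from \<open>\<exists>D\<le>n. \<exists>m\<le>n. certifies p Y D m\<close> obtain D m where 1: "D \<le> n" "m \<le> n" "certifies p Y D m"
        by (elim exE conjE) (rule that)
      have "certifies p X D m" by (rule certifies_cong[OF 1(3)]) (use XY 1(1) in simp)
      with 1(1,2) show ?thesis by (intro exI[of _ D] exI[of _ m] conjI)
    qed
    have "map X [0..<n] = map Y [0..<n]" by (rule map_upt_cong) (rule XY)
    with R[THEN conjunct1] have "map Y [0..<n] \<in> T" by (simp only:)
    moreover have "\<not> (\<exists>D\<le>n. \<exists>m\<le>n. certifies p Y D m)"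
      using R[THEN conjunct2] by (rule contrapos_nn) (rule imp)
    ultimately show "?R n Y" by (rule conjI)
  qed
  then obtain X where X: "\<And>n. ?R n X" by (elim exE) (rule that, erule spec)
  have "X \<in> paths T" unfolding paths_def mem_Collect_eq by (rule allI, rule X[THEN conjunct1])
  from bspec[OF total this] obtain D m where Dm: "certifies p X D m" by (elim exE) (rule that)
  \<comment> \<open>The certified value is below the certificate, so level \<open>D\<close> bounds
    both.\<close>
  then have "m < D" unfolding certifies_def by (elim conjE) (rule triple_less(3))
  with Dm have "\<exists>D'\<le>D. \<exists>m\<le>D. certifies p X D' m"
    by (intro exI[of _ D] exI[of _ m] conjI) simp_all
  with X[of D] show False by (elim conjE) (rule notE)
qed

lemma survivesI:
  assumes "map X [0..<l + s] \<in> T" "D \<le> l" "certifies p X D m"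
  shows "survives p l m s"
proof -
  obtain c where c: "c < 2 ^ (l + s)" "\<And>i. i < l + s \<Longrightarrow> bits c i = X i"
    using ex_bits[of "l + s" X] by (elim exE conjE) (rule that, assumption, elim allE impE)
  have "map (bits c) [0..<l + s] \<in> T"
    using assms(1) map_upt_cong[of "l + s" "bits c" X, OF c(2)] by (simp only:)
  moreover have "certifies p (bits c) D m"
    by (rule certifies_cong[OF assms(3)]) (use c(2) assms(2) in simp)
  ultimately show ?thesis
    unfolding survives_def component_tree using c(1) assms(2) by (intro exI[of _ c] exI[of _ D] conjI)
qed

lemma survivesD:
  assumes "survives p l m s"
  shows "\<exists>X. map X [0..<l + s] \<in> T \<and> (\<exists>D\<le>l. certifies p X D m)"
  using assms unfolding survives_def component_tree by (elim exE conjE) (intro exI conjI)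

lemma survives_antimono:
  assumes "s \<le> t" "survives p l m t"
  shows "survives p l m s"
proof -
  obtain X D where X: "map X [0..<l + t] \<in> T" "D \<le> l" "certifies p X D m"
    using survivesD[OF assms(2)] by (elim exE conjE) (rule that)
  have "map X [0..<l + s] \<in> T" by (rule paths_prefix[OF T X(1)]) (use assms(1) in simp)
  then show ?thesis using X(2,3) by (rule survivesI)
qed

text \<open>The value that the decided level assigns to the initial segment of a path is kept alive
  by that path.\<close>

lemma ex_survivor:
  assumes "decided_at p l" "X \<in> paths T"
  shows "\<exists>m\<le>l. \<forall>s. survives p l m s"
proof -
  have X: "map X [0..<n] \<in> T" for n
    using assms(2) unfolding paths_def mem_Collect_eq by (rule spec)
  obtain c where c: "c < 2 ^ l" "\<And>i. i < l \<Longrightarrow> bits c i = X i"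
    using ex_bits[of l X] by (elim exE conjE) (rule that, assumption, elim allE impE)
  have "map (bits c) [0..<l] \<in> T"
    using X[of l] map_upt_cong[of l "bits c" X, OF c(2)] by (simp only:)
  then have "\<exists>D\<le>l. \<exists>m\<le>l. certifies p (bits c) D m"
    using assms(1) c(1) unfolding decided_at_def component_tree by simp
  then obtain D m where Dm: "D \<le> l" "m \<le> l" "certifies p (bits c) D m"
    by (elim exE conjE) (rule that)
  have "certifies p X D m"
    by (rule certifies_cong[OF Dm(3)]) (use c(2) Dm(1) in simp)
  then have "survives p l m s" for s
    by (rule survivesI[OF X Dm(1)])
  with Dm(2) show ?thesis by (intro exI[of _ m] conjI allI)
qed

text \<open>Being alive at all stages is turned into an actual path by compactness, applied to
  strings with a certificate bounded by the fixed level \<open>l\<close>; its value is therefore a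
  genuine solution.\<close>

lemma survivor_path:
  assumes "\<And>s. survives p l m s"
  shows "\<exists>X\<in>paths T. \<exists>D. certifies p X D m"
proof -
  let ?R = "\<lambda>n X. map X [0..<l + n] \<in> T \<and> (\<exists>D\<le>l. certifies p X D m)"
  have "\<exists>X. \<forall>n. ?R n X"
  proof (rule compactness)
    show "\<exists>X. ?R n X" for n by (rule survivesD[OF assms])
    fix n' n X assume mn: "n' \<le> n" and R: "?R n X"
    have "map X [0..<l + n'] \<in> T"
      by (rule paths_prefix[OF T R[THEN conjunct1]]) (use mn in simp)
    then show "?R n' X" using R[THEN conjunct2] by (rule conjI)
  next
    fix n X Y assume XY: "\<And>i. i < l + n \<Longrightarrow> X i = Y i" and R: "?R n X"
    from R obtain D where D: "D \<le> l" "certifies p X D m" by (elim exE conjE) (rule that)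
    have "certifies p Y D m" by (rule certifies_cong[OF D(2)]) (use XY D(1) in simp)
    moreover have "map Y [0..<l + n] \<in> T"
    proof -
      have "map X [0..<l + n] = map Y [0..<l + n]" by (rule map_upt_cong) (rule XY)
      with R[THEN conjunct1] show ?thesis by (simp only:)
    qed
    ultimately show "?R n Y" using D(1) by (intro conjI exI)
  qed
  then obtain X where X: "\<And>n. ?R n X" by (elim exE) (rule that, erule spec)
  have "map X [0..<n] \<in> T" for n
    by (rule paths_prefix[OF T X[of n, THEN conjunct1]]) simp
  then have "X \<in> paths T" unfolding paths_def mem_Collect_eq by (rule allI)
  moreover from X[of 0] obtain D where "certifies p X D m" by (elim exE conjE) (rule that)
  ultimately show ?thesis by (intro bexI exI)
qed

end

lemma evaluation_WKL_le: "evaluation WKL \<le>\<^sub>s\<^sub>W finite_parallelization C2"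
proof -
  let ?S = "instances (evaluation WKL)"
  let ?l = "\<lambda>p. LEAST l. decided_at p l"
  \<comment> \<open>At a decided level the values are at most \<open>l\<close>, which leaves the
    \<open>l + 1\<close> candidates from 0 to \<open>l\<close>.\<close>
  let ?k = "\<lambda>p. Suc (?l p)"
  let ?v = "\<lambda>p. race (?k p) (survives p (?l p))"
  let ?F = "\<lambda>p. tjoin [num (?k p), tjoin (map (?v p) [0..<?k p])]"
  \<comment> \<open>The first component with answer 0; its index is the chosen value, so the
    instance is not consulted.\<close>
  let ?W = "\<lambda>g. LEAST j. g (Suc (prod_encode (j, 0))) = 0"
  have S: "\<exists>f e T X. p = tjoin [f, num e, tree_code T] \<and> is_tree T \<and> infinite T \<and> X \<in> paths T \<and>
      (\<forall>X\<in>paths T. \<exists>D m. certifies p X D m)"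
    if pS: "p \<in> ?S" for p
  proof -
    obtain f e h g where p: "p = tjoin [f, num e, h]" and g: "g \<in> WKL h"
      using pS by (rule evaluationE)
    from g obtain X T where T: "h = tree_code T" "is_tree T" "infinite T" "X \<in> paths T"
      unfolding WKL_def mem_Collect_eq by (elim exE conjE) (rule that)
    have "\<forall>g\<in>WKL h. \<phi> e (tjoin [f, g]) 0 \<noteq> None"
      using pS unfolding p instances_def mem_Collect_eq evaluation_eq by (rule contrapos_np) (rule if_not_P)
    then have total: "\<phi> e (tjoin [f, char_fun {n. X n}]) 0 \<noteq> None" if XT: "X \<in> paths T" for X
      using XT unfolding T(1) WKL_eq[OF T(2,3)] by (elim ballE) (assumption, blast)
    have "\<exists>D m. certifies p X D m" if XT: "X \<in> paths T" for X
      using total[OF XT] unfolding p not_None_eq phi_iff_certifies[where h = h] by (elim exE) (intro exI)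
    moreover have "p = tjoin [f, num e, tree_code T]" using p T(1) by simp
    ultimately have "p = tjoin [f, num e, tree_code T] \<and> is_tree T \<and> infinite T \<and> X \<in> paths T \<and>
        (\<forall>X\<in>paths T. \<exists>D m. certifies p X D m)"
      using T(2-4) by (intro conjI ballI)
    then show ?thesis by (intro exI)
  qed
  have ex: "\<exists>l. decided_at p l" if pS: "p \<in> ?S" for p
  proof -
    from S[OF pS] obtain f e T where 1: "p = tjoin [f, num e, tree_code T]" "is_tree T"
      "\<forall>X\<in>paths T. \<exists>D m. certifies p X D m"
      by (elim exE conjE) (rule that)
    then show ?thesis by (rule ex_decided_at)
  qed
  have l: "computable_on ?S (\<lambda>p x. ?l p)"
  proof (rule computable_on_Least)
    show "decidable_on ?S (\<lambda>p z. decided_at p (psnd z))"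
      by (rule decidable_on_compose[OF decidable_on_decided_at]) (intro comp)
  qed (rule ex)
  have v: "computable_on ?S (\<lambda>p z. ?v p (pfst z) (psnd z))"
    by (rule computable_on_race[OF decidable_on_survives[OF l] computable_on_Suc[OF l]])
  have t: "computable_on ?S (\<lambda>p z. tjoin (map (?v p) [0..<?k p]) (psnd z))"
    by (rule computable_on_compose[OF computable_on_tjoin_list[OF computable_on_Suc[OF l] v]]) (intro comp)
  have F: "computable_on ?S ?F"
    by (rule computable_on_tjoin2[OF computable_on_num t computable_on_id])
      (rule computable_on_Suc[OF l], intro comp)
  have sol: "\<exists>is. g = tjoin (map num is) \<and> length is = ?k p \<and>
      (\<forall>j<?k p. is ! j < 2 \<and> is ! j \<notin> range (?v p j))"
    if g: "g \<in> finite_parallelization C2 (?F p)" for p g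
  proof -
    from g obtain "is" where "is": "g = tjoin (map num is)" "length is = ?k p"
      "\<forall>j<?k p. C2_instance (map (?v p) [0..<?k p] ! j) \<and> is ! j < 2 \<and>
        is ! j \<notin> range (map (?v p) [0..<?k p] ! j)"
      unfolding C2_star_iff by (elim exE conjE) (rule that)
    have "is ! j < 2 \<and> is ! j \<notin> range (?v p j)" if j: "j < ?k p" for j
    proof -
      have nth: "map (?v p) [0..<?k p] ! j = ?v p j" using nth_map_upt[of j "?k p" 0 "?v p"] j by simp
      from "is"(3)[rule_format, OF j] show ?thesis unfolding nth by (rule conjunct2)
    qed
    with "is"(1,2) show ?thesis by (intro exI[of _ "is"] conjI allI impI) (assumption | blast)+
  qed
  show ?thesis
  proof (rule sW_leI[where \<Psi> = "\<lambda>g. num (?W g)", OF F])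
    show "computable_on (\<Union>p\<in>?S. finite_parallelization C2 (?F p)) (\<lambda>g. num (?W g))" (is "computable_on ?R _")
    proof -
      have "computable_on ?R (\<lambda>g x. ?W g)"
      proof (rule computable_on_Least)
        show "decidable_on ?R (\<lambda>g z. g (Suc (prod_encode (psnd z, 0))) = 0)" by (intro comp)
        fix g assume "g \<in> ?R"
        then obtain p where "g \<in> finite_parallelization C2 (?F p)" by (elim UN_E)
        from sol[OF this] obtain "is" where "g = tjoin (map num is)" by (elim exE conjE) (rule that)
        \<comment> \<open>A join vanishes beyond its last component, so the search halts on any
          solution tuple.\<close>
        then have "g (Suc (prod_encode (length is, 0))) = 0" by simp
        then show "\<exists>j. g (Suc (prod_encode (j, 0))) = 0" ..
      qed
      then show ?thesis by (rule computable_on_num[OF _ computable_on_id])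
    qed
  next
    fix p assume pS: "p \<in> ?S"
    from S[OF pS] obtain f e T X where T: "p = tjoin [f, num e, tree_code T]" "is_tree T"
      "infinite T" "X \<in> paths T" "\<forall>X\<in>paths T. \<exists>D m. certifies p X D m"
      by (elim exE conjE) (rule that)
    note ctx = T(1,2,5)
    have inst: "C2_instance (?v p j)" for j
      by (rule C2_instance_race) (rule survives_antimono[OF ctx])
    have l: "decided_at p (?l p)" using ex[OF pS] by (rule LeastI_ex)
    obtain i where i: "\<And>j. i j < 2 \<and> i j \<notin> range (?v p j)"
    proof -
      have "\<forall>j. \<exists>i. i < 2 \<and> i \<notin> range (?v p j)"
        by (rule allI) (rule C2_instance_solution[OF inst])
      from choice[OF this] show ?thesis by (elim exE) (rule that, erule spec)
    qed
    have "tjoin (map num (map i [0..<?k p])) \<in> finite_parallelization C2 (?F p)"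
      unfolding C2_star_iff
    proof (intro conjI exI[of _ "map i [0..<?k p]"] allI impI)
      fix j assume j: "j < ?k p"
      have nth: "map (?v p) [0..<?k p] ! j = ?v p j" "map i [0..<?k p] ! j = i j"
        using nth_map_upt[of j "?k p" 0 "?v p"] nth_map_upt[of j "?k p" 0 i] j by simp_all
      show "C2_instance (map (?v p) [0..<?k p] ! j)" unfolding nth by (rule inst)
      show "map i [0..<?k p] ! j < 2" unfolding nth by (rule i[THEN conjunct1])
      show "map i [0..<?k p] ! j \<notin> range (map (?v p) [0..<?k p] ! j)"
        unfolding nth by (rule i[THEN conjunct2])
    qed (simp_all only: length_map length_upt diff_zero One_nat_def Suc_le_mono le0)
    then show "?F p \<in> instances (finite_parallelization C2)"
      by (rule instancesI[where P = "finite_parallelization C2" and f = "?F p"])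
    fix g assume "g \<in> finite_parallelization C2 (?F p)"
    from sol[OF this] obtain "is" where "is": "g = tjoin (map num is)" "length is = ?k p"
      "\<And>j. j < ?k p \<Longrightarrow> is ! j < 2 \<and> is ! j \<notin> range (?v p j)"
      by (elim exE conjE) (rule that, assumption+, elim allE impE)
    let ?i = "\<lambda>j. g (Suc (prod_encode (j, 0)))"
    have i: "?i j < 2 \<and> ?i j \<notin> range (?v p j)" if j: "j < ?k p" for j
    proof -
      have eq: "?i j = is ! j" using j "is"(2) unfolding "is"(1) by simp
      show ?thesis unfolding eq using j by (rule "is"(3))
    qed
    from ex_survivor[OF ctx l T(4)] obtain m where m: "m \<le> ?l p" "\<And>s. survives p (?l p) m s"
      by (elim exE conjE) (rule that, assumption, erule spec)
    have "survives p (?l p) (?W g) s" for s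
    proof (rule race_winner[where alive = "survives p (?l p)" and m = m and k = "?k p" and i = ?i])
      fix m' s t assume "s \<le> t" "survives p (?l p) m' t"
      then show "survives p (?l p) m' s" by (rule survives_antimono[OF ctx])
    qed (rule le_imp_less_Suc[OF m(1)], rule m(2), rule i)
    from survivor_path[OF ctx this] obtain Y D where Y: "Y \<in> paths T" "certifies p Y D (?W g)"
      by (elim bexE exE) (rule that)
    have "char_fun {n. Y n} \<in> WKL (tree_code T)"
      unfolding WKL_eq[OF T(2,3)] mem_Collect_eq
      by (rule exI[of _ Y], rule conjI, rule refl, rule Y(1))
    moreover have "\<phi> e (tjoin [f, char_fun {n. Y n}]) 0 = Some (?W g)"
      unfolding phi_iff_certifies[where h = "tree_code T"] T(1)[symmetric] using Y(2) by (rule exI)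
    ultimately have W: "num (?W g) \<in> {num y |y. \<exists>g\<in>WKL (tree_code T). \<phi> e (tjoin [f, g]) 0 = Some y}"
      unfolding mem_Collect_eq by (intro exI[of _ "?W g"] conjI refl bexI[of _ "char_fun {n. Y n}"])
    have "\<forall>g\<in>WKL (tree_code T). \<phi> e (tjoin [f, g]) 0 \<noteq> None"
      using pS unfolding T(1) instances_def mem_Collect_eq evaluation_eq by (rule contrapos_np) (rule if_not_P)
    then have "evaluation WKL p = {num y |y. \<exists>g\<in>WKL (tree_code T). \<phi> e (tjoin [f, g]) 0 = Some y}"
      unfolding T(1) evaluation_eq by (rule if_P)
    with W show "num (?W g) \<in> evaluation WKL p" by (rule back_subst[where P = "\<lambda>A. _ \<in> A", OF _ sym])
  qed
qed

section \<open>Finitely many choices reduce to a tree of positive measure\<close>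

text \<open>\<open>finite_parallelization C2\<close> with the answers packed into one number: the
  number of components paired with the code of a set whose members below \<open>k\<close> are the
  indices answered 1. This makes \<open>le_first_order_part\<close> applicable.\<close>

definition coded_choice :: problem where
  "coded_choice q = {num c |c k fs. q = tjoin [num k, tjoin fs] \<and> 1 \<le> k \<and> length fs = k \<and>
     pfst c = k \<and> (\<forall>j<k. C2_instance (fs ! j) \<and> of_bool (bits (psnd c) j) \<notin> range (fs ! j))}"

lemma coded_choiceE:
  assumes "g \<in> coded_choice q"
  obtains c k fs where "g = num c" "q = tjoin [num k, tjoin fs]" "1 \<le> k" "length fs = k" "pfst c = k"
    "\<forall>j<k. C2_instance (fs ! j) \<and> of_bool (bits (psnd c) j) \<notin> range (fs ! j)"
  using assms unfolding coded_choice_def mem_Collect_eq by (elim exE conjE) (rule that)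

lemma coded_choiceI:
  assumes "1 \<le> k" "length fs = k" "pfst c = k"
    "\<forall>j<k. C2_instance (fs ! j) \<and> of_bool (bits (psnd c) j) \<notin> range (fs ! j)"
  shows "num c \<in> coded_choice (tjoin [num k, tjoin fs])"
  unfolding coded_choice_def mem_Collect_eq
  by (rule exI[of _ c], rule exI[of _ k], rule exI[of _ fs], intro conjI refl assms)

lemma coded_choice_subset: "coded_choice q \<subseteq> range num"
proof
  fix g assume "g \<in> coded_choice q"
  then obtain c where "g = num c" by (rule coded_choiceE)
  then show "g \<in> range num" by (rule range_eqI)
qed

lemma C2_star_le_coded_choice: "finite_parallelization C2 \<le>\<^sub>s\<^sub>W coded_choice"
proof -
  let ?S = "instances (finite_parallelization C2)"
  let ?b = "\<lambda>g j. of_bool (bits (psnd (g 0)) j)"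
  let ?G = "\<lambda>g. tjoin (map (\<lambda>j. num (?b g j)) [0..<pfst (g 0)])"
  show ?thesis
  proof (rule sW_leI[where \<Phi> = "\<lambda>f. f" and \<Psi> = ?G])
    show "computable_on ?S (\<lambda>f. f)" by (intro comp)
    show "computable_on (\<Union>f\<in>?S. coded_choice f) ?G"
      by (rule computable_on_tjoin_list) (intro comp)+
  next
    fix q assume "q \<in> ?S"
    then obtain h where h: "h \<in> finite_parallelization C2 q"
      unfolding instances_def mem_Collect_eq ex_in_conv[symmetric] by (elim exE) (rule that)
    then obtain k fs where q: "q = tjoin [num k, tjoin fs]"
      unfolding finite_parallelization_def mem_Collect_eq by (elim exE conjE) (rule that)
    from h obtain "is" where k: "1 \<le> k" "length fs = k" and "is":
      "\<forall>j<k. C2_instance (fs ! j) \<and> is ! j < 2 \<and> is ! j \<notin> range (fs ! j)"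
      unfolding q C2_star_iff by (elim exE conjE) (rule that)
    let ?A = "{j. j < k \<and> is ! j = 1}"
    let ?c = "prod_encode (k, set_encode ?A)"
    have dec: "set_decode (psnd ?c) = ?A" by simp
    have "num ?c \<in> coded_choice q"
      unfolding q
    proof (rule coded_choiceI[OF k])
      show "\<forall>j<k. C2_instance (fs ! j) \<and> of_bool (bits (psnd ?c) j) \<notin> range (fs ! j)"
      proof (intro allI impI)
        fix j assume j: "j < k"
        note sol = "is"[rule_format, OF j]
        have "is ! j = 0 \<or> is ! j = 1" using sol by linarith
        then have eq: "of_bool (bits (psnd ?c) j) = is ! j" unfolding dec using j by (elim disjE) simp_all
        show "C2_instance (fs ! j) \<and> of_bool (bits (psnd ?c) j) \<notin> range (fs ! j)"
          unfolding eq by (rule conjI, rule sol[THEN conjunct1], rule sol[THEN conjunct2, THEN conjunct2])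
      qed
    qed simp
    then show "q \<in> instances coded_choice" by (rule instancesI[where P = coded_choice and f = q])
  next
    fix q g assume "g \<in> coded_choice q"
    then obtain c k fs where c: "g = num c" "q = tjoin [num k, tjoin fs]" "1 \<le> k" "length fs = k"
      "pfst c = k" "\<forall>j<k. C2_instance (fs ! j) \<and> of_bool (bits (psnd c) j) \<notin> range (fs ! j)"
      by (rule coded_choiceE)
    let ?is = "map (\<lambda>j. of_bool (bits (psnd c) j) :: nat) [0..<k]"
    show "?G g \<in> finite_parallelization C2 q"
      unfolding c(2) C2_star_iff
    proof (intro conjI exI[of _ ?is] allI impI)
      show "?G g = tjoin (map num ?is)" by (simp add: c(1,5) comp_def)
      fix j assume j: "j < k"
      have nth: "?is ! j = of_bool (bits (psnd c) j)" using j by simp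
      note sol = c(6)[rule_format, OF j]
      show "C2_instance (fs ! j)" by (rule sol[THEN conjunct1])
      show "?is ! j < 2" unfolding nth by (rule le_less_trans[OF of_bool_less_eq_one]) simp
      show "?is ! j \<notin> range (fs ! j)" unfolding nth by (rule sol[THEN conjunct2])
    qed (use c(3,4) in simp_all)
  qed
qed

text \<open>The measure is a finite product, and a nonempty set of outcomes of a fair coin has
  positive probability.\<close>

lemma emeasure_cylinder_pos:
  assumes "finite J" "\<And>i. i \<in> J \<Longrightarrow> A i \<noteq> {}"
  shows "0 < emeasure cantor_measure {X. \<forall>i\<in>J. X i \<in> A i}"
proof -
  interpret product_prob_space "\<lambda>_ :: nat. measure_pmf (pmf_of_set (UNIV :: bool set))" UNIV
    by (rule product_prob_spaceI) (rule prob_space_measure_pmf)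
  have "{X \<in> space (\<Pi>\<^sub>M n\<in>UNIV. measure_pmf (pmf_of_set (UNIV :: bool set))). \<forall>i\<in>J. X i \<in> A i} =
      {X. \<forall>i\<in>J. X i \<in> A i}"
    by (simp add: space_PiM)
  then have eq: "emeasure cantor_measure {X. \<forall>i\<in>J. X i \<in> A i} =
      (\<Prod>i\<in>J. emeasure (measure_pmf (pmf_of_set UNIV)) (A i))"
    using emeasure_PiM_Collect[of J A] assms(1) by (simp add: cantor_measure_def)
  have pos: "0 < emeasure (measure_pmf (pmf_of_set (UNIV :: bool set))) (A i)" if "i \<in> J" for i
    using emeasure_measure_pmf_not_zero[of "pmf_of_set (UNIV :: bool set)" "A i"] assms(2)[OF that]
    by (simp add: zero_less_iff_neq_zero)
  have "I \<subseteq> J \<Longrightarrow> 0 < (\<Prod>i\<in>I. emeasure (measure_pmf (pmf_of_set (UNIV :: bool set))) (A i))" if "finite I" for I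
    using that
  proof (induction I rule: finite_induct)
    case (insert i I)
    then show ?case using pos[of i] by (simp add: ennreal_zero_less_mult_iff)
  qed simp
  from this[OF assms(1) order_refl] show ?thesis unfolding eq .
qed

text \<open>
  The paths are \<open>1\<^sup>k 0 i\<^sub>0 \<dots> i\<^bsub>k-1\<^esub> Y\<close>, where each \<open>i\<^sub>j\<close> is a solution of the \<open>j\<close>-th instance and
  \<open>Y\<close> is arbitrary. The number \<open>k\<close> is recorded because a strong reduction cannot consult the
  instance again.
\<close>

abbreviation arity :: "baire \<Rightarrow> nat" where
  "arity q \<equiv> component q 0 0"

text \<open>Position \<open>arity q + 1 + j\<close> holds the answer to instance \<open>j\<close>.
  The stage \<open>s\<close> counts only what is enumerated before it, which makes the condition
  decidable.\<close>

definition allowed :: "baire \<Rightarrow> nat \<Rightarrow> nat \<Rightarrow> bool \<Rightarrow> bool" where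
  "allowed q s i b \<longleftrightarrow> (i < arity q \<longrightarrow> b) \<and> (i = arity q \<longrightarrow> \<not> b) \<and>
    (arity q < i \<and> i \<le> 2 * arity q \<longrightarrow>
      (\<forall>t<s. component q 1 (Suc (prod_encode (i - Suc (arity q), t))) \<noteq> of_bool b))"

text \<open>The length of a string doubles as the stage: longer strings recheck all their bits
  against more of the enumerations, and \<open>allowed_antimono\<close> gives closure under
  prefixes.\<close>

definition choice_tree :: "baire \<Rightarrow> bool list set" where
  "choice_tree q = {map X [0..<n] |X n. \<forall>i<n. allowed q n i (X i)}"

lemma allowed_antimono: "s \<le> t \<Longrightarrow> allowed q t i b \<Longrightarrow> allowed q s i b"
  unfolding allowed_def by (elim conjE) (intro conjI impI allI, simp_all)

lemma mem_choice_tree: "map X [0..<n] \<in> choice_tree q \<longleftrightarrow> (\<forall>i<n. allowed q n i (X i))"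
proof
  assume "map X [0..<n] \<in> choice_tree q"
  then obtain Y m where Y: "map X [0..<n] = map Y [0..<m]" "\<forall>i<m. allowed q m i (Y i)"
    unfolding choice_tree_def mem_Collect_eq by (elim exE conjE) (rule that)
  have m: "m = n" using arg_cong[OF Y(1), of length] by simp
  show "\<forall>i<n. allowed q n i (X i)"
  proof (intro allI impI)
    fix i assume i: "i < n"
    have "X i = Y i" using arg_cong[OF Y(1), of "\<lambda>xs. xs ! i"] i m by simp
    then show "allowed q n i (X i)" using Y(2)[rule_format, of i] i m by simp
  qed
next
  assume "\<forall>i<n. allowed q n i (X i)"
  then show "map X [0..<n] \<in> choice_tree q"
    unfolding choice_tree_def mem_Collect_eq by (intro exI[of _ X] exI[of _ n] conjI refl)
qed

lemma is_tree_choice_tree: "is_tree (choice_tree q)"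
  unfolding is_tree_def
proof (intro ballI allI impI)
  fix \<sigma> \<tau> assume "\<sigma> \<in> choice_tree q" and \<tau>: "prefix \<tau> \<sigma>"
  then obtain X n where X: "\<sigma> = map X [0..<n]" "\<forall>i<n. allowed q n i (X i)"
    unfolding choice_tree_def mem_Collect_eq by (elim exE conjE) (rule that)
  have \<tau>_eq: "\<tau> = take (length \<tau>) \<sigma>" using \<tau> by (metis prefix_def append_eq_conv_conj)
  have len: "length \<tau> \<le> n" using prefix_length_le[OF \<tau>] X(1) by simp
  have "\<tau> = map X [0..<length \<tau>]"
    using \<tau>_eq len unfolding X(1) take_map by (simp add: take_upt)
  moreover have "map X [0..<length \<tau>] \<in> choice_tree q"
    unfolding mem_choice_tree
  proof (intro allI impI)
    fix i assume "i < length \<tau>"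
    then have "allowed q n i (X i)" using X(2)[rule_format, of i] len by simp
    then show "allowed q (length \<tau>) i (X i)" by (rule allowed_antimono[OF len])
  qed
  ultimately show "\<tau> \<in> choice_tree q" by (rule back_subst[where P = "\<lambda>\<sigma>. \<sigma> \<in> choice_tree q", OF _ sym, rotated])
qed

text \<open>Every bit of a path is rechecked at all later stages, and positions above
  \<open>2 * arity q\<close> are free. The paths thus form a cylinder over finitely many
  coordinates.\<close>

lemma paths_choice_tree:
  "paths (choice_tree q) = {X. \<forall>i\<in>{..2 * arity q}. X i \<in> {b. \<forall>s. allowed q s i b}}"
proof (intro set_eqI iffI)
  fix X assume "X \<in> paths (choice_tree q)"
  then have X: "\<forall>i<n. allowed q n i (X i)" for n
    unfolding paths_def mem_Collect_eq mem_choice_tree by (rule spec)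
  \<comment> \<open>A level beyond both the position \<open>i\<close> and the stage \<open>s\<close>
    is inspected.\<close>
  have "allowed q s i (X i)" for i s
    using X[of "max s (Suc i)"] by (intro allowed_antimono[of s "max s (Suc i)"]) simp_all
  then show "X \<in> {X. \<forall>i\<in>{..2 * arity q}. X i \<in> {b. \<forall>s. allowed q s i b}}" by simp
next
  fix X assume "X \<in> {X. \<forall>i\<in>{..2 * arity q}. X i \<in> {b. \<forall>s. allowed q s i b}}"
  then have X: "allowed q s i (X i)" if "i \<le> 2 * arity q" for i s
    using that by simp
  have "allowed q s i (X i)" for i s
  proof (cases "i \<le> 2 * arity q")
    case False
    then show ?thesis by (simp add: allowed_def)
  qed (rule X)
  then show "X \<in> paths (choice_tree q)" unfolding paths_def mem_Collect_eq mem_choice_tree by simp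
qed

text \<open>A number is tested by bounded search for a string that it codes: the length is at most
  the number itself, and \<open>ex_bits\<close> bounds the digits.\<close>

lemma computable_on_choice_tree: "computable_on S (\<lambda>q. tree_code (choice_tree q))"
proof -
  let ?P = "\<lambda>q x. \<exists>n\<le>x. \<exists>c<2 ^ n. x = string_code n (bits c) \<and> (\<forall>i<n. allowed q n i (bits c i))"
  have "computable_on S (\<lambda>q x. of_bool (?P q x))"
    unfolding allowed_def by (intro comp)
  then show ?thesis
  proof (rule computable_on_cong)
    fix q x
    have "x \<in> (\<lambda>\<sigma>. list_encode (map of_bool \<sigma>)) ` choice_tree q \<longleftrightarrow> ?P q x"
    proof
      assume "x \<in> (\<lambda>\<sigma>. list_encode (map of_bool \<sigma>)) ` choice_tree q"
      then obtain \<sigma> where \<sigma>: "x = list_encode (map of_bool \<sigma>)" "\<sigma> \<in> choice_tree q"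
        by (elim imageE) (rule that)
      from \<sigma>(2) obtain X n where X: "\<sigma> = map X [0..<n]" "\<forall>i<n. allowed q n i (X i)"
        unfolding choice_tree_def mem_Collect_eq by (elim exE conjE) (rule that)
      obtain c where c: "c < 2 ^ n" "\<forall>i<n. bits c i = X i"
        using ex_bits[of n X] by (elim exE conjE) (rule that)
      have "x = string_code n X" unfolding \<sigma>(1) X(1) by (simp add: string_code_def comp_def)
      also have "\<dots> = string_code n (bits c)"
        by (rule string_code_cong) (rule c(2)[rule_format, symmetric])
      finally have x: "x = string_code n (bits c)" .
      have "\<forall>i<n. allowed q n i (bits c i)"
      proof (intro allI impI)
        fix i assume i: "i < n"
        show "allowed q n i (bits c i)"
          unfolding c(2)[rule_format, OF i] using i by (rule X(2)[rule_format])
      qed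
      then show "?P q x"
        using c(1) x string_code_ge[of n "bits c"]
        by (intro exI[of _ n] exI[of _ c] conjI) (simp_all only:)
    next
      assume "?P q x"
      then obtain n c where "x = string_code n (bits c)" "\<forall>i<n. allowed q n i (bits c i)"
        by (elim exE conjE) (rule that)
      then show "x \<in> (\<lambda>\<sigma>. list_encode (map of_bool \<sigma>)) ` choice_tree q"
        by (simp only: string_code_mem_iff mem_choice_tree)
    qed
    then show "of_bool (?P q x) = tree_code (choice_tree q) x"
      by (simp only: tree_code_def char_fun_def of_bool_def)
  qed
qed

lemma infinite_paths:
  assumes "X \<in> paths T"
  shows "infinite T"
proof
  assume "finite T"
  moreover have "range (\<lambda>n. map X [0..<n]) \<subseteq> T" using assms unfolding paths_def by auto
  ultimately have "finite (range (\<lambda>n. map X [0..<n]))" by (rule finite_subset[rotated])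
  moreover have "inj (\<lambda>n. map X [0..<n])"
  proof (rule injI)
    fix m n assume "map X [0..<m] = map X [0..<n]"
    from arg_cong[OF this, of length] show "m = n" by simp
  qed
  ultimately show False by (metis finite_imageD infinite_UNIV_nat)
qed

lemma coded_choice_le_WWKL: "coded_choice \<le>\<^sub>s\<^sub>W WWKL"
proof -
  let ?S = "instances coded_choice"
  let ?F = "\<lambda>q. tree_code (choice_tree q)"
  let ?k = "\<lambda>g. LEAST n. g n = (0 :: nat)"
  \<comment> \<open>The first zero of the path marks \<open>k\<close>, and the next \<open>k\<close>
    bits are the answers. A code is found by search, since digits beyond \<open>k\<close> are left
    open.\<close>
  let ?C = "\<lambda>g c. pfst c = ?k g \<and> (\<forall>j<?k g. bits (psnd c) j \<longleftrightarrow> g (Suc (?k g) + j) = 1)"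
  let ?c = "\<lambda>g. LEAST c. ?C g c"
  have exC: "\<exists>c. ?C g c" for g
  proof -
    have "set_decode (set_encode {j. j < ?k g \<and> g (Suc (?k g) + j) = 1}) =
        {j. j < ?k g \<and> g (Suc (?k g) + j) = 1}"
      by (rule set_encode_inverse) simp
    then show ?thesis
      by (intro exI[of _ "prod_encode (?k g, set_encode {j. j < ?k g \<and> g (Suc (?k g) + j) = 1})"]) simp
  qed
  have sol: "\<exists>X. g = char_fun {n. X n} \<and> (\<forall>i\<le>2 * arity q. \<forall>s. allowed q s i (X i))"
    if g: "g \<in> WWKL (?F q)" for q g
  proof -
    from g obtain X T where "g = char_fun {n. X n}" "?F q = tree_code T" "X \<in> paths T"
      unfolding WWKL_def mem_Collect_eq by (elim exE conjE) (rule that)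
    then have "g = char_fun {n. X n} \<and> X \<in> paths (choice_tree q)" by (simp only: tree_code_eq_iff)
    then show ?thesis unfolding paths_choice_tree by (intro exI[of _ X]) simp
  qed
  have k: "?k g = arity q" if g: "g \<in> WWKL (?F q)" for q g
  proof -
    from sol[OF g] obtain X where X: "g = char_fun {n. X n}" "\<And>i s. i \<le> 2 * arity q \<Longrightarrow> allowed q s i (X i)"
      by (elim exE conjE) (rule that, assumption, elim allE impE)
    have "\<not> X (arity q)" using X(2)[of "arity q" 0] by (simp add: allowed_def)
    moreover have "X i" if "i < arity q" for i using X(2)[of i 0] that by (simp add: allowed_def)
    ultimately show ?thesis
      unfolding X(1) char_fun_Collect by (intro Least_equality) (simp, metis leI of_bool_eq_0_iff)
  qed
  show ?thesis
  proof (rule sW_leI[where \<Phi> = ?F and \<Psi> = "\<lambda>g. num (?c g)"])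
    show "computable_on ?S ?F" by (rule computable_on_choice_tree)
    show "computable_on (\<Union>q\<in>?S. WWKL (?F q)) (\<lambda>g. num (?c g))" (is "computable_on ?R _")
    proof -
      have k': "computable_on ?R (\<lambda>g x. ?k g)"
      proof (rule computable_on_Least)
        show "decidable_on ?R (\<lambda>g z. g (psnd z) = 0)" by (intro comp)
        fix g assume "g \<in> ?R"
        then obtain q where "g \<in> WWKL (?F q)" by (elim UN_E)
        from sol[OF this] obtain X where X: "g = char_fun {n. X n}" "\<And>i s. i \<le> 2 * arity q \<Longrightarrow> allowed q s i (X i)"
          by (elim exE conjE) (rule that, assumption, elim allE impE)
        have "\<not> X (arity q)" using X(2)[of "arity q" 0] by (simp add: allowed_def)
        then show "\<exists>n. g n = 0" unfolding X(1) char_fun_Collect by (intro exI[of _ "arity q"]) simp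
      qed
      have "computable_on ?R (\<lambda>g x. ?c g)"
        by (rule computable_on_Least) (intro comp k', rule exC)
      then show ?thesis by (rule computable_on_num[OF _ computable_on_id])
    qed
  next
    fix q assume "q \<in> ?S"
    then obtain h where "h \<in> coded_choice q"
      unfolding instances_def mem_Collect_eq ex_in_conv[symmetric] by (elim exE) (rule that)
    then obtain c k fs where q: "q = tjoin [num k, tjoin fs]" "length fs = k"
      and C2: "\<forall>j<k. C2_instance (fs ! j) \<and> of_bool (bits (psnd c) j) \<notin> range (fs ! j)"
      by (rule coded_choiceE)
    have arity: "arity q = k" by (simp add: q(1))
    have comp1: "component q 1 (Suc (prod_encode (j, t))) = (fs ! j) t" if "j < k" for j t
      using that q(2) by (simp add: q(1))
    have nonempty: "{b. \<forall>s. allowed q s i b} \<noteq> {}" if i: "i \<in> {..2 * arity q}" for i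
    proof (cases "k < i")
      case True
      \<comment> \<open>The instance lies in the domain, so a solution is at hand, and its bit is
        never enumerated.\<close>
      let ?j = "i - Suc k"
      have j: "?j < k" using True i arity by simp
      have "(fs ! ?j) t \<noteq> of_bool (bits (psnd c) ?j)" for t
        using C2[rule_format, OF j, THEN conjunct2] by (metis rangeI)
      then have "allowed q s i (bits (psnd c) ?j)" for s
        unfolding allowed_def arity using True comp1[OF j] by simp
      then have "bits (psnd c) ?j \<in> {b. \<forall>s. allowed q s i b}" by simp
      then show ?thesis unfolding ex_in_conv[symmetric] by (rule exI)
    next
      case False
      \<comment> \<open>The header is forced: ones before position \<open>k\<close>, a zero at
        \<open>k\<close>.\<close>
      then have "allowed q s i (i < k)" for s
        unfolding allowed_def arity by simp
      then have "(i < k) \<in> {b. \<forall>s. allowed q s i b}" by simp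
      then show ?thesis unfolding ex_in_conv[symmetric] by (rule exI)
    qed
    have meas: "0 < emeasure cantor_measure (paths (choice_tree q))"
      unfolding paths_choice_tree by (rule emeasure_cylinder_pos[OF finite_atMost nonempty])
    then have "paths (choice_tree q) \<noteq> {}" by (intro notI) simp
    then obtain X where X: "X \<in> paths (choice_tree q)" unfolding ex_in_conv[symmetric] by (elim exE) (rule that)
    have "char_fun {n. X n} \<in> WWKL (?F q)"
      unfolding WWKL_def mem_Collect_eq
      by (rule exI[of _ X], rule exI[of _ "choice_tree q"])
        (intro conjI refl is_tree_choice_tree infinite_paths[OF X] meas X)
    then show "?F q \<in> instances WWKL" by (rule instancesI[where P = WWKL and f = "?F q"])
    fix g assume g: "g \<in> WWKL (?F q)"
    have kg: "?k g = k" using k[OF g] arity by (rule trans)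
    from sol[OF g] obtain Y where Y: "g = char_fun {n. Y n}" "\<And>i s. i \<le> 2 * k \<Longrightarrow> allowed q s i (Y i)"
      unfolding arity by (elim exE conjE) (rule that, assumption, elim allE impE)
    define d where "d = ?c g"
    have "?C g d" unfolding d_def using exC by (rule LeastI_ex)
    then have d: "pfst d = k \<and> (\<forall>j<k. bits (psnd d) j \<longleftrightarrow> g (Suc k + j) = 1)"
      unfolding kg .
    show "num (?c g) \<in> coded_choice q"
      unfolding d_def[symmetric] q(1)
    proof (rule coded_choiceI)
      show "1 \<le> k" using \<open>h \<in> coded_choice q\<close> q(1) by (elim coded_choiceE) simp
      show "length fs = k" "pfst d = k" by (rule q(2), rule d[THEN conjunct1])
      show "\<forall>j<k. C2_instance (fs ! j) \<and> of_bool (bits (psnd d) j) \<notin> range (fs ! j)"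
      proof (intro allI impI conjI)
        fix j assume j: "j < k"
        show "C2_instance (fs ! j)" using C2[rule_format, OF j] by (rule conjunct1)
        have eq: "bits (psnd d) j = Y (Suc k + j)"
          unfolding d[THEN conjunct2, rule_format, OF j] Y(1) char_fun_Collect by simp
        have ne: "of_bool (Y (Suc k + j)) \<noteq> (fs ! j) t" for t
        proof -
          \<comment> \<open>Stage \<open>s\<close> covers enumerations strictly before
            \<open>s\<close>, so stage \<open>Suc t\<close> is the first that sees the value at
            \<open>t\<close>.\<close>
          have "allowed q (Suc t) (Suc k + j) (Y (Suc k + j))" by (rule Y(2)) (use j in simp)
          then have "component q 1 (Suc (prod_encode (j, t))) \<noteq> of_bool (Y (Suc k + j))"
            unfolding allowed_def arity using j by simp
          then show ?thesis unfolding comp1[OF j] by (rule not_sym)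
        qed
        show "of_bool (bits (psnd d) j) \<notin> range (fs ! j)"
          unfolding eq by (intro notI, elim rangeE) (rule notE[OF ne])
      qed
    qed
  qed
qed

lemma WWKL_restricts_WKL: "restricts WWKL WKL"
  unfolding restricts_def
proof (intro allI disjCI)
  fix p assume ne: "WWKL p \<noteq> WKL p"
  show "WWKL p = {}"
  proof (rule ccontr)
    assume "WWKL p \<noteq> {}"
    then obtain g where "g \<in> WWKL p" unfolding ex_in_conv[symmetric] by (elim exE) (rule that)
    then obtain T where T: "p = tree_code T" "is_tree T" "infinite T" "emeasure cantor_measure (paths T) > 0"
      unfolding WWKL_def mem_Collect_eq by (elim exE conjE) (rule that)
    have "WWKL p = WKL p" unfolding WWKL_def WKL_def T(1) using T(2-4) by (simp only: tree_code_eq_iff simp_thms) blast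
    with ne show False by contradiction
  qed
qed

theorem theorem4p1:
  fixes n :: nat
  shows "first_order_part (iter_jump WWKL n) \<equiv>\<^sub>s\<^sub>W first_order_part (iter_jump WKL n) \<and>
    first_order_part (iter_jump WKL n) \<equiv>\<^sub>s\<^sub>W iter_jump (finite_parallelization C2) n"
proof -
  let ?C = "iter_jump (finite_parallelization C2) n"
  have 1: "first_order_part (iter_jump WWKL n) \<le>\<^sub>s\<^sub>W first_order_part (iter_jump WKL n)"
    by (intro restricts_sW_le restricts_first_order_part restricts_iter_jump WWKL_restricts_WKL)
  have "first_order_part (iter_jump WKL n) \<le>\<^sub>s\<^sub>W evaluation (iter_jump WKL n)"
    by (rule first_order_part_le_evaluation)
  also have "\<dots> \<le>\<^sub>s\<^sub>W iter_jump (evaluation WKL) n"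
    by (rule evaluation_iter_jump_le)
  also have "\<dots> \<le>\<^sub>s\<^sub>W ?C"
    by (rule iter_jump_mono) (rule evaluation_WKL_le)
  finally have 2: "first_order_part (iter_jump WKL n) \<le>\<^sub>s\<^sub>W ?C" .
  have "?C \<le>\<^sub>s\<^sub>W iter_jump coded_choice n"
    by (rule iter_jump_mono) (rule C2_star_le_coded_choice)
  \<comment> \<open>Jumps change instances only, so the solutions of the iterated jump of
    \<open>coded_choice\<close> are still numbers; this closes the cycle of three
    reductions.\<close>
  also have "\<dots> \<le>\<^sub>s\<^sub>W first_order_part (iter_jump WWKL n)"
    by (rule le_first_order_part[OF iter_jump_mono[OF coded_choice_le_WWKL] iter_jump_subset])
      (rule coded_choice_subset)
  finally have 3: "?C \<le>\<^sub>s\<^sub>W first_order_part (iter_jump WWKL n)" .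
  show ?thesis
    unfolding sW_equiv_def using 1 2 3 by (intro conjI) (blast intro: sW_le_trans)+
qed

end
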